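(* Let $h\in\mathcal Z_+'$ be real and suppose that $\langle h,\bar f\star f\rangle\ge0$ for all $f\in\mathcal D$. Then $h\in C^\infty(\mathbb R_+)$ and $$(-1)^nh^{(n)}(t)\ge0$$ for all $t>0$ and all $n=0,1,2,\ldots$. The function $h(t)$ admits an analytic continuation to the right half-plane $\operatorname{Re}t>0$, and it is uniformly bounded in every strip $\operatorname{Re}t\in(t_1,t_2)$ where $0<t_1<t_2<\infty$. Moreover, for some $\varkappa\in\mathbb R$ and $C>0$, $$h(t)\le Ct^{-1}(1+|\ln t|)^\varkappa,\qquad t>0.$$
   Context: Notation: $\mathbb R_+=(0,\infty)$. For a topological vector space $\mathcal L$, $\mathcal L'$ is the space of continuous antilinear functionals; brackets $\langle\cdot,\cdot\rangle$ are linear in the first and antilinear in the second argument. $\mathcal Z$ is the set of Schwartz functions $\varphi$ on $\mathbb R$ that extend to entire functions with $|\varphi(z)|\le C_n(1+|z|)^{-n}e^{r|\operatorname{Im}z|}$ for all $n$ and some $r=r(\varphi)>0$ (equivalently, $\mathcal Z$ is the image of $C_0^\infty(\mathbb R)$ under the Fourier transform, with the corresponding topology). $\mathcal Z_+$ is the set of functions $F$ on $\mathbb R_+$ such that $x\mapsto F(e^x)$ belongs to $\mathcal Z$ (with the transferred topology), and $\mathcal Z_+'$ is its dual. The distribution $h$ is real if $\langle h,\bar F\rangle=\overline{\langle h,F\rangle}$ for all $F\in\mathcal Z_+$. Identification of $h\in\mathcal Z_+'$ with a function $h(t)$ means $\langle h,F\rangle=\int_0^\infty h(t)\overline{F(t)}dt$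 for all $F\in\mathcal Z_+$. $\mathcal D$ is the set of functions $f$ on $\mathbb R_+$ such that $e^{x/2}f(e^x)$ belongs to $\mathcal Z$ as a function of $x\in\mathbb R$. The Laplace convolution is $(\bar f_1\star f_2)(t)=\int_0^t\overline{f_1(s)}f_2(t-s)ds$; for $f_1,f_2\in\mathcal D$ it belongs to $\mathcal Z_+$. *)

theory Defs
  imports "HOL-Complex_Analysis.Complex_Analysis"
begin

definition nth_vderiv :: "nat \<Rightarrow> (real \<Rightarrow> 'a::real_normed_vector) \<Rightarrow> real \<Rightarrow> 'a" where
  "nth_vderiv n f = ((\<lambda>g x. vector_derivative g (at x)) ^^ n) f"

text \<open>Only meant for open sets \<open>S\<close>, where the two-sided derivatives at points of \<open>S\<close> do not
  depend on values outside \<open>S\<close>.\<close>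

definition C_infinity_on :: "real set \<Rightarrow> (real \<Rightarrow> 'a::real_normed_vector) \<Rightarrow> bool" where
  "C_infinity_on S f \<longleftrightarrow> (\<forall>n. \<forall>x\<in>S. nth_vderiv n f differentiable (at x))"


section \<open>Compactly supported smooth functions with their inductive limit topology\<close>

definition test_functions_within :: "real \<Rightarrow> (real \<Rightarrow> complex) set" where
  "test_functions_within R = {u. C_infinity_on UNIV u \<and> (\<forall>x. \<bar>x\<bar> > R \<longrightarrow> u x = 0)}"

definition test_functions :: "(real \<Rightarrow> complex) set" where
  "test_functions = (\<Union>R. test_functions_within R)"

text \<open>A base of neighbourhoods of zero for the locally convex inductive limit of the Frechet spaces
  \<open>test_functions_within R\<close>: absolutely convex sets whose intersection with each of
  these spaces is a neighbourhood of zero there.\<close>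

definition test_nbhd :: "(real \<Rightarrow> complex) set \<Rightarrow> bool" where
  "test_nbhd W \<longleftrightarrow> W \<subseteq> test_functions \<and>
     (\<forall>u\<in>W. \<forall>v\<in>W. \<forall>a b. cmod a + cmod b \<le> 1 \<longrightarrow> (\<lambda>x. a * u x + b * v x) \<in> W) \<and>
     (\<forall>R. \<exists>N. \<exists>\<epsilon>>0. \<forall>u\<in>test_functions_within R.
        (\<forall>k\<le>N. \<forall>x. cmod (nth_vderiv k u x) < \<epsilon>) \<longrightarrow> u \<in> W)"

definition test_topology :: "(real \<Rightarrow> complex) topology" where
  "test_topology = topology (\<lambda>U. U \<subseteq> test_functions \<and>
     (\<forall>u\<in>U. \<exists>W. test_nbhd W \<and> (\<forall>w\<in>W. (\<lambda>x. u x + w x) \<in> U)))"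

lemma test_nbhd_Int:
  assumes V: "test_nbhd V" and W: "test_nbhd W"
  shows "test_nbhd (V \<inter> W)"
proof -
  have "\<exists>N. \<exists>\<epsilon>>0. \<forall>u\<in>test_functions_within R.
          (\<forall>k\<le>N. \<forall>x. cmod (nth_vderiv k u x) < \<epsilon>) \<longrightarrow> u \<in> V \<inter> W" for R
  proof -
    obtain M \<delta> where M: "\<delta> > 0" "\<forall>u\<in>test_functions_within R.
        (\<forall>k\<le>M. \<forall>x. cmod (nth_vderiv k u x) < \<delta>) \<longrightarrow> u \<in> V"
      using V unfolding test_nbhd_def by blast
    obtain N \<epsilon> where N: "\<epsilon> > 0" "\<forall>u\<in>test_functions_within R.
        (\<forall>k\<le>N. \<forall>x. cmod (nth_vderiv k u x) < \<epsilon>) \<longrightarrow> u \<in> W"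
      using W unfolding test_nbhd_def by blast
    show ?thesis
      by (rule exI[of _ "max M N"], rule exI[of _ "min \<delta> \<epsilon>"]) (use M N in auto)
  qed
  then show ?thesis
    using V W unfolding test_nbhd_def by auto
qed

lemma istopology_test:
  "istopology (\<lambda>U. U \<subseteq> test_functions \<and>
     (\<forall>u\<in>U. \<exists>W. test_nbhd W \<and> (\<forall>w\<in>W. (\<lambda>x. u x + w x) \<in> U)))"
  unfolding istopology_def
proof (intro conjI allI impI ballI)
  fix S T u
  assume S: "S \<subseteq> test_functions \<and> (\<forall>u\<in>S. \<exists>W. test_nbhd W \<and> (\<forall>w\<in>W. (\<lambda>x. u x + w x) \<in> S))"
    and T: "T \<subseteq> test_functions \<and> (\<forall>u\<in>T. \<exists>W. test_nbhd W \<and> (\<forall>w\<in>W. (\<lambda>x. u x + w x) \<in> T))"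
    and u: "u \<in> S \<inter> T"
  obtain V where "test_nbhd V" "\<forall>w\<in>V. (\<lambda>x. u x + w x) \<in> S"
    using S u by blast
  moreover obtain W where "test_nbhd W" "\<forall>w\<in>W. (\<lambda>x. u x + w x) \<in> T"
    using T u by blast
  ultimately show "\<exists>W. test_nbhd W \<and> (\<forall>w\<in>W. (\<lambda>x. u x + w x) \<in> S \<inter> T)"
    using test_nbhd_Int[of V W] by blast
next
  fix K u
  assume K: "\<forall>S\<in>K. S \<subseteq> test_functions \<and>
      (\<forall>u\<in>S. \<exists>W. test_nbhd W \<and> (\<forall>w\<in>W. (\<lambda>x. u x + w x) \<in> S))"
    and u: "u \<in> \<Union>K"
  then obtain S W where "S \<in> K" "test_nbhd W" "\<forall>w\<in>W. (\<lambda>x. u x + w x) \<in> S"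
    by blast
  then show "\<exists>W. test_nbhd W \<and> (\<forall>w\<in>W. (\<lambda>x. u x + w x) \<in> \<Union>K)"
    by blast
qed auto

lemma openin_test_topology:
  "openin test_topology U \<longleftrightarrow> U \<subseteq> test_functions \<and>
     (\<forall>u\<in>U. \<exists>W. test_nbhd W \<and> (\<forall>w\<in>W. (\<lambda>x. u x + w x) \<in> U))"
  unfolding test_topology_def by (simp add: topology_inverse'[OF istopology_test])


section \<open>The spaces of analytic test functions\<close>

definition schwartz :: "(real \<Rightarrow> complex) set" where
  "schwartz = {\<phi>. C_infinity_on UNIV \<phi> \<and>
     (\<forall>m k. bounded (range (\<lambda>x. x ^ m *\<^sub>R nth_vderiv k \<phi> x)))}"

definition Z_space :: "(real \<Rightarrow> complex) set" where
  "Z_space = {\<phi>. \<phi> \<in> schwartz \<and>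
     (\<exists>\<Phi> r. \<Phi> holomorphic_on UNIV \<and> (\<forall>x::real. \<Phi> (complex_of_real x) = \<phi> x) \<and> r > 0 \<and>
        (\<forall>n::nat. \<exists>C. \<forall>z. cmod (\<Phi> z) \<le> C * exp (r * \<bar>Im z\<bar>) / (1 + cmod z) ^ n))}"

definition inverse_fourier :: "(real \<Rightarrow> complex) \<Rightarrow> real \<Rightarrow> complex" where
  "inverse_fourier \<phi> x = complex_of_real (1 / sqrt (2 * pi)) *
     (LINT \<xi>|lborel. \<phi> \<xi> * exp (\<i> * complex_of_real (x * \<xi>)))"

text \<open>By the Paley--Wiener theorem \<open>inverse_fourier\<close> maps \<open>Z_space\<close> bijectively onto
  \<open>test_functions\<close>, so pulling back transfers the topology and makes the Fourier
  transform a homeomorphism from \<open>test_functions\<close> onto \<open>Z_space\<close>.\<close>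

definition Z_topology :: "(real \<Rightarrow> complex) topology" where
  "Z_topology = pullback_topology Z_space inverse_fourier test_topology"

text \<open>Functions on the half-line \<open>{0<..}\<close> are represented by their extensions by zero
  to the real line; this makes the representing function unique.\<close>

definition Zplus :: "(real \<Rightarrow> complex) set" where
  "Zplus = {F. (\<lambda>x. F (exp x)) \<in> Z_space \<and> (\<forall>t\<le>0. F t = 0)}"

definition Zplus_topology :: "(real \<Rightarrow> complex) topology" where
  "Zplus_topology = pullback_topology Zplus (\<lambda>F x. F (exp x)) Z_topology"

text \<open>Continuous antilinear functionals. The pairing of \<open>h\<close> with \<open>F\<close> is written \<open>h F\<close>;
  the values of \<open>h\<close> outside \<open>Zplus\<close> are irrelevant.\<close>

definition Zplus_dual :: "((real \<Rightarrow> complex) \<Rightarrow> complex) set" where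
  "Zplus_dual = {h. continuous_map Zplus_topology euclidean h \<and>
     (\<forall>F\<in>Zplus. \<forall>G\<in>Zplus. \<forall>a b. h (\<lambda>t. a * F t + b * G t) = cnj a * h F + cnj b * h G)}"

definition real_distribution :: "((real \<Rightarrow> complex) \<Rightarrow> complex) \<Rightarrow> bool" where
  "real_distribution h \<longleftrightarrow> (\<forall>F\<in>Zplus. h (\<lambda>t. cnj (F t)) = cnj (h F))"

definition identified_with ::
  "((real \<Rightarrow> complex) \<Rightarrow> complex) \<Rightarrow> (real \<Rightarrow> complex) \<Rightarrow> bool" where
  "identified_with h k \<longleftrightarrow> (\<forall>F\<in>Zplus.
     set_integrable lborel {0<..} (\<lambda>t. k t * cnj (F t)) \<and>
     h F = (LINT t:{0<..}|lborel. k t * cnj (F t)))"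

definition D_space :: "(real \<Rightarrow> complex) set" where
  "D_space = {f. (\<lambda>x. complex_of_real (exp (x / 2)) * f (exp x)) \<in> Z_space \<and> (\<forall>t\<le>0. f t = 0)}"

text \<open>For \<open>t \<le> 0\<close> the interval of integration is empty and the value is \<open>0\<close>, as required
  for a representative of a function on the half-line.\<close>

definition laplace_conv ::
  "(real \<Rightarrow> complex) \<Rightarrow> (real \<Rightarrow> complex) \<Rightarrow> real \<Rightarrow> complex" (infixl \<open>\<star>\<close> 70) where
  "(f \<star> g) t = (LINT s:{0<..<t}|lborel. f s * g (t - s))"

end

theory Submission
  imports
    "HOL-Probability.Characteristic_Functions"
    "HOL-Probability.Sinc_Integral"
    Defs
begin

text \<open>
  By the Paley--Wiener theorem the functions in \<open>Zplus\<close> are the functions \<open>F\<close> for which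
  \<open>F (exp x)\<close> is the Fourier transform of a smooth function \<open>u\<close> of compact support, so that
  \<open>h\<close> becomes a distribution \<open>L u\<close> on the line. If \<open>exp (x / 2) * f (exp x)\<close> is the Fourier
  transform of \<open>g / Gamma (1 / 2 - i x)\<close>, the Beta integral shows that the Laplace convolution of
  the conjugate of \<open>f\<close> with \<open>f\<close> corresponds to \<open>w / Gamma (1 - i x)\<close>, where \<open>w\<close> is the
  autocorrelation of \<open>g\<close>. The hypothesis therefore says that the distribution
  \<open>B w = L (w / Gamma (1 - i x))\<close> is positive definite.

  Instead of the positive tempered measure provided by the Bochner--Schwartz theorem, we use
  approximating densities \<open>p n y\<close>, the values of \<open>B\<close> at \<open>exp (i x y)\<close> times a slowly varying
  cutoff which is itself an autocorrelation. They are nonnegative, and testing \<open>B\<close> against a fixed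
  autocorrelation bounds their local averages polynomially in \<open>y\<close>, uniformly in \<open>n\<close>.
  Consequently the integrals of \<open>exp (- y) * exp (- z * exp (- y)) * p n y\<close> over \<open>{-n..n}\<close> are
  completely monotone in \<open>z > 0\<close> and uniformly bounded on \<open>Re z \<ge> a\<close> for every \<open>a > 0\<close>. Montel's
  theorem yields a limit \<open>H\<close> inheriting these properties, and dominated convergence
  identifies \<open>h\<close> with \<open>H\<close>.
\<close>

subsection \<open>Smooth functions\<close>

text \<open>Powers are the natural coordinates: if conj f and f are superpositions of s powr (-1/2 +
  i x) and s powr (-1/2 - i y), the Beta integral returns Gamma (1/2 + i x) * Gamma (1/2 - i y) /
  Gamma (1 - i (y - x)) times t powr (- i (y - x)). Dividing by the first two factors leaves a
  kernel in y - x alone; this is legitimate because 1/Gamma is entire. The remaining factor explains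
  the kernel of the representation: exp (v - exp v) has Fourier transform Gamma (1 - i z), and at v
  = ln t - y it equals t * exp (- y) * exp (- t * exp (- y)). Smearing the spectral densities with
  it cancels 1/Gamma and produces a Laplace integral at once. The obstacle is that exp (i x y) lacks
  compact support, so the functional cannot be evaluated at it, while an arbitrary cutoff would
  destroy positivity. The averages grow like a power of their centre ln t, and the kernel
  contributes a factor 1/t; together these are the final growth estimate.\<close>

lemma nth_vderiv_0 [simp]: "nth_vderiv 0 f = f"
  by (simp add: nth_vderiv_def)

lemma nth_vderiv_Suc: "nth_vderiv (Suc n) f = nth_vderiv n (\<lambda>x. vector_derivative f (at x))"
  by (simp add: nth_vderiv_def funpow_Suc_right del: funpow.simps)

lemma nth_vderiv_Suc': "nth_vderiv (Suc n) f x = vector_derivative (nth_vderiv n f) (at x)"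
  by (simp add: nth_vderiv_def)

abbreviation smooth :: "(real \<Rightarrow> complex) \<Rightarrow> bool" where
  "smooth \<equiv> C_infinity_on UNIV"

lemma nth_vderiv_SucI:
  assumes "\<And>x. (f has_vector_derivative g x) (at x)"
  shows "nth_vderiv (Suc n) f = nth_vderiv n g"
proof -
  have "(\<lambda>x. vector_derivative f (at x)) = g"
    using assms by (auto intro: vector_derivative_at)
  then show ?thesis by (simp add: nth_vderiv_Suc)
qed

text \<open>Smoothness is a greatest fixed point: a class of functions in which every member has its
  derivative in the class consists of smooth functions. This suits classes such as Fourier
  integrals, where no formula for the n-th derivative is required.\<close>

lemma smooth_coinduct:
  assumes S: "\<And>f. f \<in> S \<Longrightarrow> \<exists>g\<in>S. \<forall>x. (f has_vector_derivative g x) (at x)" and f: "f \<in> S"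
  shows "smooth f"
proof -
  have "\<forall>x. nth_vderiv n f differentiable (at x)" if "f \<in> S" for n f
    using that
  proof (induction n arbitrary: f)
    case 0
    from S[OF this] show ?case by (metis differentiableI_vector nth_vderiv_0)
  next
    case (Suc n)
    from S[OF Suc.prems] obtain g where g: "g \<in> S" "\<And>x. (f has_vector_derivative g x) (at x)"
      by blast
    show ?case using Suc.IH[OF g(1)] nth_vderiv_SucI[OF g(2)] by simp
  qed
  then show ?thesis using f by (simp add: C_infinity_on_def)
qed

lemma smooth_vderiv: "smooth f \<Longrightarrow> smooth (\<lambda>x. vector_derivative f (at x))"
  unfolding C_infinity_on_def by (metis nth_vderiv_Suc)

lemma smooth_nth_vderiv: "smooth f \<Longrightarrow> smooth (nth_vderiv k f)"
  by (induction k arbitrary: f) (auto simp: nth_vderiv_Suc smooth_vderiv)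

lemma smooth_has_vderiv:
  "smooth f \<Longrightarrow> (f has_vector_derivative vector_derivative f (at x)) (at x)"
  unfolding C_infinity_on_def
  using vector_derivative_works[of f] by (metis UNIV_I nth_vderiv_0)

lemma smooth_continuous: "smooth f \<Longrightarrow> continuous_on A f"
  by (intro continuous_at_imp_continuous_on ballI
      has_vector_derivative_continuous[OF smooth_has_vderiv])

lemma smooth_const [simp]: "smooth (\<lambda>x. c)"
  by (rule smooth_coinduct[of "range (\<lambda>c x. c)"])
     (auto intro: has_vector_derivative_const)

text \<open>Truncating the order makes products accessible to induction: the derivative of a product
  is a sum of products with one order less to go, so the Leibniz formula is avoided.\<close>

definition smooth_upto :: "nat \<Rightarrow> (real \<Rightarrow> complex) \<Rightarrow> bool" where
  "smooth_upto n f \<longleftrightarrow> (\<forall>k\<le>n. \<forall>x. nth_vderiv k f differentiable (at x))"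

lemma smooth_iff_upto: "smooth f \<longleftrightarrow> (\<forall>n. smooth_upto n f)"
  unfolding C_infinity_on_def smooth_upto_def by blast

lemma smooth_upto_0: "smooth_upto 0 f \<longleftrightarrow> (\<forall>x. f differentiable (at x))"
  by (simp add: smooth_upto_def)

lemma all_le_Suc_iff: "(\<forall>k\<le>Suc N. P k) \<longleftrightarrow> P 0 \<and> (\<forall>k\<le>N. P (Suc k))"
  by (metis Suc_le_mono le0 not0_implies_Suc)

lemma smooth_upto_Suc:
  "smooth_upto (Suc n) f \<longleftrightarrow> (\<forall>x. f differentiable (at x)) \<and>
     smooth_upto n (\<lambda>x. vector_derivative f (at x))"
  unfolding smooth_upto_def all_le_Suc_iff by (simp add: nth_vderiv_Suc)

lemma smooth_upto_SucD: "smooth_upto (Suc n) f \<Longrightarrow> smooth_upto n f"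
  by (simp add: smooth_upto_def)

lemma smooth_upto_add:
  "smooth_upto n f \<Longrightarrow> smooth_upto n g \<Longrightarrow> smooth_upto n (\<lambda>x. f x + g x)"
proof (induction n arbitrary: f g)
  case (Suc n)
  then have "(\<lambda>x. vector_derivative (\<lambda>x. f x + g x) (at x)) =
     (\<lambda>x. vector_derivative f (at x) + vector_derivative g (at x))"
    by (simp add: smooth_upto_Suc vector_derivative_works has_vector_derivative_add vector_derivative_at)
  then show ?case using Suc by (simp add: smooth_upto_Suc)
qed (simp add: smooth_upto_0)

lemma smooth_upto_mult:
  "smooth_upto n f \<Longrightarrow> smooth_upto n g \<Longrightarrow> smooth_upto n (\<lambda>x. f x * g x)"
proof (induction n arbitrary: f g)
  case (Suc n)
  then have "(\<lambda>x. vector_derivative (\<lambda>x. f x * g x) (at x)) =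
     (\<lambda>x. f x * vector_derivative g (at x) + vector_derivative f (at x) * g x)"
    by (simp add: smooth_upto_Suc vector_derivative_works has_vector_derivative_mult vector_derivative_at)
  moreover have "smooth_upto n f" "smooth_upto n g"
    using Suc.prems smooth_upto_SucD by blast+
  ultimately show ?case using Suc by (simp add: smooth_upto_Suc smooth_upto_add)
qed (simp add: smooth_upto_0)

lemma smooth_add: "smooth f \<Longrightarrow> smooth g \<Longrightarrow> smooth (\<lambda>x. f x + g x)"
  by (simp add: smooth_iff_upto smooth_upto_add)

lemma smooth_mult: "smooth f \<Longrightarrow> smooth g \<Longrightarrow> smooth (\<lambda>x. f x * g x)"
  by (simp add: smooth_iff_upto smooth_upto_mult)

lemma smooth_cmult: "smooth f \<Longrightarrow> smooth (\<lambda>x. c * f x)"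
  by (intro smooth_mult smooth_const)

lemma smooth_diff: "smooth f \<Longrightarrow> smooth g \<Longrightarrow> smooth (\<lambda>x. f x - g x)"
  using smooth_add[of f "\<lambda>x. - 1 * g x"] smooth_cmult[of g "- 1"] by simp

lemma smooth_affine:
  assumes "smooth f" shows "smooth (\<lambda>x. f (a * x + b))"
\<comment> \<open>The free constant \<open>c\<close> absorbs the factor \<open>a\<close> that each
  differentiation produces, which closes the class.\<close>
proof (rule smooth_coinduct[of "{\<lambda>x. c * f (a * x + b) |f c. smooth f}"])
  fix u assume "u \<in> {\<lambda>x. c * f (a * x + b) |f c. smooth f}"
  then obtain f c where u: "u = (\<lambda>x. c * f (a * x + b))" "smooth f" by blast
  have "((f \<circ> (\<lambda>x. a * x + b)) has_vector_derivative a *\<^sub>R vector_derivative f (at (a * x + b))) (at x)" for x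
    by (rule vector_diff_chain_at) (auto intro!: derivative_eq_intros smooth_has_vderiv u simp: has_real_derivative_iff_has_vector_derivative[symmetric])
  then have "(u has_vector_derivative c * (a *\<^sub>R vector_derivative f (at (a * x + b)))) (at x)" for x
    unfolding u by (intro has_vector_derivative_mult_right) (simp add: o_def)
  then show "\<exists>v\<in>{\<lambda>x. c * f (a * x + b) |f c. smooth f}. \<forall>x. (u has_vector_derivative v x) (at x)"
    using smooth_vderiv[OF u(2)]
    by (intro bexI[of _ "\<lambda>x. (c * a) * vector_derivative f (at (a * x + b))"] CollectI
         exI[of _ "\<lambda>x. vector_derivative f (at x)"] exI[of _ "c * a"])
       (auto simp: scaleR_conv_of_real mult_ac)
next
  show "(\<lambda>x. f (a * x + b)) \<in> {\<lambda>x. c * f (a * x + b) |f c. smooth f}"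
    using assms by (intro CollectI exI[of _ f] exI[of _ 1]) simp
qed

lemma smooth_entire:
  assumes "g holomorphic_on UNIV"
  shows "smooth (\<lambda>x. g (a * complex_of_real x + b))"
proof (rule smooth_coinduct[of "{\<lambda>x. c * g (a * complex_of_real x + b) |c g. g holomorphic_on UNIV}"])
  fix u assume "u \<in> {\<lambda>x. c * g (a * complex_of_real x + b) |c g. g holomorphic_on UNIV}"
  then obtain c g where u: "u = (\<lambda>x. c * g (a * complex_of_real x + b))" "g holomorphic_on UNIV"
    by blast
  have "((\<lambda>z. c * g (a * z + b)) has_field_derivative (c * a) * deriv g (a * z + b)) (at z)" for z
  proof -
    have "(g has_field_derivative deriv g (a * z + b)) (at (a * z + b))"
      using holomorphic_derivI[OF u(2)] by simp
    moreover have "((\<lambda>z. a * z + b) has_field_derivative a) (at z)"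
      by (auto intro!: derivative_eq_intros)
    ultimately have "((\<lambda>z. g (a * z + b)) has_field_derivative deriv g (a * z + b) * a) (at z)"
      by (rule DERIV_chain2)
    from DERIV_cmult[OF this, of c] show ?thesis by (simp add: mult_ac)
  qed
  then have "(u has_vector_derivative (c * a) * deriv g (a * x + b)) (at x)" for x
    unfolding u by (rule has_vector_derivative_real_field)
  then show "\<exists>v\<in>{\<lambda>x. c * g (a * complex_of_real x + b) |c g. g holomorphic_on UNIV}.
      \<forall>x. (u has_vector_derivative v x) (at x)"
    using holomorphic_deriv[OF u(2)] 
    by (intro bexI[of _ "\<lambda>x. (c * a) * deriv g (a * complex_of_real x + b)"] CollectI
         exI[of _ "c * a"] exI[of _ "deriv g"]) auto
next
  show "(\<lambda>x. g (a * complex_of_real x + b)) \<in>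
     {\<lambda>x. c * g (a * complex_of_real x + b) |c g. g holomorphic_on UNIV}"
    using assms by (intro CollectI exI[of _ g] exI[of _ 1]) simp
qed

section \<open>Oscillating exponentials\<close>

definition osc :: "real \<Rightarrow> real \<Rightarrow> complex" where
  "osc y x = exp (\<i> * complex_of_real (y * x))"

lemma norm_osc [simp]: "norm (osc y x) = 1"
  by (simp add: osc_def)

lemma osc_add: "osc (x + y) t = osc x t * osc y t"
  by (simp add: osc_def distrib_left distrib_right exp_add)

lemma osc_add_right: "osc y (s + t) = osc y s * osc y t"
  by (simp add: osc_def distrib_left distrib_right exp_add)

lemma cnj_osc: "cnj (osc y x) = osc (- y) x"
  by (simp add: osc_def exp_cnj)

lemma osc_commute: "osc x y = osc y x"
  by (simp add: osc_def mult.commute)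

lemma osc_0 [simp]: "osc 0 x = 1" "osc x 0 = 1"
  by (simp_all add: osc_def)

lemma osc_measurable [measurable (raw)]:
  "f \<in> borel_measurable M \<Longrightarrow> g \<in> borel_measurable M \<Longrightarrow> (\<lambda>x. osc (f x) (g x)) \<in> borel_measurable M"
  unfolding osc_def by measurable

lemma has_vector_derivative_osc: "(osc y has_vector_derivative (\<i> * y) * osc y x) (at x)"
proof -
  have "((\<lambda>z. exp (\<i> * y * z)) has_field_derivative (\<i> * y) * exp (\<i> * y * z)) (at z)" for z
    by (auto intro!: derivative_eq_intros)
  then show ?thesis
    using has_vector_derivative_real_field[of "\<lambda>z. exp (\<i> * y * z)" _ x]
    by (simp add: osc_def[abs_def] mult.assoc)
qed

lemma nth_vderiv_osc: "nth_vderiv k (\<lambda>x. c * osc y x) = (\<lambda>x. c * (\<i> * y) ^ k * osc y x)"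
proof (induction k arbitrary: c)
  case (Suc k)
  have "((\<lambda>x. c * osc y x) has_vector_derivative (c * (\<i> * y)) * osc y x) (at x)" for x
    using has_vector_derivative_mult_right[OF has_vector_derivative_osc, of c y x]
    by (simp add: mult_ac)
  from nth_vderiv_SucI[OF this] show ?case by (simp only: Suc.IH) (simp add: mult_ac)
qed simp

lemma smooth_osc: "smooth (osc y)"
  using smooth_entire[of exp "\<i> * y" 0] by (simp add: osc_def[abs_def] holomorphic_on_exp mult.assoc)

subsection \<open>Bounds on derivatives\<close>

text \<open>The bound says that the C^N norm on [-R, R] is at most \<open>M\<close>. As a predicate
  it needs no supremum, and it also applies to functions without compact support such as
  \<open>osc y\<close>.\<close>

definition deriv_bound :: "nat \<Rightarrow> real \<Rightarrow> real \<Rightarrow> (real \<Rightarrow> complex) \<Rightarrow> bool" where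
  "deriv_bound N R M f \<longleftrightarrow> (\<forall>k\<le>N. \<forall>x. \<bar>x\<bar> \<le> R \<longrightarrow> norm (nth_vderiv k f x) \<le> M)"

lemma deriv_bound_Suc:
  "deriv_bound (Suc N) R M f \<longleftrightarrow> (\<forall>x. \<bar>x\<bar> \<le> R \<longrightarrow> norm (f x) \<le> M) \<and>
     deriv_bound N R M (\<lambda>x. vector_derivative f (at x))"
  unfolding deriv_bound_def all_le_Suc_iff by (simp add: nth_vderiv_Suc)

lemma deriv_bound_mono: "deriv_bound N R M f \<Longrightarrow> n \<le> N \<Longrightarrow> r \<le> R \<Longrightarrow> M \<le> M' \<Longrightarrow> deriv_bound n r M' f"
  unfolding deriv_bound_def by (meson order_trans)

lemma nth_vderiv_add: "smooth f \<Longrightarrow> smooth g \<Longrightarrow>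
  nth_vderiv k (\<lambda>x. f x + g x) = (\<lambda>x. nth_vderiv k f x + nth_vderiv k g x)"
proof (induction k arbitrary: f g)
  case (Suc k)
  show ?case 
    by (subst nth_vderiv_SucI[OF has_vector_derivative_add[OF Suc.prems[THEN smooth_has_vderiv]]])
       (simp add: Suc smooth_vderiv nth_vderiv_Suc)
qed simp

lemma nth_vderiv_cmult: "smooth f \<Longrightarrow> nth_vderiv k (\<lambda>x. c * f x) = (\<lambda>x. c * nth_vderiv k f x)"
proof (induction k arbitrary: f)
  case (Suc k)
  show ?case 
    by (subst nth_vderiv_SucI[OF has_vector_derivative_mult_right[OF Suc.prems[THEN smooth_has_vderiv]]])
       (simp add: Suc smooth_vderiv nth_vderiv_Suc)
qed simp

lemma nth_vderiv_diff: "smooth f \<Longrightarrow> smooth g \<Longrightarrow>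
  nth_vderiv k (\<lambda>x. f x - g x) = (\<lambda>x. nth_vderiv k f x - nth_vderiv k g x)"
  using nth_vderiv_add[of f "\<lambda>x. - 1 * g x" k] nth_vderiv_cmult[of g k "- 1"] smooth_cmult[of g "- 1"]
  by simp

lemma deriv_bound_add:
  assumes "smooth f" "smooth g" "deriv_bound N R A f" "deriv_bound N R B g"
  shows "deriv_bound N R (A + B) (\<lambda>x. f x + g x)"
  using assms unfolding deriv_bound_def by (auto simp: nth_vderiv_add intro: norm_triangle_mono)

text \<open>Each use of the product rule replaces one product by two, hence the factor
  \<open>2 ^ N\<close>.\<close>

lemma deriv_bound_mult:
  assumes "smooth f" "smooth g" "deriv_bound N R A f" "deriv_bound N R B g" "A \<ge> 0" "B \<ge> 0"
  shows "deriv_bound N R (2 ^ N * A * B) (\<lambda>x. f x * g x)"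
  using assms
proof (induction N arbitrary: f g)
  case 0
  then show ?case by (auto simp: deriv_bound_def norm_mult intro!: mult_mono)
next
  case (Suc N)
  have 0: "norm (f x * g x) \<le> 2 ^ Suc N * A * B" if "\<bar>x\<bar> \<le> R" for x
  proof -
    have "norm (f x * g x) \<le> A * B"
      using Suc.prems that by (auto simp: deriv_bound_Suc norm_mult intro!: mult_mono)
    also have "\<dots> \<le> 2 ^ Suc N * (A * B)"
      using mult_right_mono[OF two_realpow_ge_one[of "Suc N"], of "A * B"] Suc.prems by simp
    finally show ?thesis by (simp add: mult_ac)
  qed
  have f: "deriv_bound N R A f" "deriv_bound N R B g"
    using Suc.prems deriv_bound_mono by (metis lessI less_imp_le order_refl)+
  have D: "(\<lambda>x. vector_derivative (\<lambda>x. f x * g x) (at x)) =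
     (\<lambda>x. f x * vector_derivative g (at x) + vector_derivative f (at x) * g x)"
    using Suc.prems by (auto intro!: vector_derivative_at has_vector_derivative_mult smooth_has_vderiv)
  have "deriv_bound N R (2 ^ N * A * B + 2 ^ N * A * B)
      (\<lambda>x. f x * vector_derivative g (at x) + vector_derivative f (at x) * g x)"
    using Suc.prems f
    by (intro deriv_bound_add Suc.IH smooth_mult smooth_vderiv) (auto simp: deriv_bound_Suc)
  then show ?case using 0 unfolding deriv_bound_Suc D by (simp add: mult_ac)
qed

lemma ex_deriv_bound:
  assumes "smooth f" shows "\<exists>M\<ge>0. deriv_bound N R M f"
proof -
  have "\<exists>M. \<forall>x. \<bar>x\<bar> \<le> R \<longrightarrow> norm (nth_vderiv k f x) \<le> M" for k
  proof -
    have "compact (nth_vderiv k f ` {-R..R})"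
      by (intro compact_continuous_image smooth_continuous smooth_nth_vderiv assms) auto
    then show ?thesis by (force dest!: compact_imp_bounded simp: bounded_iff)
  qed
  then obtain M where M: "\<And>k x. \<bar>x\<bar> \<le> R \<Longrightarrow> norm (nth_vderiv k f x) \<le> M k" by metis
  have "norm (nth_vderiv k f x) \<le> (\<Sum>k\<le>N. \<bar>M k\<bar>)" if "\<bar>x\<bar> \<le> R" "k \<le> N" for k x
  proof -
    have "norm (nth_vderiv k f x) \<le> \<bar>M k\<bar>" using M[OF that(1), of k] by linarith
    also have "\<dots> \<le> (\<Sum>k\<le>N. \<bar>M k\<bar>)" by (rule member_le_sum) (use that in auto)
    finally show ?thesis .
  qed
  then show ?thesis unfolding deriv_bound_def
    by (intro exI[of _ "\<Sum>k\<le>N. \<bar>M k\<bar>"]) (auto simp: sum_nonneg)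
qed

lemma deriv_bound_osc: "deriv_bound N R (norm c * (1 + \<bar>y\<bar>) ^ N) (\<lambda>x. c * osc y x)"
proof -
  have "\<bar>y\<bar> ^ k \<le> (1 + \<bar>y\<bar>) ^ N" if "k \<le> N" for k
  proof -
    have "\<bar>y\<bar> ^ k \<le> (1 + \<bar>y\<bar>) ^ k" by (rule power_mono) auto
    also have "\<dots> \<le> (1 + \<bar>y\<bar>) ^ N" by (rule power_increasing) (use that in auto)
    finally show ?thesis .
  qed
  then show ?thesis unfolding deriv_bound_def nth_vderiv_osc
    by (auto simp: norm_mult norm_power intro!: mult_left_mono)
qed

lemma nth_vderiv_vanish:
  fixes f :: "real \<Rightarrow> complex"
  assumes "open S" "\<And>x. x \<in> S \<Longrightarrow> f x = 0" "x \<in> S"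
  shows "nth_vderiv k f x = 0"
  using assms(3)
proof (induction k arbitrary: x)
  case (Suc k)
  have "(nth_vderiv k f has_vector_derivative 0) (at x)"
    by (rule has_vector_derivative_transform_within_open[OF _ assms(1) Suc.prems, of "\<lambda>x. 0"])
       (auto simp: Suc.IH)
  then show ?case by (simp add: nth_vderiv_Suc' vector_derivative_at)
qed (use assms in simp)

lemma test_functions_withinD:
  assumes "u \<in> test_functions_within R"
  shows "smooth u" "\<bar>x\<bar> > R \<Longrightarrow> u x = 0"
  using assms by (auto simp: test_functions_within_def)

lemma nth_vderiv_outside:
  assumes "u \<in> test_functions_within R" "\<bar>x\<bar> > R"
  shows "nth_vderiv k u x = 0"
proof (rule nth_vderiv_vanish[of "{x. \<bar>x\<bar> > R}"])
  show "open {x. \<bar>x\<bar> > R}" by (intro open_Collect_less continuous_intros)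
qed (use assms in \<open>auto simp: test_functions_within_def\<close>)

text \<open>All derivatives vanish beyond the support, so a bound on [-R, R] is a bound on the line;
  \<open>M \<ge> 0\<close> covers the outside.\<close>

lemma deriv_bound_global:
  assumes "u \<in> test_functions_within R" "deriv_bound N R M u" "M \<ge> 0" "k \<le> N"
  shows "norm (nth_vderiv k u x) \<le> M"
  using assms nth_vderiv_outside[OF assms(1), of x k] unfolding deriv_bound_def
  by (cases "\<bar>x\<bar> \<le> R") auto

lemma test_functions_within_mult:
  "u \<in> test_functions_within R \<Longrightarrow> smooth g \<Longrightarrow> (\<lambda>x. u x * g x) \<in> test_functions_within R"
  by (auto simp: test_functions_within_def smooth_mult)

lemma test_functions_within_add:
  "u \<in> test_functions_within R \<Longrightarrow> v \<in> test_functions_within R \<Longrightarrow> (\<lambda>x. u x + v x) \<in> test_functions_within R"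
  by (auto simp: test_functions_within_def smooth_add)

lemma test_functions_within_cmult:
  "u \<in> test_functions_within R \<Longrightarrow> (\<lambda>x. c * u x) \<in> test_functions_within R"
  by (auto simp: test_functions_within_def smooth_cmult)

lemma test_functions_within_mono:
  "u \<in> test_functions_within R \<Longrightarrow> R \<le> R' \<Longrightarrow> u \<in> test_functions_within R'"
  by (auto simp: test_functions_within_def)

lemma test_functions_within_vderiv:
  assumes "u \<in> test_functions_within R"
  shows "(\<lambda>x. vector_derivative u (at x)) \<in> test_functions_within R"
  using assms nth_vderiv_outside[OF assms, of _ 1] smooth_vderiv[of u]
  by (auto simp: test_functions_within_def nth_vderiv_Suc)

subsection \<open>Fourier integrals of rapidly decaying functions\<close>

text \<open>Unnormalized, with the sign in the exponent used by \<open>inverse_fourier\<close>.\<close>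

definition FT :: "(real \<Rightarrow> complex) \<Rightarrow> real \<Rightarrow> complex" where
  "FT b x = (LINT y|lborel. b y * osc x y)"

text \<open>Moments are what differentiation under the integral sign consumes. Unlike a pointwise
  condition on derivatives, their finiteness survives multiplication by an indicator, which is
  needed to cut \<open>FT\<close> into pieces.\<close>

definition rapid :: "(real \<Rightarrow> complex) \<Rightarrow> bool" where
  "rapid b \<longleftrightarrow> b \<in> borel_measurable borel \<and> (\<forall>k. integrable lborel (\<lambda>y. \<bar>y\<bar> ^ k * norm (b y)))"

lemma rapid_measurable: "rapid b \<Longrightarrow> b \<in> borel_measurable borel"
  by (simp add: rapid_def)

lemma rapid_integrable_norm: "rapid b \<Longrightarrow> integrable lborel (\<lambda>y. norm (b y))"
  using spec[of "\<lambda>k. integrable lborel (\<lambda>y. \<bar>y\<bar> ^ k * norm (b y))" 0] by (simp add: rapid_def)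

lemma rapid_integrable: "rapid b \<Longrightarrow> integrable lborel b"
  using rapid_integrable_norm[of b] rapid_measurable[of b] by (simp add: integrable_norm_iff)

lemma rapid_bound:
  assumes "rapid b" "c \<in> borel_measurable borel" "\<And>y. norm (c y) \<le> C * norm (b y)"
  shows "rapid c"
  unfolding rapid_def
proof (intro conjI allI)
  fix k
  have "integrable lborel (\<lambda>y. C * (\<bar>y\<bar> ^ k * norm (b y)))"
    using assms by (auto simp: rapid_def)
  then show "integrable lborel (\<lambda>y. \<bar>y\<bar> ^ k * norm (c y))"
  proof (rule Bochner_Integration.integrable_bound)
    show "AE y in lborel. norm (\<bar>y\<bar> ^ k * norm (c y)) \<le> norm (C * (\<bar>y\<bar> ^ k * norm (b y)))"
    proof (rule AE_I2)
      fix y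
      have "norm (\<bar>y\<bar> ^ k * norm (c y)) = \<bar>y\<bar> ^ k * norm (c y)" by simp
      also have "\<dots> \<le> \<bar>y\<bar> ^ k * (C * norm (b y))" by (intro mult_left_mono assms) simp
      also have "\<dots> \<le> norm (C * (\<bar>y\<bar> ^ k * norm (b y)))" by (simp add: mult_ac)
      finally show "norm (\<bar>y\<bar> ^ k * norm (c y)) \<le> norm (C * (\<bar>y\<bar> ^ k * norm (b y)))" .
    qed
  qed (use assms in measurable)
qed fact

lemma rapid_moment:
  assumes "rapid b" shows "rapid (\<lambda>y. (\<i> * complex_of_real y) ^ k * b y)"
  unfolding rapid_def
proof (intro conjI allI)
  show "(\<lambda>y. (\<i> * complex_of_real y) ^ k * b y) \<in> borel_measurable borel"
    using rapid_measurable[OF assms] by measurable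
  fix m
  have "integrable lborel (\<lambda>y. \<bar>y\<bar> ^ (m + k) * norm (b y))"
    using assms by (simp add: rapid_def)
  then show "integrable lborel (\<lambda>y. \<bar>y\<bar> ^ m * norm ((\<i> * complex_of_real y) ^ k * b y))"
    by (simp add: norm_mult norm_power power_add mult_ac)
qed

lemma rapid_times_i: "rapid b \<Longrightarrow> rapid (\<lambda>y. \<i> * complex_of_real y * b y)"
  using rapid_moment[of b 1] by simp

lemma integrable_FT: "rapid b \<Longrightarrow> integrable lborel (\<lambda>y. b y * osc x y)"
  by (rule Bochner_Integration.integrable_bound[OF rapid_integrable_norm])
     (use rapid_measurable[of b] in \<open>auto simp: norm_mult\<close>)

lemma norm_FT_le: "rapid b \<Longrightarrow> norm (FT b x) \<le> (LINT y|lborel. norm (b y))"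
  unfolding FT_def by (rule order_trans[OF integral_norm_bound]) (simp add: norm_mult)

lemma FT_add: "rapid a \<Longrightarrow> rapid b \<Longrightarrow> FT (\<lambda>y. a y + b y) x = FT a x + FT b x"
  unfolding FT_def using integrable_FT[of a x] integrable_FT[of b x]
  by (simp add: distrib_right)

lemma FT_diff: "rapid a \<Longrightarrow> rapid b \<Longrightarrow> FT (\<lambda>y. a y - b y) x = FT a x - FT b x"
  unfolding FT_def using integrable_FT[of a x] integrable_FT[of b x]
  by (simp add: left_diff_distrib)

lemma FT_cmult: "FT (\<lambda>y. c * b y) x = c * FT b x"
  unfolding FT_def by (simp add: mult.assoc)

lemma FT_0 [simp]: "FT (\<lambda>y. 0) x = 0"
  by (simp add: FT_def)

lemma osc_taylor: "norm (osc x y - 1 - \<i> * (x * y)) \<le> (x * y)\<^sup>2"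
proof -
  have "norm (osc x y - (\<Sum>k\<le>1. (\<i> * complex_of_real (x * y)) ^ k / fact k)) \<le> \<bar>x * y\<bar> ^ Suc 1 / fact (Suc 1)"
    unfolding osc_def by (rule iexp_approx1)
  also have "\<dots> = (x * y)\<^sup>2 / 2"
    by (simp add: power2_eq_square abs_mult_self_eq del: abs_mult)
  also have "\<dots> \<le> (x * y)\<^sup>2" by simp
  finally show ?thesis by (simp add: diff_diff_eq)
qed

text \<open>A quadratic remainder bound is a convenient certificate for a derivative: it serves both
  for Fourier integrals and for a function that is flat at a point.\<close>

lemma has_vector_derivative_quadratic:
  fixes f :: "real \<Rightarrow> 'a::real_normed_vector"
  assumes "\<And>y. norm (f y - f x - (y - x) *\<^sub>R D) \<le> C * (y - x)\<^sup>2"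
  shows "(f has_vector_derivative D) (at x)"
  unfolding has_vector_derivative_def has_derivative_at_alt
proof (intro conjI allI impI)
  fix e :: real assume e: "e > 0"
  show "\<exists>d>0. \<forall>y. norm (y - x) < d \<longrightarrow> norm (f y - f x - (y - x) *\<^sub>R D) \<le> e * norm (y - x)"
  \<comment> \<open>The summand 1 keeps the denominator positive when \<open>C\<close> is
    zero.\<close>
  proof (intro exI[of _ "e / (\<bar>C\<bar> + 1)"] conjI allI impI)
    fix y assume y: "norm (y - x) < e / (\<bar>C\<bar> + 1)"
    have "norm (f y - f x - (y - x) *\<^sub>R D) \<le> C * (y - x)\<^sup>2" by fact
    also have "\<dots> \<le> (\<bar>C\<bar> + 1) * (y - x)\<^sup>2" by (intro mult_right_mono) auto
    also have "\<dots> = ((\<bar>C\<bar> + 1) * \<bar>y - x\<bar>) * \<bar>y - x\<bar>" by (simp add: power2_eq_square)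
    also have "\<dots> \<le> e * \<bar>y - x\<bar>"
      using y by (intro mult_right_mono) (auto simp: field_simps)
    finally show "norm (f y - f x - (y - x) *\<^sub>R D) \<le> e * norm (y - x)" by simp
  qed (use e in auto)
qed (rule bounded_linear_scaleR_left)

text \<open>The remainder of \<open>osc\<close> is quadratic by \<open>osc_taylor\<close>, so the
  second absolute moment of \<open>b\<close> supplies the constant of
  \<open>has_vector_derivative_quadratic\<close>; no limit theorem for integrals enters.\<close>

lemma FT_has_vector_derivative:
  assumes b: "rapid b"
  shows "(FT b has_vector_derivative FT (\<lambda>y. \<i> * complex_of_real y * b y) x) (at x)"
proof (rule has_vector_derivative_quadratic)
  fix x'
  let ?q = "\<lambda>y. b y * osc x' y - b y * osc x y - (x' - x) *\<^sub>R (\<i> * complex_of_real y * b y * osc x y)"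
  have int: "integrable lborel ?q"
    by (intro Bochner_Integration.integrable_diff integrable_FT b integrable_scaleR_right rapid_times_i)
  have 2: "integrable lborel (\<lambda>y. \<bar>y\<bar> ^ 2 * norm (b y))" using b unfolding rapid_def by blast
  have "FT b x' - FT b x - (x' - x) *\<^sub>R FT (\<lambda>y. \<i> * complex_of_real y * b y) x = (LINT y|lborel. ?q y)"
    unfolding FT_def
    using integrable_FT[OF b] integrable_FT[OF rapid_times_i[OF b]]
    by (subst Bochner_Integration.integral_diff, force intro!: Bochner_Integration.integrable_diff,
        force) (subst Bochner_Integration.integral_diff, auto)
  also have "norm \<dots> \<le> (LINT y|lborel. (x' - x)\<^sup>2 * (\<bar>y\<bar> ^ 2 * norm (b y)))"
  proof (rule Bochner_Integration.integral_norm_bound_integral[OF int])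
    show "integrable lborel (\<lambda>y. (x' - x)\<^sup>2 * (\<bar>y\<bar> ^ 2 * norm (b y)))"
      using 2 by (rule integrable_mult_right)
    fix y
    have "?q y = b y * osc x y * (osc (x' - x) y - 1 - \<i> * complex_of_real ((x' - x) * y))"
      using osc_add[of x "x' - x" y] by (simp add: algebra_simps scaleR_conv_of_real)
    then have "norm (?q y) = norm (b y) * norm (osc (x' - x) y - 1 - \<i> * complex_of_real ((x' - x) * y))"
      by (simp add: norm_mult)
    also have "\<dots> \<le> norm (b y) * ((x' - x) * y)\<^sup>2"
      by (intro mult_left_mono osc_taylor) simp
    finally show "norm (?q y) \<le> (x' - x)\<^sup>2 * (\<bar>y\<bar> ^ 2 * norm (b y))"
      by (simp add: power_mult_distrib mult_ac)
  qed
  finally show "norm (FT b x' - FT b x - (x' - x) *\<^sub>R FT (\<lambda>y. \<i> * complex_of_real y * b y) x)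
      \<le> (LINT y|lborel. \<bar>y\<bar> ^ 2 * norm (b y)) * (x' - x)\<^sup>2"
    by (simp add: mult.commute)
qed

lemma smooth_FT: "rapid b \<Longrightarrow> smooth (FT b)"
  by (rule smooth_coinduct[of "FT ` {b. rapid b}"])
     (auto intro!: rapid_times_i FT_has_vector_derivative bexI[of _ "FT (\<lambda>y. \<i> * complex_of_real y * _ y)"])

lemma nth_vderiv_FT: "rapid b \<Longrightarrow> nth_vderiv k (FT b) = FT (\<lambda>y. (\<i> * complex_of_real y) ^ k * b y)"
proof (induction k arbitrary: b)
  case (Suc k)
  have "nth_vderiv (Suc k) (FT b) = nth_vderiv k (FT (\<lambda>y. \<i> * complex_of_real y * b y))"
    by (rule nth_vderiv_SucI[OF FT_has_vector_derivative[OF Suc.prems]])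
  also have "\<dots> = FT (\<lambda>y. (\<i> * complex_of_real y) ^ k * (\<i> * complex_of_real y * b y))"
    by (rule Suc.IH[OF rapid_times_i[OF Suc.prems]])
  finally show ?case by (simp add: mult_ac)
qed simp

lemma abs_power_le: "k \<le> N \<Longrightarrow> \<bar>y\<bar> ^ k \<le> (1 + \<bar>y\<bar>) ^ N" for y :: real
  by (rule order_trans[OF power_mono[of "\<bar>y\<bar>" "1 + \<bar>y\<bar>"] power_increasing]) auto

lemma rapid_integrable_weight:
  assumes "rapid b" shows "integrable lborel (\<lambda>y. (1 + \<bar>y\<bar>) ^ N * norm (b y))"
proof -
  have "(1 + \<bar>y\<bar>) ^ N * norm (b y) = (\<Sum>k\<le>N. of_nat (N choose k) * (\<bar>y\<bar> ^ k * norm (b y)))" for y :: real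
    by (subst binomial_ring[of "\<bar>y\<bar>" 1, simplified add.commute])
       (simp add: sum_distrib_left mult_ac)
  then show ?thesis using assms
    by (auto simp: rapid_def intro!: Bochner_Integration.integrable_sum integrable_mult_right)
qed

lemma deriv_bound_FT:
  assumes "rapid b"
  shows "deriv_bound N R (LINT y|lborel. (1 + \<bar>y\<bar>) ^ N * norm (b y)) (FT b)"
  unfolding deriv_bound_def
proof (intro allI impI)
  fix k x assume k: "k \<le> N"
  have "norm (nth_vderiv k (FT b) x) \<le> (LINT y|lborel. norm ((\<i> * complex_of_real y) ^ k * b y))"
    unfolding nth_vderiv_FT[OF assms] by (rule norm_FT_le[OF rapid_moment[OF assms]])
  also have "\<dots> \<le> (LINT y|lborel. (1 + \<bar>y\<bar>) ^ N * norm (b y))"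
    by (rule integral_mono[OF rapid_integrable_norm[OF rapid_moment[OF assms]] rapid_integrable_weight[OF assms]])
       (use k in \<open>auto simp: norm_mult norm_power intro!: mult_right_mono abs_power_le\<close>)
  finally show "norm (nth_vderiv k (FT b) x) \<le> (LINT y|lborel. (1 + \<bar>y\<bar>) ^ N * norm (b y))" .
qed

lemma rapid_restrict:
  assumes "rapid a" "S \<in> sets borel" shows "rapid (\<lambda>y. indicator S y * a y)"
  by (rule rapid_bound[OF assms(1), of _ 1])
     (use assms rapid_measurable[OF assms(1)] in \<open>auto simp: indicator_def norm_mult\<close>)

subsection \<open>Antilinear functionals on test functions\<close>

lemma norm_osc_diff_le: "norm (osc y x - osc s x) \<le> \<bar>y - s\<bar> * \<bar>x\<bar>"
proof -
  have "osc y x - osc s x = osc s x * (osc (y - s) x - 1)"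
    using osc_add[of s "y - s" x] by (simp add: algebra_simps)
  moreover have "norm (osc (y - s) x - 1) \<le> \<bar>(y - s) * x\<bar>"
    using iexp_approx1[of "(y - s) * x" 0] by (simp add: osc_def)
  ultimately show ?thesis by (simp add: norm_mult abs_mult)
qed

text \<open>The k-th derivative of \<open>a y * osc y x\<close> in \<open>x\<close> is
  \<open>a y * (\<i> * y) ^ k * osc y x\<close>. The claim is therefore continuity at
  \<open>s\<close> of a curve with values in C^N on [-R, R], obtained from the continuity of the
  finitely many coefficients and the Lipschitz bound for \<open>osc\<close>.\<close>

lemma deriv_bound_osc_continuous:
  assumes a: "isCont a s" and e: "e > 0"
  shows "\<exists>d>0. \<forall>y. \<bar>y - s\<bar> < d \<longrightarrow> (\<forall>k\<le>N. \<forall>x. \<bar>x\<bar> \<le> R \<longrightarrow>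
     norm (a y * (\<i> * y) ^ k * osc y x - a s * (\<i> * s) ^ k * osc s x) \<le> e)"
proof -
  have "\<forall>\<^sub>F y in at s. \<forall>k\<in>{..N}. norm (a y * (\<i> * y) ^ k - a s * (\<i> * s) ^ k) +
     norm (a s * (\<i> * s) ^ k) * (\<bar>y - s\<bar> * \<bar>R\<bar>) < e"
  proof (rule eventually_ball_finite, simp, rule ballI)
    fix k
    have "((\<lambda>y. norm (a y * (\<i> * complex_of_real y) ^ k - a s * (\<i> * s) ^ k) +
       norm (a s * (\<i> * s) ^ k) * (\<bar>y - s\<bar> * \<bar>R\<bar>)) \<longlongrightarrow> norm (a s * (\<i> * s) ^ k - a s * (\<i> * s) ^ k) +
       norm (a s * (\<i> * s) ^ k) * (\<bar>s - s\<bar> * \<bar>R\<bar>)) (at s)"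
      using a unfolding isCont_def by (intro tendsto_intros)
    then show "\<forall>\<^sub>F y in at s. norm (a y * (\<i> * y) ^ k - a s * (\<i> * s) ^ k) +
     norm (a s * (\<i> * s) ^ k) * (\<bar>y - s\<bar> * \<bar>R\<bar>) < e"
      using e by (intro order_tendstoD(2)) auto
  qed
  then obtain d where d: "d > 0" "\<And>y k. y \<noteq> s \<Longrightarrow> \<bar>y - s\<bar> < d \<Longrightarrow> k \<le> N \<Longrightarrow>
     norm (a y * (\<i> * y) ^ k - a s * (\<i> * s) ^ k) + norm (a s * (\<i> * s) ^ k) * (\<bar>y - s\<bar> * \<bar>R\<bar>) < e"
    unfolding eventually_at dist_real_def by auto
  have "norm (a y * (\<i> * y) ^ k * osc y x - a s * (\<i> * s) ^ k * osc s x) \<le> e"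
    if "\<bar>y - s\<bar> < d" "k \<le> N" "\<bar>x\<bar> \<le> R" for y k x
  proof (cases "y = s")
    case False
    have "a y * (\<i> * y) ^ k * osc y x - a s * (\<i> * s) ^ k * osc s x =
       (a y * (\<i> * y) ^ k - a s * (\<i> * s) ^ k) * osc y x + a s * (\<i> * s) ^ k * (osc y x - osc s x)"
      by (simp add: algebra_simps)
    also have "norm \<dots> \<le> norm (a y * (\<i> * y) ^ k - a s * (\<i> * s) ^ k) + 
        norm (a s * (\<i> * s) ^ k) * norm (osc y x - osc s x)"
      by (rule order_trans[OF norm_triangle_ineq]) (simp add: norm_mult)
    also have "\<dots> \<le> norm (a y * (\<i> * y) ^ k - a s * (\<i> * s) ^ k) + 
        norm (a s * (\<i> * s) ^ k) * (\<bar>y - s\<bar> * \<bar>R\<bar>)"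
      using that by (intro add_left_mono mult_left_mono order_trans[OF norm_osc_diff_le]) auto
    also have "\<dots> \<le> e" using d(2)[OF False that(1,2)] by simp
    finally show ?thesis .
  qed (use e in simp)
  then show ?thesis using d(1) by blast
qed

text \<open>The seminorm form of continuity of a distribution: the order \<open>N\<close> and the
  constant \<open>C\<close> may both depend on the support radius \<open>R\<close>. Nothing is known
  about \<open>L\<close> away from test functions.\<close>

locale antilinear_distribution =
  fixes L :: "(real \<Rightarrow> complex) \<Rightarrow> complex"
  assumes antilinear: "\<And>R u v a b. u \<in> test_functions_within R \<Longrightarrow> v \<in> test_functions_within R \<Longrightarrow>
      L (\<lambda>x. a * u x + b * v x) = cnj a * L u + cnj b * L v"
    and bounded: "\<And>R. \<exists>N. \<exists>C\<ge>0. \<forall>u\<in>test_functions_within R. \<forall>M\<ge>0. deriv_bound N R M u \<longrightarrow>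
      norm (L u) \<le> C * M"
begin

text \<open>After multiplication by one fixed test function, \<open>L\<close> becomes continuous on
  all smooth functions, in particular on exponentials and on Fourier integrals.\<close>

lemma bounded_mult:
  assumes \<Theta>: "\<Theta> \<in> test_functions_within R"
  shows "\<exists>C\<ge>0. \<exists>N. \<forall>g M. smooth g \<longrightarrow> M \<ge> 0 \<longrightarrow> deriv_bound N R M g \<longrightarrow>
    norm (L (\<lambda>x. \<Theta> x * g x)) \<le> C * M"
proof -
  obtain N C where C: "C \<ge> 0" "\<And>u M. u \<in> test_functions_within R \<Longrightarrow> M \<ge> 0 \<Longrightarrow>
      deriv_bound N R M u \<Longrightarrow> norm (L u) \<le> C * M" using bounded[of R] by blast
  have sm: "smooth \<Theta>" using \<Theta> by (rule test_functions_withinD)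
  obtain A where A: "A \<ge> 0" "deriv_bound N R A \<Theta>" using ex_deriv_bound[OF sm] by blast
  have "norm (L (\<lambda>x. \<Theta> x * g x)) \<le> (C * (2 ^ N * A)) * M" if "smooth g" "M \<ge> 0" "deriv_bound N R M g" for g M
    using C(2)[OF test_functions_within_mult[OF \<Theta> that(1)] _ deriv_bound_mult[OF sm that(1) A(2) that(3) A(1) that(2)]]
      A(1) that(2) by (simp add: mult_ac)
  then show ?thesis using C(1) A(1) by (intro exI[of _ "C * (2 ^ N * A)"] conjI exI[of _ N]) simp_all
qed

lemma L_combine:
  assumes "\<Theta> \<in> test_functions_within R" "smooth f" "smooth g"
  shows "L (\<lambda>x. \<Theta> x * (a * f x + b * g x)) = cnj a * L (\<lambda>x. \<Theta> x * f x) + cnj b * L (\<lambda>x. \<Theta> x * g x)"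
  using antilinear[OF test_functions_within_mult[OF assms(1,2)] test_functions_within_mult[OF assms(1,3)], of a b]
  by (simp add: algebra_simps)

lemma L_diff:
  assumes "\<Theta> \<in> test_functions_within R" "smooth f" "smooth g"
  shows "L (\<lambda>x. \<Theta> x * (f x - g x)) = L (\<lambda>x. \<Theta> x * f x) - L (\<lambda>x. \<Theta> x * g x)"
  using L_combine[OF assms, of 1 "- 1"] by simp

lemma L_cmult:
  assumes "\<Theta> \<in> test_functions_within R"
  shows "L (\<lambda>x. c * \<Theta> x) = cnj c * L \<Theta>"
  using antilinear[OF assms assms, of c 0] by simp

lemma norm_L_osc_le:
  assumes "\<Theta> \<in> test_functions_within R"
  shows "\<exists>N. \<exists>C\<ge>0. \<forall>y. norm (L (\<lambda>x. \<Theta> x * osc y x)) \<le> C * (1 + \<bar>y\<bar>) ^ N"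
proof -
  obtain C N where "C \<ge> 0" "\<And>g M. smooth g \<Longrightarrow> M \<ge> 0 \<Longrightarrow> deriv_bound N R M g \<Longrightarrow>
    norm (L (\<lambda>x. \<Theta> x * g x)) \<le> C * M" using bounded_mult[OF assms] by auto
  moreover have "deriv_bound N R ((1 + \<bar>y\<bar>) ^ N) (osc y)" for y
    using deriv_bound_osc[of N R 1 y] by simp
  ultimately show ?thesis using smooth_osc
    by (intro exI[of _ N] exI[of _ C] conjI allI) simp_all
qed

lemma continuous_L_osc:
  assumes "\<Theta> \<in> test_functions_within R"
  shows "isCont (\<lambda>y. L (\<lambda>x. \<Theta> x * osc y x)) s"
proof -
  obtain C N where C: "C \<ge> 0" "\<And>g M. smooth g \<Longrightarrow> M \<ge> 0 \<Longrightarrow> deriv_bound N R M g \<Longrightarrow>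
    norm (L (\<lambda>x. \<Theta> x * g x)) \<le> C * M" using bounded_mult[OF assms] by auto
  show ?thesis unfolding continuous_at_eps_delta
  proof (intro allI impI)
    fix e :: real assume "e > 0"
    \<comment> \<open>Division by \<open>C + 1\<close> is safe for \<open>C = 0\<close>, and C / (C
      + 1) < 1 gives the strict inequality at the end.\<close>
    then have e: "e / (C + 1) > 0" using C(1) by simp
    have "isCont (\<lambda>_. 1 :: complex) s" by simp
    from deriv_bound_osc_continuous[OF this e, of N R] obtain d where d: "d > 0"
      "\<And>y k x. \<bar>y - s\<bar> < d \<Longrightarrow> k \<le> N \<Longrightarrow> \<bar>x\<bar> \<le> R \<Longrightarrow>
       norm ((\<i> * complex_of_real y) ^ k * osc y x - (\<i> * complex_of_real s) ^ k * osc s x) \<le> e / (C + 1)"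
      by auto
    have "dist (L (\<lambda>x. \<Theta> x * osc y x)) (L (\<lambda>x. \<Theta> x * osc s x)) < e" if y: "dist y s < d" for y
    proof -
      have "deriv_bound N R (e / (C + 1)) (\<lambda>x. osc y x - osc s x)"
        unfolding deriv_bound_def nth_vderiv_diff[OF smooth_osc smooth_osc]
        using d(2)[of y] y nth_vderiv_osc[of _ 1] by (simp add: dist_real_def)
      then have "norm (L (\<lambda>x. \<Theta> x * (osc y x - osc s x))) \<le> C * (e / (C + 1))"
        by (intro C(2) smooth_diff smooth_osc less_imp_le[OF e])
      also have "\<dots> < e" using C(1) \<open>e > 0\<close> by (simp add: field_simps)
      finally show ?thesis by (simp add: L_diff[OF assms smooth_osc smooth_osc] dist_norm)
    qed
    then show "\<exists>d>0. \<forall>x'. dist x' s < d \<longrightarrow>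
        dist (L (\<lambda>x. \<Theta> x * osc x' x)) (L (\<lambda>x. \<Theta> x * osc s x)) < e" using d(1) by blast
  qed
qed

end

section \<open>Exchanging the functional with a Fourier integral\<close>

context antilinear_distribution
begin

text \<open>The contribution of a short frequency interval is compared, in the C^N norm, with a
  single exponential weighted by the interval length. The error is the oscillation \<open>e\<close>
  times that length, which is the estimate a derivative requires.\<close>

lemma FT_piece_bound:
  assumes a: "rapid a" "\<And>x. isCont a x" and uv: "u \<le> v" "u \<le> s" "s \<le> v" and e: "e \<ge> 0"
    and d: "\<And>y k x. u \<le> y \<Longrightarrow> y \<le> v \<Longrightarrow> k \<le> N \<Longrightarrow> \<bar>x\<bar> \<le> R \<Longrightarrow>
     norm (a y * (\<i> * complex_of_real y) ^ k * osc y x - a s * (\<i> * complex_of_real s) ^ k * osc s x) \<le> e"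
  shows "deriv_bound N R (e * (v - u))
     (\<lambda>x. FT (\<lambda>y. indicator {u<..v} y * a y) x - complex_of_real (v - u) * a s * osc s x)"
  unfolding deriv_bound_def
proof (intro allI impI)
  fix k x assume k: "k \<le> N" and x: "\<bar>x\<bar> \<le> R"
  let ?b = "\<lambda>y. indicator {u<..v} y * a y"
  have b: "rapid ?b" by (rule rapid_restrict[OF a(1)]) simp
  have sm: "smooth (\<lambda>x. complex_of_real (v - u) * a s * osc s x)" by (rule smooth_cmult[OF smooth_osc])
  define K where "K = a s * (\<i> * complex_of_real s) ^ k * osc s x"
  have int: "integrable lborel (\<lambda>y. (\<i> * complex_of_real y) ^ k * ?b y * osc x y)"
    by (rule integrable_FT[OF rapid_moment[OF b]])
  have int2: "integrable lborel (\<lambda>y. indicator {u<..v} y *\<^sub>R K)"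
    by (rule integrable_indicator) (use uv in auto)
  have "nth_vderiv k (\<lambda>x. FT ?b x - complex_of_real (v - u) * a s * osc s x) x =
     (LINT y|lborel. (\<i> * complex_of_real y) ^ k * ?b y * osc x y) - (LINT y|lborel. indicator {u<..v} y *\<^sub>R K)"
    unfolding nth_vderiv_diff[OF smooth_FT[OF b] sm] nth_vderiv_FT[OF b] nth_vderiv_osc
    using uv by (simp add: FT_def K_def scaleR_conv_of_real)
  also have "\<dots> = (LINT y|lborel. (\<i> * complex_of_real y) ^ k * ?b y * osc x y - indicator {u<..v} y *\<^sub>R K)"
    using int int2 by simp
  also have "norm \<dots> \<le> (LINT y|lborel. indicator {u<..v} y * e)"
  proof (rule Bochner_Integration.integral_norm_bound_integral)
    show "integrable lborel (\<lambda>y. (\<i> * complex_of_real y) ^ k * ?b y * osc x y - indicator {u<..v} y *\<^sub>R K)"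
      using int int2 by simp
    show "integrable lborel (\<lambda>y. indicator {u<..v} y * e)"
      by (intro integrable_mult_left integrable_real_indicator) (use uv in auto)
    fix y
    show "norm ((\<i> * complex_of_real y) ^ k * ?b y * osc x y - indicator {u<..v} y *\<^sub>R K) \<le> indicator {u<..v} y * e"
    proof (cases "y \<in> {u<..v}")
      case True
      then have "norm (a y * (\<i> * complex_of_real y) ^ k * osc y x - K) \<le> e"
        unfolding K_def using d k x by simp
      then show ?thesis using True by (simp add: mult_ac osc_commute[of x y])
    qed simp
  qed
  also have "\<dots> = e * (v - u)" using uv by simp
  finally show "norm (nth_vderiv k (\<lambda>x. FT ?b x - complex_of_real (v - u) * a s * osc s x) x) \<le> e * (v - u)" .
qed

text \<open>Instead of a vector-valued integral the fundamental theorem of calculus is used. The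
  function \<beta> applies \<open>L\<close> to the part of the Fourier integral up to frequency
  \<open>s\<close>; by \<open>FT_piece_bound\<close> its derivative is the desired integrand, and it
  vanishes at \<open>-A\<close> because the interval is empty there. The conjugate of
  \<open>a\<close> reflects antilinearity.\<close>

lemma L_FT_interval:
  assumes \<Theta>: "\<Theta> \<in> test_functions_within R" and a: "rapid a" "\<And>x. isCont a x" and A: "A \<ge> 0"
  shows "((\<lambda>y. cnj (a y) * L (\<lambda>x. \<Theta> x * osc y x)) has_integral
     L (\<lambda>x. \<Theta> x * FT (\<lambda>y. indicator {-A<..A} y * a y) x)) {-A..A}"
proof -
  define \<beta> where "\<beta> s = L (\<lambda>x. \<Theta> x * FT (\<lambda>y. indicator {-A<..s} y * a y) x)" for s
  define p where "p y = L (\<lambda>x. \<Theta> x * osc y x)" for y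
  obtain C N where C: "C \<ge> 0" "\<And>g M. smooth g \<Longrightarrow> M \<ge> 0 \<Longrightarrow> deriv_bound N R M g \<Longrightarrow>
    norm (L (\<lambda>x. \<Theta> x * g x)) \<le> C * M" using bounded_mult[OF \<Theta>] by auto
  have rapid: "rapid (\<lambda>y. indicator {u<..v} y * a y)" for u v
    by (rule rapid_restrict[OF a(1)]) simp
  have split: "\<beta> v - \<beta> u = L (\<lambda>x. \<Theta> x * FT (\<lambda>y. indicator {u<..v} y * a y) x)"
    if "-A \<le> u" "u \<le> v" for u v
  proof -
    have "FT (\<lambda>y. indicator {-A<..v} y * a y) x - FT (\<lambda>y. indicator {-A<..u} y * a y) x
        = FT (\<lambda>y. indicator {u<..v} y * a y) x" for x
      unfolding FT_diff[OF rapid rapid, symmetric]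
      using that by (intro arg_cong[where f="\<lambda>f. FT f x"] ext) (auto simp: indicator_def)
    then show ?thesis unfolding \<beta>_def
      by (simp add: L_diff[OF \<Theta> smooth_FT[OF rapid] smooth_FT[OF rapid], symmetric])
  qed
  have "((\<lambda>s. cnj (a s) * p s) has_integral \<beta> A - \<beta> (-A)) {-A..A}"
  proof (rule fundamental_theorem_of_calculus)
    fix s assume s: "s \<in> {-A..A}"
    show "(\<beta> has_vector_derivative cnj (a s) * p s) (at s within {-A..A})"
      unfolding has_vector_derivative_def has_derivative_within_alt
    proof (intro conjI allI impI)
      fix e :: real assume "e > 0"
      then have e: "e / (C + 1) > 0" using C(1) by simp
      from deriv_bound_osc_continuous[OF a(2)[of s] e, of N R] obtain d where d: "d > 0"
        "\<And>y k x. \<bar>y - s\<bar> < d \<Longrightarrow> k \<le> N \<Longrightarrow> \<bar>x\<bar> \<le> R \<Longrightarrow>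
         norm (a y * (\<i> * complex_of_real y) ^ k * osc y x - a s * (\<i> * complex_of_real s) ^ k * osc s x) \<le> e / (C + 1)"
        by blast
      \<comment> \<open>Taking \<open>s\<close> as the left or as the right endpoint yields the
        right-hand and the left-hand difference quotient from one estimate.\<close>
      have key: "norm (\<beta> v - \<beta> u - (v - u) *\<^sub>R (cnj (a s) * p s)) \<le> e * (v - u)"
        if uv: "-A \<le> u" "u \<le> v" "u \<le> s" "s \<le> v" "s - u < d" "v - s < d" for u v
      proof -
        let ?g = "\<lambda>x. FT (\<lambda>y. indicator {u<..v} y * a y) x - complex_of_real (v - u) * a s * osc s x"
        have sm: "smooth ?g" by (intro smooth_diff smooth_FT rapid smooth_cmult smooth_osc)
        have "deriv_bound N R (e / (C + 1) * (v - u)) ?g"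
          by (rule FT_piece_bound[OF a uv(2-4)]) (use e d uv in auto)
        then have "norm (L (\<lambda>x. \<Theta> x * ?g x)) \<le> C * (e / (C + 1) * (v - u))"
          using e uv by (intro C(2)[OF sm] mult_nonneg_nonneg less_imp_le[OF e]) auto
        also have "\<dots> \<le> e * (v - u)"
          using C(1) \<open>e > 0\<close> uv(2) by (simp add: field_simps mult_left_mono)
        also have "L (\<lambda>x. \<Theta> x * ?g x) = \<beta> v - \<beta> u - (v - u) *\<^sub>R (cnj (a s) * p s)"
          using L_combine[OF \<Theta> smooth_FT[OF rapid] smooth_osc, of 1 u v "- (complex_of_real (v - u) * a s)" s]
          by (simp add: split[OF uv(1,2)] p_def scaleR_conv_of_real algebra_simps)
        finally show ?thesis .
      qed
      show "\<exists>d>0. \<forall>t\<in>{-A..A}. norm (t - s) < d \<longrightarrow>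
          norm (\<beta> t - \<beta> s - (t - s) *\<^sub>R (cnj (a s) * p s)) \<le> e * norm (t - s)"
      proof (intro exI[of _ d] conjI ballI impI d(1))
        fix t assume t: "t \<in> {-A..A}" "norm (t - s) < d"
        show "norm (\<beta> t - \<beta> s - (t - s) *\<^sub>R (cnj (a s) * p s)) \<le> e * norm (t - s)"
        proof (cases "s \<le> t")
          case True
          then show ?thesis using key[of s t] s t d(1) by auto
        next
          case False
          have "\<beta> t - \<beta> s - (t - s) *\<^sub>R (cnj (a s) * p s) = - (\<beta> s - \<beta> t - (s - t) *\<^sub>R (cnj (a s) * p s))"
            by (simp add: algebra_simps)
          then show ?thesis using key[of t s] s t d(1) False by (simp only: norm_minus_cancel) auto
        qed
      qed
    qed (rule bounded_linear_scaleR_left)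
  qed (use A in simp)
  moreover have "\<beta> (-A) = 0"
    unfolding \<beta>_def using L_cmult[OF \<Theta>, of 0] by simp
  ultimately show ?thesis by (simp add: \<beta>_def p_def)
qed

text \<open>Let the interval exhaust the line. The scalar integrals converge because
  \<open>L\<close> grows at most polynomially on exponentials while \<open>a\<close> is rapid; on
  the other side, the C^M norm of the omitted part of \<open>FT a\<close> is bounded by a weighted
  L1 norm over the tail of \<open>a\<close>, which tends to zero.\<close>

lemma L_FT:
  assumes \<Theta>: "\<Theta> \<in> test_functions_within R" and a: "rapid a" "\<And>x. isCont a x"
  shows "integrable lborel (\<lambda>y. cnj (a y) * L (\<lambda>x. \<Theta> x * osc y x))"
    and "L (\<lambda>x. \<Theta> x * FT a x) = (LINT y|lborel. cnj (a y) * L (\<lambda>x. \<Theta> x * osc y x))"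
proof -
  define p where "p y = L (\<lambda>x. \<Theta> x * osc y x)" for y
  define g where "g y = cnj (a y) * p y" for y
  obtain N C where C: "C \<ge> 0" "\<And>y. norm (p y) \<le> C * (1 + \<bar>y\<bar>) ^ N"
    using norm_L_osc_le[OF \<Theta>] unfolding p_def by blast
  have cont: "continuous_on UNIV g"
    unfolding g_def using a(2) continuous_L_osc[OF \<Theta>]
    by (intro continuous_at_imp_continuous_on ballI continuous_intros) (auto simp: p_def)
  then have meas [measurable]: "g \<in> borel_measurable borel"
    by (rule borel_measurable_continuous_onI)
  have W: "integrable lborel (\<lambda>y. C * ((1 + \<bar>y\<bar>) ^ N * norm (a y)))"
    by (rule integrable_mult_right[OF rapid_integrable_weight[OF a(1)]])
  have gW: "norm (g y) \<le> C * ((1 + \<bar>y\<bar>) ^ N * norm (a y))" for y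
    using mult_left_mono[OF C(2)[of y] norm_ge_zero[of "a y"]] by (simp add: g_def norm_mult mult_ac)
  have "integrable lborel g"
    by (rule Bochner_Integration.integrable_bound[OF W])
       (use gW in \<open>auto intro: order_trans[OF _ abs_ge_self]\<close>)
  then show int: "integrable lborel (\<lambda>y. cnj (a y) * L (\<lambda>x. \<Theta> x * osc y x))"
    unfolding g_def p_def .
  define gn where "gn n y = indicator {- real n..real n} y *\<^sub>R g y" for n y
  define c where "c n = L (\<lambda>x. \<Theta> x * FT (\<lambda>y. indicator {- real n<..real n} y * a y) x)" for n
  have cg: "(LINT y|lborel. gn n y) = c n" for n
  proof -
    have "set_integrable lborel {- real n..real n} g"
      unfolding set_integrable_def by (rule borel_integrable_compact) (use cont continuous_on_subset in auto)
    from set_borel_integral_eq_integral[OF this]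
    have "(LINT y|lborel. gn n y) = integral {- real n..real n} g"
      by (simp add: gn_def set_lebesgue_integral_def)
    also have "\<dots> = c n"
      using L_FT_interval[OF \<Theta> a, of "real n"] by (simp add: g_def[abs_def] p_def c_def integral_unique)
    finally show ?thesis .
  qed
  have "(\<lambda>n. LINT y|lborel. gn n y) \<longlonglongrightarrow> (LINT y|lborel. g y)"
  proof (rule integral_dominated_convergence[OF _ _ W])
    show "AE y in lborel. (\<lambda>n. gn n y) \<longlonglongrightarrow> g y"
    proof (rule AE_I2, rule tendsto_eventually)
      fix y :: real
      show "\<forall>\<^sub>F n in sequentially. gn n y = g y"
        using eventually_ge_at_top[of "nat \<lceil>\<bar>y\<bar>\<rceil>"] by eventually_elim (auto simp: gn_def indicator_def)
    qed
    show "AE y in lborel. norm (gn n y) \<le> C * ((1 + \<bar>y\<bar>) ^ N * norm (a y))" for n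
      using gW order_trans[OF norm_ge_zero gW] by (auto simp: gn_def indicator_def)
  qed (auto simp: gn_def)
  then have lim1: "c \<longlonglongrightarrow> (LINT y|lborel. g y)" by (simp add: cg)
  obtain K M where K: "K \<ge> 0" "\<And>g M'. smooth g \<Longrightarrow> M' \<ge> 0 \<Longrightarrow> deriv_bound M R M' g \<Longrightarrow>
    norm (L (\<lambda>x. \<Theta> x * g x)) \<le> K * M'" using bounded_mult[OF \<Theta>] by auto
  define t where "t n y = (1 - indicator {- real n<..real n} y) * ((1 + \<bar>y\<bar>) ^ M * norm (a y))" for n y
  have W': "integrable lborel (\<lambda>y. (1 + \<bar>y\<bar>) ^ M * norm (a y))"
    by (rule rapid_integrable_weight[OF a(1)])
  have "(\<lambda>n. LINT y|lborel. t n y) \<longlonglongrightarrow> (LINT y::real|lborel. 0 :: real)"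
  proof (rule integral_dominated_convergence[where w="\<lambda>y. (1 + \<bar>y\<bar>) ^ M * norm (a y)"])
    show "AE y in lborel. (\<lambda>n. t n y) \<longlonglongrightarrow> 0"
    proof (rule AE_I2, rule tendsto_eventually)
      fix y :: real
      show "\<forall>\<^sub>F n in sequentially. t n y = 0"
        using eventually_gt_at_top[of "nat \<lceil>\<bar>y\<bar>\<rceil>"] by eventually_elim (auto simp: t_def indicator_def; linarith)
    qed
    show "AE y in lborel. norm (t n y) \<le> (1 + \<bar>y\<bar>) ^ M * norm (a y)" for n
      by (auto simp: t_def indicator_def)
    show "t n \<in> borel_measurable lborel" for n
      unfolding t_def using rapid_measurable[OF a(1)] by measurable
  qed (simp_all add: W')
  then have t0: "(\<lambda>n. K * (LINT y|lborel. t n y)) \<longlonglongrightarrow> 0"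
    using tendsto_mult_left by fastforce
  have "norm (c n - L (\<lambda>x. \<Theta> x * FT a x)) \<le> K * (LINT y|lborel. t n y)" for n
  proof -
    have r1: "rapid (\<lambda>y. indicator {- real n<..real n} y * a y)"
      by (rule rapid_restrict[OF a(1)]) simp
    have r: "rapid (\<lambda>y. indicator (- {- real n<..real n}) y * a y)"
      by (rule rapid_restrict[OF a(1)]) simp
    have "FT a x - FT (\<lambda>y. indicator {- real n<..real n} y * a y) x
        = FT (\<lambda>y. indicator (- {- real n<..real n}) y * a y) x" for x
      unfolding FT_diff[OF a(1) r1, symmetric]
      by (intro arg_cong[where f="\<lambda>f. FT f x"] ext) (auto simp: indicator_def)
    then have "L (\<lambda>x. \<Theta> x * FT a x) - c n = L (\<lambda>x. \<Theta> x * FT (\<lambda>y. indicator (- {- real n<..real n}) y * a y) x)"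
      unfolding c_def by (simp add: L_diff[OF \<Theta> smooth_FT[OF a(1)] smooth_FT[OF r1], symmetric])
    also have "norm \<dots> \<le> K * (LINT y|lborel. (1 + \<bar>y\<bar>) ^ M * norm (indicator (- {- real n<..real n}) y * a y))"
      by (intro K(2) smooth_FT r deriv_bound_FT integral_nonneg_AE) auto
    also have "(\<lambda>y. (1 + \<bar>y\<bar>) ^ M * norm (indicator (- {- real n<..real n}) y * a y)) = t n"
      by (auto simp: t_def indicator_def norm_mult fun_eq_iff)
    finally show ?thesis by (simp add: norm_minus_commute)
  qed
  then have "(\<lambda>n. c n - L (\<lambda>x. \<Theta> x * FT a x)) \<longlonglongrightarrow> 0"
    by (intro Lim_null_comparison[OF _ t0]) simp
  then have "c \<longlonglongrightarrow> L (\<lambda>x. \<Theta> x * FT a x)"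
    by (simp add: LIM_zero_iff)
  from LIMSEQ_unique[OF this lim1]
  show "L (\<lambda>x. \<Theta> x * FT a x) = (LINT y|lborel. cnj (a y) * L (\<lambda>x. \<Theta> x * osc y x))"
    by (simp add: g_def p_def)
qed

end

subsection \<open>Fubini for kernels dominated by a product\<close>

lemma Fubini_dominated:
  fixes K :: "real \<Rightarrow> real \<Rightarrow> complex"
  assumes K [measurable]: "case_prod K \<in> borel_measurable (lborel \<Otimes>\<^sub>M lborel)"
    and a: "integrable lborel a" and b: "integrable lborel b"
    and bound: "\<And>x y. norm (K x y) \<le> a x * b y"
  shows "(LINT x|lborel. LINT y|lborel. K x y) = (LINT y|lborel. LINT x|lborel. K x y)"
proof -
  note [measurable] = borel_measurable_integrable[OF a] borel_measurable_integrable[OF b]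
  have "integrable (lborel \<Otimes>\<^sub>M lborel) (\<lambda>(x, y). a x * b y)"
  proof (rule lborel_pair.Fubini_integrable)
    show "integrable lborel (\<lambda>x. LINT y|lborel. norm (case (x, y) of (x, y) \<Rightarrow> a x * b y))"
      using a b by (auto simp: abs_mult)
  qed (use b in auto)
  then have "integrable (lborel \<Otimes>\<^sub>M lborel) (case_prod K)"
    by (rule Bochner_Integration.integrable_bound)
       (use bound in \<open>auto intro!: AE_I2 order_trans[OF _ abs_ge_self]\<close>)
  from lborel_pair.Fubini_integral[OF this] show ?thesis by simp
qed

subsection \<open>Fourier inversion\<close>

lemma integral_std_normal_density_osc:
  "(LINT v|lborel. complex_of_real (std_normal_density v) * osc t v) =
     complex_of_real (sqrt (2 * pi) * std_normal_density t)"
proof -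
  have "(LINT v|lborel. complex_of_real (std_normal_density v) * osc t v) = char std_normal_distribution t"
    unfolding char_def osc_def by (subst integral_density) (auto simp: scaleR_conv_of_real)
  also have "\<dots> = complex_of_real (sqrt (2 * pi) * std_normal_density t)"
    unfolding char_std_normal_distribution by (simp add: std_normal_density_def)
  finally show ?thesis .
qed

lemma std_normal_density_pos: "std_normal_density v > 0"
  by (simp add: normal_density_pos)

text \<open>The Gaussian factor makes the double integral absolutely convergent, so that Fubini
  applies even though the iterated integral without it need not be absolutely convergent. As the
  Gaussian is its own transform, the result is an average of \<open>f\<close> about
  \<open>- x\<close> of width \<sigma>.\<close>

lemma FT_FT_gaussian:
  fixes f :: "real \<Rightarrow> complex"
  assumes f: "integrable lborel f" and s: "\<sigma> > 0"
  shows "(LINT w|lborel. sqrt (2 * pi) * std_normal_density (\<sigma> * w) * (FT f w * osc x w))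
     = 2 * pi * (LINT v|lborel. f (- x + \<sigma> * v) * std_normal_density v)"
proof -
  define g :: "real \<Rightarrow> real" where "g = std_normal_density"
  have g_meas [measurable]: "g \<in> borel_measurable borel" by (simp add: g_def)
  have f_meas [measurable]: "f \<in> borel_measurable borel" using f by auto
  have "integrable lborel (\<lambda>w. g (0 + \<sigma> * w))"
    unfolding g_def using s by (intro lborel_integrable_real_affine integrable_normal_density) auto
  then have gi: "integrable lborel (\<lambda>w. g (\<sigma> * w))" by simp
  define K where "K w y = g (\<sigma> * w) * (f y * osc (x + y) w)" for w y
  have "(LINT w|lborel. g (\<sigma> * w) * (FT f w * osc x w)) = (LINT w|lborel. LINT y|lborel. K w y)"
  proof (intro Bochner_Integration.integral_cong refl)
    fix w
    have "g (\<sigma> * w) * (FT f w * osc x w) = (g (\<sigma> * w) * osc x w) * (LINT y|lborel. f y * osc w y)"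
      by (simp add: FT_def)
    also have "\<dots> = (LINT y|lborel. (g (\<sigma> * w) * osc x w) * (f y * osc w y))"
      by (rule integral_mult_right_zero[symmetric])
    also have "\<dots> = (LINT y|lborel. K w y)"
      unfolding K_def by (simp add: osc_add osc_commute[of w] mult_ac)
    finally show "g (\<sigma> * w) * (FT f w * osc x w) = (LINT y|lborel. K w y)" .
  qed
  also have "\<dots> = (LINT y|lborel. LINT w|lborel. K w y)"
  proof (rule Fubini_dominated[where a = "\<lambda>w. g (\<sigma> * w)" and b = "\<lambda>y. norm (f y)"])
    show "norm (K w y) \<le> g (\<sigma> * w) * norm (f y)" for w y
      using std_normal_density_pos[of "\<sigma> * w"] by (simp add: K_def norm_mult g_def)
  qed (use gi f in \<open>auto simp: K_def\<close>)
  also have "\<dots> = (LINT y|lborel. f y * complex_of_real (sqrt (2 * pi) / \<sigma> * g ((x + y) / \<sigma>)))"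
  proof (intro Bochner_Integration.integral_cong refl)
    fix y
    have "(LINT w|lborel. K w y) = f y * (LINT w|lborel. g (\<sigma> * w) * osc (x + y) w)"
      unfolding K_def by (subst integral_mult_right_zero[symmetric]) (simp add: mult_ac)
    also have "(LINT w|lborel. g (\<sigma> * w) * osc (x + y) w)
        = \<bar>1 / \<sigma>\<bar> *\<^sub>R (LINT v|lborel. g (\<sigma> * (0 + 1 / \<sigma> * v)) * osc (x + y) (0 + 1 / \<sigma> * v))"
      by (rule lborel_integral_real_affine) (use s in auto)
    also have "(\<lambda>v. g (\<sigma> * (0 + 1 / \<sigma> * v)) * osc (x + y) (0 + 1 / \<sigma> * v)) =
        (\<lambda>v. complex_of_real (std_normal_density v) * osc ((x + y) / \<sigma>) v)"
      using s by (auto simp: g_def osc_def)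
    also have "\<bar>1 / \<sigma>\<bar> *\<^sub>R (LINT v|lborel. \<dots> v) = complex_of_real (sqrt (2 * pi) / \<sigma> * g ((x + y) / \<sigma>))"
      using s by (subst integral_std_normal_density_osc) (simp add: g_def scaleR_conv_of_real)
    finally show "(LINT w|lborel. K w y) = f y * complex_of_real (sqrt (2 * pi) / \<sigma> * g ((x + y) / \<sigma>))" .
  qed
  also have "\<dots> = \<bar>\<sigma>\<bar> *\<^sub>R (LINT v|lborel. f (- x + \<sigma> * v) * complex_of_real (sqrt (2 * pi) / \<sigma> * g ((x + (- x + \<sigma> * v)) / \<sigma>)))"
    by (rule lborel_integral_real_affine) (use s in auto)
  also have "\<dots> = sqrt (2 * pi) * (LINT v|lborel. f (- x + \<sigma> * v) * g v)"
  proof -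
    have "(\<lambda>v. f (- x + \<sigma> * v) * complex_of_real (sqrt (2 * pi) / \<sigma> * g ((x + (- x + \<sigma> * v)) / \<sigma>)))
        = (\<lambda>v. complex_of_real (sqrt (2 * pi) / \<sigma>) * (f (- x + \<sigma> * v) * g v))"
      using s by (auto simp: mult_ac)
    then show ?thesis using s
      by (simp only: integral_mult_right_zero) (simp add: scaleR_conv_of_real)
  qed
  finally have "(LINT w|lborel. g (\<sigma> * w) * (FT f w * osc x w)) = sqrt (2 * pi) * (LINT v|lborel. f (- x + \<sigma> * v) * g v)" .
  moreover have "(LINT w|lborel. sqrt (2 * pi) * std_normal_density (\<sigma> * w) * (FT f w * osc x w)) =
     sqrt (2 * pi) * (LINT w|lborel. g (\<sigma> * w) * (FT f w * osc x w))"
    unfolding g_def by (subst integral_mult_right_zero[symmetric]) (simp add: mult_ac)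
  ultimately show ?thesis by (simp add: g_def of_real_mult[symmetric] mult.assoc[symmetric] del: of_real_mult)
qed

text \<open>Both sides of \<open>FT_FT_gaussian\<close> converge by dominated convergence as
  \<sigma> tends to zero. The reflection appears because both transforms carry the same sign in the
  exponent.\<close>

theorem FT_FT:
  fixes f :: "real \<Rightarrow> complex"
  assumes f: "integrable lborel f" "continuous_on UNIV f" "\<And>x. norm (f x) \<le> B"
    and Ff: "integrable lborel (FT f)"
  shows "FT (FT f) x = 2 * pi * f (- x)"
proof -
  define \<sigma> where "\<sigma> n = inverse (real (Suc n))" for n
  have \<sigma>: "\<sigma> \<longlonglongrightarrow> 0" unfolding \<sigma>_def by (rule LIMSEQ_inverse_real_of_nat)
  have f_meas [measurable]: "f \<in> borel_measurable borel" "FT f \<in> borel_measurable borel" using f Ff by auto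
  have 1: "(\<lambda>n. LINT w|lborel. sqrt (2 * pi) * std_normal_density (\<sigma> n * w) * (FT f w * osc x w))
     \<longlonglongrightarrow> (LINT w|lborel. FT f w * osc x w)"
  proof (rule integral_dominated_convergence[where w = "\<lambda>w. norm (FT f w)"])
    show "AE w in lborel. (\<lambda>n. sqrt (2 * pi) * std_normal_density (\<sigma> n * w) * (FT f w * osc x w)) \<longlonglongrightarrow> FT f w * osc x w"
    proof (rule AE_I2)
      fix w
      have "(\<lambda>n. sqrt (2 * pi) * std_normal_density (\<sigma> n * w)) \<longlonglongrightarrow> sqrt (2 * pi) * std_normal_density (0 * w)"
        unfolding std_normal_density_def by (intro tendsto_intros \<sigma>) auto
      then have "(\<lambda>n. sqrt (2 * pi) * std_normal_density (\<sigma> n * w)) \<longlonglongrightarrow> 1"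
        by (simp add: std_normal_density_def)
      then have "(\<lambda>n. complex_of_real (sqrt (2 * pi) * std_normal_density (\<sigma> n * w)) * (FT f w * osc x w)) \<longlonglongrightarrow> of_real 1 * (FT f w * osc x w)"
        by (intro tendsto_mult tendsto_of_real tendsto_const)
      then show "(\<lambda>n. sqrt (2 * pi) * std_normal_density (\<sigma> n * w) * (FT f w * osc x w)) \<longlonglongrightarrow> FT f w * osc x w"
        by simp
    qed
    show "AE w in lborel. norm (sqrt (2 * pi) * std_normal_density (\<sigma> n * w) * (FT f w * osc x w)) \<le> norm (FT f w)" for n
    proof (rule AE_I2)
      fix w
      have "sqrt (2 * pi) * std_normal_density (\<sigma> n * w) = exp (- (\<sigma> n * w)\<^sup>2 / 2)"
        by (simp add: std_normal_density_def)
      also have "\<dots> \<le> 1" by simp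
      finally have "sqrt (2 * pi) * std_normal_density (\<sigma> n * w) \<le> 1" .
      moreover have "norm (sqrt (2 * pi) * std_normal_density (\<sigma> n * w) * (FT f w * osc x w)) =
         (sqrt (2 * pi) * std_normal_density (\<sigma> n * w)) * norm (FT f w)"
        using std_normal_density_pos[of "\<sigma> n * w"] by (simp add: norm_mult)
      ultimately show "norm (sqrt (2 * pi) * std_normal_density (\<sigma> n * w) * (FT f w * osc x w)) \<le> norm (FT f w)"
        by (simp add: mult_left_le_one_le std_normal_density_pos less_imp_le)
    qed
  qed (use Ff in \<open>auto intro: measurable_compose[OF _ borel_measurable_of_real]\<close>)
  have 2: "(\<lambda>n. 2 * pi * (LINT v|lborel. f (- x + \<sigma> n * v) * std_normal_density v))
     \<longlonglongrightarrow> 2 * pi * (LINT v|lborel. f (- x) * std_normal_density v)"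
  proof (intro tendsto_mult tendsto_const integral_dominated_convergence[where w = "\<lambda>v. B * std_normal_density v"])
    show "integrable lborel (\<lambda>v. B * std_normal_density v)"
      by (intro integrable_mult_right integrable_normal_density) simp
    show "AE v in lborel. (\<lambda>n. f (- x + \<sigma> n * v) * std_normal_density v) \<longlonglongrightarrow> f (- x) * std_normal_density v"
    proof (rule AE_I2)
      fix v
      have "(\<lambda>n. - x + \<sigma> n * v) \<longlonglongrightarrow> - x + 0 * v" by (intro tendsto_intros \<sigma>)
      then have "(\<lambda>n. f (- x + \<sigma> n * v)) \<longlonglongrightarrow> f (- x)"
        using f(2) by (auto simp: continuous_on_eq_continuous_at intro!: isCont_tendsto_compose[of _ f])
      then show "(\<lambda>n. f (- x + \<sigma> n * v) * std_normal_density v) \<longlonglongrightarrow> f (- x) * std_normal_density v"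
        by (intro tendsto_intros)
    qed
    show "AE v in lborel. norm (f (- x + \<sigma> n * v) * std_normal_density v) \<le> B * std_normal_density v" for n
      by (intro AE_I2) (simp add: norm_mult mult_right_mono f(3))
  qed auto
  have s: "\<sigma> n > 0" for n by (simp add: \<sigma>_def)
  have "(LINT v|lborel. f (- x) * std_normal_density v) = f (- x) * complex_of_real (LINT v|lborel. std_normal_density v)"
    by (subst integral_mult_right_zero) (simp add: integral_complex_of_real)
  also have "(LINT v|lborel. std_normal_density v) = 1"
    by (rule integral_normal_density) simp
  finally have "(\<lambda>n. 2 * pi * (LINT v|lborel. f (- x + \<sigma> n * v) * std_normal_density v)) \<longlonglongrightarrow> 2 * pi * f (- x)"
    using 2 by simp
  from LIMSEQ_unique[OF 1[unfolded FT_FT_gaussian[OF f(1) s]] this]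
  show ?thesis unfolding FT_def[of "FT f"] .
qed

lemma integrable_inverse_1_plus_square_lborel: "integrable lborel (\<lambda>x::real. C / (1 + x\<^sup>2))"
proof -
  have "integrable lborel (\<lambda>x::real. inverse (1 + x\<^sup>2))"
    using integrable_inverse_1_plus_square by (simp add: set_integrable_def)
  then have "integrable lborel (\<lambda>x::real. C * inverse (1 + x\<^sup>2))"
    by (rule integrable_mult_right)
  then show ?thesis by (simp add: divide_inverse)
qed

lemma rapid_decay:
  assumes meas [measurable]: "b \<in> borel_measurable borel"
    and decay: "\<And>n. \<exists>C\<ge>0. \<forall>x. norm (b x) \<le> C / (1 + \<bar>x\<bar>) ^ n"
  shows "rapid b"
  unfolding rapid_def
proof (intro conjI allI meas)
  fix k
  \<comment> \<open>Of the \<open>k + 2\<close> powers, \<open>k\<close> compensate the moment and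
    two provide an integrable majorant.\<close>
  obtain C where C: "C \<ge> 0" "\<And>x. norm (b x) \<le> C / (1 + \<bar>x\<bar>) ^ (k + 2)"
    using decay[of "k + 2"] by blast
  show "integrable lborel (\<lambda>y. \<bar>y\<bar> ^ k * norm (b y))"
  proof (rule Bochner_Integration.integrable_bound[OF integrable_inverse_1_plus_square_lborel[of C]])
    show "AE y in lborel. norm (\<bar>y\<bar> ^ k * norm (b y)) \<le> norm (C / (1 + y\<^sup>2))"
    proof (rule AE_I2)
      fix y :: real
      have "\<bar>y\<bar> ^ k * norm (b y) \<le> (1 + \<bar>y\<bar>) ^ k * (C / (1 + \<bar>y\<bar>) ^ (k + 2))"
        by (intro mult_mono power_mono C) auto
      also have "\<dots> = C / (1 + \<bar>y\<bar>)\<^sup>2"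
        by (simp add: power_add power2_eq_square add_pos_nonneg[THEN less_imp_neq, THEN not_sym])
      also have "\<dots> \<le> C / (1 + y\<^sup>2)"
        using C(1) by (intro divide_left_mono mult_pos_pos) (auto simp: power2_eq_square algebra_simps add_pos_nonneg)
      finally show "norm (\<bar>y\<bar> ^ k * norm (b y)) \<le> norm (C / (1 + y\<^sup>2))" using C(1) by simp
    qed
  qed measurable
qed

subsection \<open>Fourier transforms of test functions\<close>

definition CF :: "(real \<Rightarrow> complex) \<Rightarrow> complex \<Rightarrow> complex" where
  "CF u z = (LINT x|lborel. u x * exp (\<i> * z * complex_of_real x))"

lemma CF_of_real: "CF u (complex_of_real x) = FT u x"
  by (simp add: CF_def FT_def osc_def mult.assoc)

lemma test_continuous: "u \<in> test_functions_within R \<Longrightarrow> continuous_on A u"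
  by (intro smooth_continuous test_functions_withinD(1))

lemma
  assumes u: "u \<in> test_functions_within R" and g: "continuous_on UNIV g"
  shows integrable_test: "integrable lborel (\<lambda>x. u x * g x)"
    and integral_test: "(LINT x|lborel. u x * g x) = integral {-R..R} (\<lambda>x. u x * g x)"
proof -
  have eq: "(\<lambda>x. indicator {-R..R} x *\<^sub>R (u x * g x)) = (\<lambda>x. u x * g x)"
    using test_functions_withinD(2)[OF u] by (force simp: indicator_def fun_eq_iff abs_le_iff not_le)
  have cont: "continuous_on {-R..R} (\<lambda>x. u x * g x)"
    using g by (intro continuous_intros test_continuous[OF u]) (auto intro: continuous_on_subset)
  then have *: "set_integrable lborel {-R..R} (\<lambda>x. u x * g x)"
    unfolding set_integrable_def by (intro borel_integrable_compact) auto
  then show "integrable lborel (\<lambda>x. u x * g x)"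
    unfolding set_integrable_def eq .
  show "(LINT x|lborel. u x * g x) = integral {-R..R} (\<lambda>x. u x * g x)"
    using set_borel_integral_eq_integral(2)[OF *] unfolding set_lebesgue_integral_def eq .
qed

lemma rapid_test: "u \<in> test_functions_within R \<Longrightarrow> rapid u"
  unfolding rapid_def
proof (intro conjI allI)
  assume u: "u \<in> test_functions_within R"
  show "u \<in> borel_measurable borel"
    by (rule borel_measurable_continuous_onI[OF test_continuous[OF u]])
  fix k
  have "integrable lborel (\<lambda>x. norm (u x * complex_of_real (\<bar>x\<bar> ^ k)))"
    by (intro integrable_norm integrable_test[OF u] continuous_intros)
  then show "integrable lborel (\<lambda>x. \<bar>x\<bar> ^ k * norm (u x))"
    by (simp add: norm_mult mult.commute norm_power)
qed

lemma CF_holomorphic: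
  assumes u: "u \<in> test_functions_within R" shows "CF u holomorphic_on UNIV"
proof -
  have "(\<lambda>z. integral (cbox (-R) R) (\<lambda>x. u x * exp (\<i> * z * complex_of_real x))) holomorphic_on UNIV"
  proof (rule leibniz_rule_holomorphic)
    show "((\<lambda>z. u x * exp (\<i> * z * complex_of_real x)) has_field_derivative
        u x * (\<i> * complex_of_real x) * exp (\<i> * z * complex_of_real x)) (at z within UNIV)" for z x
      by (auto intro!: derivative_eq_intros)
    show "(\<lambda>x. u x * exp (\<i> * z * complex_of_real x)) integrable_on cbox (- R) R" for z
      by (intro integrable_continuous continuous_intros test_continuous[OF u])
    have "continuous_on (UNIV \<times> cbox (-R) R) (\<lambda>p. u (snd p) * (\<i> * complex_of_real (snd p)) * exp (\<i> * fst p * complex_of_real (snd p)))"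
      by (intro continuous_intros continuous_on_compose2[OF test_continuous[OF u, of UNIV]]) auto
    then show "continuous_on (UNIV \<times> cbox (-R) R) (\<lambda>(z, x). u x * (\<i> * complex_of_real x) * exp (\<i> * z * complex_of_real x))"
      by (simp add: case_prod_unfold)
  qed simp
  moreover have "CF u z = integral {-R..R} (\<lambda>x. u x * exp (\<i> * z * complex_of_real x))" for z
    unfolding CF_def by (intro integral_test[OF u] continuous_intros)
  ultimately show ?thesis by (simp add: holomorphic_cong[of _ _ "CF u"])
qed

lemma CF_vderiv:
  assumes u: "u \<in> test_functions_within R"
  shows "CF (\<lambda>x. vector_derivative u (at x)) z = - (\<i> * z) * CF u z"
proof -
  let ?e = "\<lambda>x. exp (\<i> * z * complex_of_real x)"
  let ?u' = "\<lambda>x. vector_derivative u (at x)"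
  \<comment> \<open>Membership in \<open>test_functions_within R\<close> gives zeros only for
    \<bar>x\<bar> > R, so the boundary terms are taken strictly beyond \<open>R\<close>; this also
    makes the interval nonempty for negative \<open>R\<close>.\<close>
  define r where "r = \<bar>R\<bar> + 1"
  have u': "?u' \<in> test_functions_within R" by (rule test_functions_within_vderiv[OF u])
  have 0: "u x * g x = indicator {-r..r} x *\<^sub>R (u x * g x)" if "u \<in> test_functions_within R" for u g and x :: real
    using test_functions_withinD(2)[OF that, of x] by (auto simp: indicator_def r_def)
  have int: "integrable lborel (\<lambda>x. ?u' x * ?e x)" "integrable lborel (\<lambda>x. u x * (\<i> * z * ?e x))"
    by (intro integrable_test[OF u'] integrable_test[OF u] continuous_intros)+
  have "(LINT x|lborel. ?u' x * ?e x + u x * (\<i> * z * ?e x)) =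
      (LINT x|lborel. indicator {-r..r} x *\<^sub>R (u x * (\<i> * z * ?e x) + ?u' x * ?e x))"
    by (subst 0[OF u], subst 0[OF u']) (simp add: scaleR_add_right add.commute)
  also have "\<dots> = u r * ?e r - u (-r) * ?e (-r)"
  proof (rule integral_FTC_Icc)
    fix x
    have "((\<lambda>z'. exp (\<i> * z * z')) has_field_derivative \<i> * z * ?e x) (at (complex_of_real x))"
      by (auto intro!: derivative_eq_intros)
    then have "(?e has_vector_derivative \<i> * z * ?e x) (at x)"
      by (rule has_vector_derivative_real_field)
    then show "((\<lambda>x. u x * ?e x) has_vector_derivative (u x * (\<i> * z * ?e x) + ?u' x * ?e x)) (at x within {-r..r})"
      by (intro has_vector_derivative_mult has_vector_derivative_at_within[OF smooth_has_vderiv]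
          test_functions_withinD(1)[OF u]) (rule has_vector_derivative_at_within)
    show "continuous_on {-r..r} (\<lambda>x. u x * (\<i> * z * ?e x) + ?u' x * ?e x)"
      by (intro continuous_intros test_continuous[OF u] test_continuous[OF u'])
  qed (simp add: r_def)
  also have "\<dots> = 0"
    using test_functions_withinD(2)[OF u, of r] test_functions_withinD(2)[OF u, of "-r"] by (simp add: r_def)
  also have "(LINT x|lborel. ?u' x * ?e x + u x * (\<i> * z * ?e x)) = CF ?u' z + \<i> * z * CF u z"
    using int by (simp add: CF_def mult_ac flip: integral_mult_right_zero)
  finally show ?thesis by (simp add: add_eq_0_iff)
qed

lemma test_functions_within_nth_vderiv:
  "u \<in> test_functions_within R \<Longrightarrow> nth_vderiv k u \<in> test_functions_within R"
  by (induction k arbitrary: u) (auto simp: nth_vderiv_Suc test_functions_within_vderiv)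

lemma CF_nth_vderiv:
  "u \<in> test_functions_within R \<Longrightarrow> CF (nth_vderiv n u) z = (- (\<i> * z)) ^ n * CF u z"
proof (induction n arbitrary: u)
  case (Suc n)
  show ?case unfolding nth_vderiv_Suc
    by (subst Suc.IH[OF test_functions_within_vderiv[OF Suc.prems]])
       (simp add: CF_vderiv[OF Suc.prems] del: mult_minus_left)
qed simp

lemma norm_CF_le:
  assumes u: "u \<in> test_functions_within R" and R: "R \<ge> 0"
  shows "norm (CF u z) \<le> exp (R * \<bar>Im z\<bar>) * (LINT x|lborel. norm (u x))"
proof -
  have "norm (CF u z) \<le> (LINT x|lborel. exp (R * \<bar>Im z\<bar>) * norm (u x))"
    unfolding CF_def
  proof (rule Bochner_Integration.integral_norm_bound_integral)
    show "integrable lborel (\<lambda>x. u x * exp (\<i> * z * complex_of_real x))"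
      by (intro integrable_test[OF u] continuous_intros)
    show "integrable lborel (\<lambda>x. exp (R * \<bar>Im z\<bar>) * norm (u x))"
      by (intro integrable_mult_right rapid_integrable_norm rapid_test[OF u])
    fix x
    show "norm (u x * exp (\<i> * z * complex_of_real x)) \<le> exp (R * \<bar>Im z\<bar>) * norm (u x)"
    proof (cases "\<bar>x\<bar> > R")
      case False
      have "- (Im z * x) \<le> \<bar>Im z\<bar> * \<bar>x\<bar>" by (metis abs_ge_minus_self abs_mult)
      also have "\<dots> \<le> \<bar>Im z\<bar> * R" using False by (intro mult_left_mono) auto
      finally show ?thesis by (simp add: norm_mult mult_ac mult_left_mono)
    qed (simp add: test_functions_withinD(2)[OF u])
  qed
  then show ?thesis by simp
qed

lemma one_plus_power_le: "t \<ge> 0 \<Longrightarrow> (1 + t) ^ n \<le> 2 ^ n * (1 + t ^ n)" for t :: real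
proof -
  assume t: "t \<ge> 0"
  show ?thesis
  proof (cases "t \<le> 1")
    case True
    then have "(1 + t) ^ n \<le> 2 ^ n" using t by (intro power_mono) auto
    also have "\<dots> \<le> 2 ^ n * (1 + t ^ n)" using t by simp
    finally show ?thesis .
  next
    case False
    then have "(1 + t) ^ n \<le> (2 * t) ^ n" using t by (intro power_mono) auto
    also have "\<dots> \<le> 2 ^ n * (1 + t ^ n)" by (simp add: power_mult_distrib)
    finally show ?thesis .
  qed
qed

text \<open>Differentiating \<open>u\<close> n times multiplies \<open>CF u\<close> by
  \<open>(- (\<i> * z)) ^ n\<close>, so norm z ^ n times \<open>CF u\<close> satisfies the same
  exponential bound as the transform of a test function.\<close>

lemma CF_decay:
  assumes u: "u \<in> test_functions_within R" and R: "R \<ge> 0"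
  shows "\<exists>C\<ge>0. \<forall>z. norm (CF u z) \<le> C * exp (R * \<bar>Im z\<bar>) / (1 + norm z) ^ n"
proof (intro exI conjI allI)
  let ?C = "2 ^ n * ((LINT x|lborel. norm (u x)) + (LINT x|lborel. norm (nth_vderiv n u x)))"
  show "?C \<ge> 0" by (intro mult_nonneg_nonneg add_nonneg_nonneg integral_nonneg_AE) auto
  fix z
  have "(1 + norm z) ^ n * norm (CF u z) \<le> 2 ^ n * (1 + norm z ^ n) * norm (CF u z)"
    by (intro mult_right_mono one_plus_power_le) auto
  also have "\<dots> = 2 ^ n * (norm (CF u z) + norm (CF (nth_vderiv n u) z))"
    by (simp add: CF_nth_vderiv[OF u] norm_mult norm_power algebra_simps)
  also have "\<dots> \<le> 2 ^ n * (exp (R * \<bar>Im z\<bar>) * (LINT x|lborel. norm (u x)) +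
      exp (R * \<bar>Im z\<bar>) * (LINT x|lborel. norm (nth_vderiv n u x)))"
    by (intro mult_left_mono add_mono norm_CF_le u R test_functions_within_nth_vderiv) auto
  also have "\<dots> = ?C * exp (R * \<bar>Im z\<bar>)" by (simp add: algebra_simps)
  finally have "norm (CF u z) * (1 + norm z) ^ n \<le> ?C * exp (R * \<bar>Im z\<bar>)"
    by (simp only: mult.commute)
  moreover have "(1 + norm z) ^ n > 0" by (simp add: add_pos_nonneg)
  ultimately show "norm (CF u z) \<le> ?C * exp (R * \<bar>Im z\<bar>) / (1 + norm z) ^ n"
    by (simp only: pos_le_divide_eq)
qed

lemma FT_decay:
  assumes u: "u \<in> test_functions_within R"
  shows "\<exists>C\<ge>0. \<forall>x. norm (FT u x) \<le> C / (1 + \<bar>x\<bar>) ^ n"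
proof -
  have "u \<in> test_functions_within \<bar>R\<bar>" using u by (rule test_functions_within_mono) simp
  from CF_decay[OF this, of n] obtain C where C: "C \<ge> 0"
    "\<And>z. norm (CF u z) \<le> C * exp (\<bar>R\<bar> * \<bar>Im z\<bar>) / (1 + norm z) ^ n" by auto
  show ?thesis using C(1) C(2)[of "complex_of_real _"]
    by (intro exI[of _ C]) (auto simp: CF_of_real)
qed

lemma test_functions_within_monomial:
  "u \<in> test_functions_within R \<Longrightarrow> (\<lambda>x. (\<i> * complex_of_real x) ^ k * u x) \<in> test_functions_within R"
  using test_functions_within_mult[of u R "\<lambda>x. (\<i> * complex_of_real x + 0) ^ k"]
    smooth_entire[of "\<lambda>z. z ^ k" \<i> 0]
  by (simp add: mult.commute holomorphic_on_power)

lemma FT_Z_space: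
  assumes u: "u \<in> test_functions_within R" shows "FT u \<in> Z_space"
proof -
  define r where "r = \<bar>R\<bar> + 1"
  have r: "r > 0" "u \<in> test_functions_within r"
    using test_functions_within_mono[OF u, of r] by (auto simp: r_def)
  have "bounded (range (\<lambda>x. x ^ m *\<^sub>R nth_vderiv k (FT u) x))" for m k
  proof -
    obtain C where C: "\<And>x. norm (FT (\<lambda>x. (\<i> * complex_of_real x) ^ k * u x) x) \<le> C / (1 + \<bar>x\<bar>) ^ m" "C \<ge> 0"
      using FT_decay[OF test_functions_within_monomial[OF u, of k], of m] by auto
    have "norm (x ^ m *\<^sub>R nth_vderiv k (FT u) x) \<le> C" for x
    proof -
      have "norm (x ^ m *\<^sub>R nth_vderiv k (FT u) x) \<le> \<bar>x\<bar> ^ m * (C / (1 + \<bar>x\<bar>) ^ m)"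
        unfolding nth_vderiv_FT[OF rapid_test[OF u]] norm_scaleR power_abs[symmetric]
        by (intro mult_left_mono C) simp
      also have "\<dots> \<le> C * (\<bar>x\<bar> ^ m / (1 + \<bar>x\<bar>) ^ m)" by (simp add: mult.commute)
      also have "\<dots> \<le> C * 1"
        using C(2) by (intro mult_left_mono) (auto simp: divide_le_eq_1 intro: power_mono)
      finally show ?thesis by simp
    qed
    then show ?thesis by (auto simp: bounded_iff)
  qed
  then have "FT u \<in> schwartz" by (simp add: schwartz_def smooth_FT rapid_test[OF u])
  moreover have "\<exists>C. \<forall>z. norm (CF u z) \<le> C * exp (r * \<bar>Im z\<bar>) / (1 + norm z) ^ n" for n
    using CF_decay[OF r(2), of n] r(1) by auto
  ultimately show ?thesis unfolding Z_space_def
    using CF_holomorphic[OF u] r(1) CF_of_real[of u] by blast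
qed

lemma Z_space_decay:
  assumes "\<phi> \<in> Z_space"
  shows "\<exists>C\<ge>0. \<forall>x. norm (\<phi> x) \<le> C / (1 + \<bar>x\<bar>) ^ n"
proof -
  obtain \<Phi> r where \<Phi>: "\<And>x::real. \<Phi> (complex_of_real x) = \<phi> x" and r: "r > 0"
    and b: "\<forall>n::nat. \<exists>C. \<forall>z. norm (\<Phi> z) \<le> C * exp (r * \<bar>Im z\<bar>) / (1 + norm z) ^ n"
    using assms unfolding Z_space_def by blast
  obtain C where "\<And>z. norm (\<Phi> z) \<le> C * exp (r * \<bar>Im z\<bar>) / (1 + norm z) ^ n" using b by blast
  from this[of "complex_of_real _"] have C: "norm (\<phi> x) \<le> C / (1 + \<bar>x\<bar>) ^ n" for x by (simp add: \<Phi>)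
  moreover have "C \<ge> 0" using order_trans[OF norm_ge_zero C[of 0]] by simp
  ultimately show ?thesis by blast
qed

lemma Z_space_continuous: "\<phi> \<in> Z_space \<Longrightarrow> continuous_on A \<phi>"
  by (auto simp: Z_space_def schwartz_def intro: smooth_continuous)

lemma rapid_Z_space: "\<phi> \<in> Z_space \<Longrightarrow> rapid \<phi>"
  by (intro rapid_decay borel_measurable_continuous_onI Z_space_continuous Z_space_decay)

subsection \<open>Paley--Wiener\<close>

text \<open>An entire function has a global primitive \<open>G\<close>, so the integral over a long
  horizontal segment is a difference of two values of \<open>G\<close>. The values at heights 0 and
  \<open>y\<close> differ by the integral over a vertical side, which vanishes as the segment
  grows.\<close>

lemma contour_shift:
  assumes f: "f holomorphic_on UNIV"
    and bound: "\<And>x t. \<bar>t\<bar> \<le> \<bar>y\<bar> \<Longrightarrow> norm (f (Complex x t)) \<le> B / (1 + x\<^sup>2)"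
  shows "integrable lborel (\<lambda>x. f (Complex x y))"
    and "(LINT x|lborel. f (Complex x y)) = (LINT x|lborel. f (complex_of_real x))"
proof -
  have cont: "continuous_on UNIV f" by (rule holomorphic_on_imp_continuous_on[OF f])
  have cont': "continuous_on UNIV (\<lambda>x. f (Complex x t))" for t
    unfolding Complex_eq by (intro continuous_on_compose2[OF cont] continuous_intros) auto
  have int: "integrable lborel (\<lambda>x. f (Complex x t))" if "\<bar>t\<bar> \<le> \<bar>y\<bar>" for t
    by (rule Bochner_Integration.integrable_bound[OF integrable_inverse_1_plus_square_lborel[of B]])
       (use borel_measurable_continuous_onI[OF cont'] in
         \<open>auto intro!: AE_I2 order_trans[OF bound[OF that]] divide_right_mono\<close>)
  show "integrable lborel (\<lambda>x. f (Complex x y))" by (rule int) simp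
  obtain G where G: "\<And>z. (G has_field_derivative f z) (at z)"
    using holomorphic_convex_primitive'[OF convex_UNIV open_UNIV f] by auto
  have FTC: "(LINT x|lborel. indicator {-real n..real n} x *\<^sub>R f (Complex x t)) = G (Complex n t) - G (Complex (- real n) t)"
    for n t
  proof (rule integral_FTC_Icc)
    fix x
    have "((\<lambda>z. G (z + \<i> * t)) has_field_derivative f (complex_of_real x + \<i> * t) * 1) (at (complex_of_real x))"
      by (rule DERIV_chain2[OF G]) (auto intro!: derivative_eq_intros)
    then have "((\<lambda>x. G (complex_of_real x + \<i> * t)) has_vector_derivative f (complex_of_real x + \<i> * t)) (at x)"
      by (simp only: mult_1_right) (rule has_vector_derivative_real_field[where f = "\<lambda>z. G (z + \<i> * t)"])
    then show "((\<lambda>x. G (Complex x t)) has_vector_derivative f (Complex x t)) (at x within {-real n..real n})"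
      unfolding Complex_eq by (rule has_vector_derivative_at_within)
  qed (auto intro: continuous_on_subset[OF cont'])
  have lim: "(\<lambda>n. G (Complex (real n) t) - G (Complex (- real n) t)) \<longlonglongrightarrow> (LINT x|lborel. f (Complex x t))"
    if "\<bar>t\<bar> \<le> \<bar>y\<bar>" for t
    unfolding FTC[symmetric]
  proof (rule integral_dominated_convergence[where w = "\<lambda>x. norm (f (Complex x t))"])
    show "AE x in lborel. (\<lambda>n. indicator {- real n..real n} x *\<^sub>R f (Complex x t)) \<longlonglongrightarrow> f (Complex x t)"
    proof (rule AE_I2, rule tendsto_eventually)
      fix x :: real
      show "\<forall>\<^sub>F n in sequentially. indicator {- real n..real n} x *\<^sub>R f (Complex x t) = f (Complex x t)"
        using eventually_ge_at_top[of "nat \<lceil>\<bar>x\<bar>\<rceil>"] by eventually_elim (auto simp: indicator_def)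
    qed
  qed (use int[OF that] in \<open>auto simp: indicator_def\<close>)
  have B: "B \<ge> 0" using order_trans[OF norm_ge_zero bound[of 0 0]] by simp
  have side: "norm (G (Complex x y) - G (Complex x 0)) \<le> B / (1 + x\<^sup>2) * \<bar>y\<bar>" for x
  proof -
    have "norm (G (Complex x y) - G (Complex x 0)) \<le> B / (1 + x\<^sup>2) * norm (Complex x y - Complex x 0)"
    proof (rule field_differentiable_bound[where S = "closed_segment (Complex x 0) (Complex x y)" and f' = f])
      fix z assume "z \<in> closed_segment (Complex x 0) (Complex x y)"
      then obtain u where u: "0 \<le> u" "u \<le> 1" "z = (1 - u) *\<^sub>R Complex x 0 + u *\<^sub>R Complex x y"
        by (auto simp: closed_segment_def)
      then have "z = Complex x (u * y)" by (simp add: complex_eq_iff algebra_simps)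
      moreover have "\<bar>u * y\<bar> \<le> \<bar>y\<bar>" using u by (simp add: abs_mult mult_left_le_one_le)
      ultimately show "norm (f z) \<le> B / (1 + x\<^sup>2)" using bound by simp
    qed (auto intro: has_field_derivative_at_within[OF G])
    moreover have "norm (Complex x y - Complex x 0) = \<bar>y\<bar>" by (simp add: cmod_def)
    ultimately show ?thesis by simp
  qed
  have inv0: "(\<lambda>n. B / (1 + (real n)\<^sup>2) * \<bar>y\<bar>) \<longlonglongrightarrow> 0" by real_asymp
  have "(\<lambda>n. (G (Complex (real n) y) - G (Complex (- real n) y)) - (G (Complex (real n) 0) - G (Complex (- real n) 0))) \<longlonglongrightarrow> 0"
  proof (rule Lim_null_comparison[OF _ tendsto_add_zero[OF inv0 inv0]], rule always_eventually, rule allI)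
    fix n
    have "norm (((G (Complex (real n) y) - G (Complex (real n) 0)) - (G (Complex (- real n) y) - G (Complex (- real n) 0))))
       \<le> B / (1 + (real n)\<^sup>2) * \<bar>y\<bar> + B / (1 + (- real n)\<^sup>2) * \<bar>y\<bar>"
      by (rule order_trans[OF norm_triangle_ineq4]) (intro add_mono side)
    then show "norm ((G (Complex (real n) y) - G (Complex (- real n) y)) - (G (Complex (real n) 0) - G (Complex (- real n) 0)))
       \<le> B / (1 + (real n)\<^sup>2) * \<bar>y\<bar> + B / (1 + (real n)\<^sup>2) * \<bar>y\<bar>"
      by (simp add: algebra_simps)
  qed
  moreover have "(\<lambda>n. (G (Complex (real n) y) - G (Complex (- real n) y)) - (G (Complex (real n) 0) - G (Complex (- real n) 0)))
     \<longlonglongrightarrow> (LINT x|lborel. f (Complex x y)) - (LINT x|lborel. f (Complex x 0))"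
    by (intro tendsto_diff lim) auto
  ultimately have "(LINT x|lborel. f (Complex x y)) - (LINT x|lborel. f (Complex x 0)) = 0"
    using LIMSEQ_unique by blast
  then show "(LINT x|lborel. f (Complex x y)) = (LINT x|lborel. f (complex_of_real x))"
    by (simp add: complex_of_real_def)
qed

text \<open>Moving the contour to height \<open>y\<close> costs the factor exp (r * \<bar>y\<bar>)
  and gains exp (- x * y). For \<bar>x\<bar> > r the gain wins as \<bar>y\<bar> grows with the sign
  of \<open>x\<close>, so the transform vanishes there.\<close>

theorem Paley_Wiener:
  assumes "\<phi> \<in> Z_space" shows "\<exists>r. FT \<phi> \<in> test_functions_within r"
proof -
  obtain \<Phi> r where hol: "\<Phi> holomorphic_on UNIV" and \<Phi>: "\<And>x::real. \<Phi> (complex_of_real x) = \<phi> x" and r: "r > 0"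
    and b: "\<forall>n::nat. \<exists>C. \<forall>z. norm (\<Phi> z) \<le> C * exp (r * \<bar>Im z\<bar>) / (1 + norm z) ^ n"
    using assms unfolding Z_space_def by blast
  \<comment> \<open>Decay of order 2 already gives an integrable majorant on every horizontal
    line.\<close>
  obtain C where C: "\<And>z. norm (\<Phi> z) \<le> C * exp (r * \<bar>Im z\<bar>) / (1 + norm z) ^ 2" using b by blast
  have C0: "C \<ge> 0" using order_trans[OF norm_ge_zero C[of 0]] by simp
  define K where "K = (LINT x::real|lborel. C / (1 + x\<^sup>2))"
  have shift: "norm (FT \<phi> x) \<le> exp (r * \<bar>y\<bar> - x * y) * K" if xy: "x * y \<ge> 0" for x y
  proof -
    define f where "f z = \<Phi> z * exp (\<i> * x * z)" for z
    have f_hol: "f holomorphic_on UNIV" unfolding f_def by (intro holomorphic_intros hol)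
    have f_bound: "norm (f (Complex s t)) \<le> exp (r * \<bar>t\<bar> - x * t) * (C / (1 + s\<^sup>2))" for s t
    proof -
      have "\<bar>s\<bar> \<le> norm (Complex s t)" using abs_Re_le_cmod[of "Complex s t"] by simp
      then have "1 + s\<^sup>2 \<le> (1 + norm (Complex s t))\<^sup>2"
        using power_mono[of "\<bar>s\<bar>" "norm (Complex s t)" 2] by (simp add: power2_sum)
      then have "C * exp (r * \<bar>t\<bar>) / (1 + norm (Complex s t))\<^sup>2 \<le> C * exp (r * \<bar>t\<bar>) / (1 + s\<^sup>2)"
        using C0 by (intro divide_left_mono mult_pos_pos zero_less_power add_pos_nonneg) auto
      then have "norm (\<Phi> (Complex s t)) \<le> C * exp (r * \<bar>t\<bar>) / (1 + s\<^sup>2)"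
        using C[of "Complex s t"] by simp
      then have "norm (\<Phi> (Complex s t)) * exp (- x * t) \<le> C * exp (r * \<bar>t\<bar>) / (1 + s\<^sup>2) * exp (- x * t)"
        by (rule mult_right_mono) simp
      moreover have "norm (f (Complex s t)) = norm (\<Phi> (Complex s t)) * exp (- x * t)"
        by (simp add: f_def norm_mult)
      moreover have "exp (r * \<bar>t\<bar> - x * t) = exp (r * \<bar>t\<bar>) * exp (- x * t)"
        by (simp add: exp_add[symmetric])
      ultimately show ?thesis by (simp add: mult_ac)
    qed
    have "norm (f (Complex s t)) \<le> exp ((r + \<bar>x\<bar>) * \<bar>y\<bar>) * C / (1 + s\<^sup>2)" if t: "\<bar>t\<bar> \<le> \<bar>y\<bar>" for s t
    proof -
      have "- (x * t) \<le> \<bar>x\<bar> * \<bar>t\<bar>" by (metis abs_ge_minus_self abs_mult)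
      then have "r * \<bar>t\<bar> - x * t \<le> (r + \<bar>x\<bar>) * \<bar>t\<bar>" by (simp add: algebra_simps)
      also have "\<dots> \<le> (r + \<bar>x\<bar>) * \<bar>y\<bar>" using t r by (intro mult_left_mono) auto
      finally have "exp (r * \<bar>t\<bar> - x * t) * (C / (1 + s\<^sup>2)) \<le> exp ((r + \<bar>x\<bar>) * \<bar>y\<bar>) * (C / (1 + s\<^sup>2))"
        using C0 by (intro mult_right_mono) auto
      then show ?thesis using f_bound[of s t] by simp
    qed
    note sh = contour_shift[OF f_hol this]
    have "FT \<phi> x = (LINT s|lborel. f (complex_of_real s))"
      by (simp add: FT_def f_def \<Phi> osc_def mult.assoc)
    also have "\<dots> = (LINT s|lborel. f (Complex s y))" by (rule sh(2)[symmetric])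
    also have "norm \<dots> \<le> (LINT s|lborel. exp (r * \<bar>y\<bar> - x * y) * (C / (1 + s\<^sup>2)))"
      by (rule Bochner_Integration.integral_norm_bound_integral[OF sh(1)])
         (use f_bound in \<open>auto intro!: integrable_mult_right integrable_inverse_1_plus_square_lborel\<close>)
    also have "\<dots> = exp (r * \<bar>y\<bar> - x * y) * K" unfolding K_def by (rule integral_mult_right_zero)
    finally show ?thesis .
  qed
  have "FT \<phi> x = 0" if x: "\<bar>x\<bar> > r" for x
  proof -
    \<comment> \<open>The contour is moved to height \<open>sgn x * n\<close>, which makes
      \<open>x * y\<close> equal to \<bar>x\<bar> * n.\<close>
    have "norm (FT \<phi> x) \<le> exp (- (\<bar>x\<bar> - r) * real n) * K" for n
    proof -
      have "x * (sgn x * real n) = \<bar>x\<bar> * real n" by (simp add: abs_sgn mult_ac)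
      moreover have "\<bar>sgn x * real n\<bar> = real n" using x r by (auto simp: abs_mult sgn_if)
      ultimately have "norm (FT \<phi> x) \<le> exp (r * real n - \<bar>x\<bar> * real n) * K"
        using shift[of x "sgn x * real n"] by (simp only: abs_ge_zero of_nat_0_le_iff mult_nonneg_nonneg simp_thms)
      then show ?thesis by (simp add: algebra_simps)
    qed
    moreover have "(\<lambda>n. exp (- (\<bar>x\<bar> - r) * real n) * K) \<longlonglongrightarrow> 0" using x by real_asymp
    ultimately have "norm (FT \<phi> x) \<le> 0" by (intro LIMSEQ_le_const) auto
    then show ?thesis by simp
  qed
  then have "FT \<phi> \<in> test_functions_within r"
    by (simp add: test_functions_within_def smooth_FT rapid_Z_space[OF assms])
  then show ?thesis by blast
qed

subsection \<open>The parametrization of the test spaces by smooth functions of compact support\<close>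

definition fourier :: "(real \<Rightarrow> complex) \<Rightarrow> real \<Rightarrow> complex" where
  "fourier u x = complex_of_real (1 / sqrt (2 * pi)) * FT u (- x)"

lemma inverse_fourier_eq_FT: "inverse_fourier \<phi> x = complex_of_real (1 / sqrt (2 * pi)) * FT \<phi> x"
  by (simp add: inverse_fourier_def FT_def osc_def)

lemma sqrt_2pi_sq:
  fixes z :: complex
  shows "complex_of_real (1 / sqrt (2 * pi)) * (complex_of_real (1 / sqrt (2 * pi)) * (2 * pi * z)) = z"
proof -
  have "complex_of_real (1 / sqrt (2 * pi)) * (complex_of_real (1 / sqrt (2 * pi)) * (2 * pi * z)) =
    complex_of_real (1 / sqrt (2 * pi) * (1 / sqrt (2 * pi)) * (2 * pi)) * z"
    by (simp only: of_real_mult mult.assoc of_real_numeral)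
  also have "1 / sqrt (2 * pi) * (1 / sqrt (2 * pi)) * (2 * pi) = 1"
    by (simp add: divide_simps)
  finally show ?thesis by simp
qed

lemma FT_reflect: "FT (\<lambda>y. b (- y)) x = FT b (- x)"
  unfolding FT_def by (subst lborel_integral_real_affine[where c = "-1" and t = 0]) (auto simp: osc_def)

lemma test_functions_within_reflect:
  "u \<in> test_functions_within R \<Longrightarrow> (\<lambda>x. u (- x)) \<in> test_functions_within R"
  using smooth_affine[of u "-1" 0] by (auto simp: test_functions_within_def)

lemma fourier_eq_FT: "fourier u = FT (\<lambda>x. complex_of_real (1 / sqrt (2 * pi)) * u (- x))"
  unfolding fourier_def[abs_def] FT_reflect[symmetric] FT_cmult ..

lemma fourier_Z_space:
  assumes "u \<in> test_functions_within R" shows "fourier u \<in> Z_space"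
  unfolding fourier_eq_FT
  by (rule FT_Z_space[OF test_functions_within_cmult[OF test_functions_within_reflect[OF assms]]])

lemma FT_FT_Z_space:
  fixes \<phi> :: "real \<Rightarrow> complex"
  assumes "\<phi> \<in> Z_space" "integrable lborel (FT \<phi>)"
  shows "FT (FT \<phi>) x = 2 * pi * \<phi> (- x)"
proof -
  obtain C where "C \<ge> 0" "\<And>x. norm (\<phi> x) \<le> C" using Z_space_decay[OF assms(1), of 0] by auto
  then show ?thesis
    by (intro FT_FT rapid_integrable rapid_Z_space Z_space_continuous assms)
qed

lemma inverse_fourier_fourier:
  assumes u: "u \<in> test_functions_within R" shows "inverse_fourier (fourier u) = u"
proof
  fix x
  let ?c = "complex_of_real (1 / sqrt (2 * pi))"
  have u': "(\<lambda>x. ?c * u (- x)) \<in> test_functions_within R"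
    by (intro test_functions_within_cmult test_functions_within_reflect u)
  have "compact ((\<lambda>x. ?c * u (- x)) ` {-R..R})"
    by (intro compact_continuous_image test_continuous[OF u']) auto
  then obtain B where B: "\<forall>x\<in>{-R..R}. norm (?c * u (- x)) \<le> B"
    by (auto dest!: compact_imp_bounded simp: bounded_iff)
  have "norm (?c * u (- x)) \<le> \<bar>B\<bar>" for x
  proof (cases "\<bar>x\<bar> \<le> R")
    case True
    then have "x \<in> {-R..R}" by auto
    with B have "norm (?c * u (- x)) \<le> B" by (rule bspec)
    then show ?thesis by linarith
  qed (simp add: test_functions_withinD(2)[OF u])
  then have "FT (FT (\<lambda>x. ?c * u (- x))) x = 2 * pi * (?c * u (- (- x)))"
    by (intro FT_FT[where B = "\<bar>B\<bar>"] rapid_integrable[OF rapid_test[OF u']] test_continuous[OF u']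
        rapid_integrable[OF rapid_Z_space[OF FT_Z_space[OF u']]])
  then have "inverse_fourier (fourier u) x = ?c * (2 * pi * (?c * u x))"
    unfolding inverse_fourier_eq_FT fourier_eq_FT by simp
  then show "inverse_fourier (fourier u) x = u x" using sqrt_2pi_sq[of "u x"] by (simp add: mult_ac)
qed

lemma
  assumes \<phi>: "\<phi> \<in> Z_space"
  shows inverse_fourier_test: "\<exists>R. inverse_fourier \<phi> \<in> test_functions_within R"
    and fourier_inverse_fourier: "fourier (inverse_fourier \<phi>) = \<phi>"
proof -
  let ?c = "complex_of_real (1 / sqrt (2 * pi))"
  obtain R where R: "FT \<phi> \<in> test_functions_within R" using Paley_Wiener[OF \<phi>] by blast
  have eq: "inverse_fourier \<phi> = (\<lambda>x. ?c * FT \<phi> x)" by (simp add: inverse_fourier_eq_FT fun_eq_iff)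
  show "\<exists>R. inverse_fourier \<phi> \<in> test_functions_within R"
    unfolding eq using test_functions_within_cmult[OF R] by blast
  show "fourier (inverse_fourier \<phi>) = \<phi>"
  proof
    fix x
    show "fourier (inverse_fourier \<phi>) x = \<phi> x"
      unfolding eq fourier_def FT_cmult FT_FT_Z_space[OF \<phi> rapid_integrable[OF rapid_test[OF R]]]
      using sqrt_2pi_sq[of "\<phi> x"] by simp
  qed
qed

section \<open>Test functions on the half-line and the induced distribution on the line\<close>

definition zfun :: "(real \<Rightarrow> complex) \<Rightarrow> real \<Rightarrow> complex" where
  "zfun u t = (if t > 0 then fourier u (ln t) else 0)"

lemma zfun_exp: "(\<lambda>x. zfun u (exp x)) = fourier u"
  by (simp add: zfun_def)

lemma zfun_Zplus: "u \<in> test_functions_within R \<Longrightarrow> zfun u \<in> Zplus"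
  by (simp add: Zplus_def zfun_exp fourier_Z_space) (simp add: zfun_def)

text \<open>Surjectivity of \<open>zfun\<close> is where the Paley-Wiener theorem is used: it makes
  the inverse transform of an element of \<open>Z_space\<close> compactly supported.\<close>

lemma Zplus_zfun:
  assumes "F \<in> Zplus"
  obtains u R where "u \<in> test_functions_within R" "F = zfun u"
proof -
  let ?\<phi> = "\<lambda>x. F (exp x)"
  have \<phi>: "?\<phi> \<in> Z_space" using assms by (simp add: Zplus_def)
  have "F t = zfun (inverse_fourier ?\<phi>) t" for t
  proof (cases "t > 0")
    case True
    then show ?thesis by (simp add: zfun_def fourier_inverse_fourier[OF \<phi>])
  next
    case False
    then show ?thesis using assms by (simp add: zfun_def Zplus_def)
  qed
  then show ?thesis using that inverse_fourier_test[OF \<phi>] by blast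
qed

lemma zfun_combine:
  assumes "u \<in> test_functions_within R" "v \<in> test_functions_within R"
  shows "zfun (\<lambda>x. a * u x + b * v x) = (\<lambda>t. a * zfun u t + b * zfun v t)"
  using FT_add[OF rapid_test[OF test_functions_within_cmult[OF assms(1), of a]]
        rapid_test[OF test_functions_within_cmult[OF assms(2), of b]]]
  by (auto simp: zfun_def fourier_def fun_eq_iff FT_cmult algebra_simps)

text \<open>The preimage of the unit ball under \<open>h\<close> is traced back through both
  pullback topologies to an open set of test functions containing zero. A basic neighbourhood inside
  it contains, for each \<open>R\<close>, all functions with sufficiently small derivatives up to
  some order, and homogeneity converts this into a seminorm estimate.\<close>

lemma antilinear_distribution_zfun:
  assumes h: "h \<in> Zplus_dual"
  shows "antilinear_distribution (\<lambda>u. h (zfun u))"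
proof
  have "\<forall>F\<in>Zplus. \<forall>G\<in>Zplus. \<forall>a b. h (\<lambda>t. a * F t + b * G t) = cnj a * h F + cnj b * h G"
    using h by (simp add: Zplus_dual_def)
  then have lin: "h (\<lambda>t. a * F t + b * G t) = cnj a * h F + cnj b * h G"
    if "F \<in> Zplus" "G \<in> Zplus" for F G a b
    using that by blast
  fix R u v a b assume uv: "u \<in> test_functions_within R" "v \<in> test_functions_within R"
  show "h (zfun (\<lambda>x. a * u x + b * v x)) = cnj a * h (zfun u) + cnj b * h (zfun v)"
    unfolding zfun_combine[OF uv] by (rule lin[OF uv[THEN zfun_Zplus]])
next
  have "\<forall>F\<in>Zplus. \<forall>G\<in>Zplus. \<forall>a b. h (\<lambda>t. a * F t + b * G t) = cnj a * h F + cnj b * h G"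
    using h by (simp add: Zplus_dual_def)
  then have lin: "h (\<lambda>t. a * F t + b * G t) = cnj a * h F + cnj b * h G"
    if "F \<in> Zplus" "G \<in> Zplus" for F G a b
    using that by blast
  fix R
  have topspace_test: "topspace test_topology \<subseteq> test_functions"
    unfolding topspace_def by (auto simp: openin_test_topology)
  have h0: "h (\<lambda>t. 0) = 0"
  proof -
    have "(\<lambda>x. 0) \<in> test_functions_within R" by (simp add: test_functions_within_def)
    from zfun_Zplus[OF this] have "zfun (\<lambda>x. 0) \<in> Zplus" .
    from lin[OF this this, of 0 0] show ?thesis by simp
  qed
  have "continuous_map Zplus_topology euclidean h" using h by (simp add: Zplus_dual_def)
  then have "openin Zplus_topology {F \<in> topspace Zplus_topology. h F \<in> ball 0 1}"
    by (rule openin_continuous_map_preimage) simp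
  then obtain V where V: "openin Z_topology V" "{F \<in> topspace Zplus_topology. h F \<in> ball 0 1} =
      (\<lambda>F x. F (exp x)) -` V \<inter> Zplus"
    unfolding Zplus_topology_def openin_pullback_topology by auto
  then obtain O' where "openin test_topology O'" "V = inverse_fourier -` O' \<inter> Z_space"
    unfolding Z_topology_def openin_pullback_topology by auto
  with V(2) have O': "openin test_topology O'" "{F \<in> topspace Zplus_topology. h F \<in> ball 0 1} =
      (\<lambda>F x. F (exp x)) -` (inverse_fourier -` O' \<inter> Z_space) \<inter> Zplus"
    by simp_all
  have zero: "zfun (\<lambda>x. 0) = (\<lambda>t. 0)" by (auto simp: zfun_def fourier_def)
  have inO: "zfun u \<in> {F \<in> topspace Zplus_topology. h F \<in> ball 0 1} \<longleftrightarrow> u \<in> O'"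
    if "u \<in> test_functions_within r" for u r
    unfolding O'(2) using zfun_Zplus[OF that] fourier_Z_space[OF that]
    by (simp add: zfun_exp inverse_fourier_fourier[OF that])
  \<comment> \<open>Continuity speaks only of points of the topological space; openness of the full
    set of test functions shows that zero is such a point.\<close>
  have test_open: "openin test_topology test_functions"
  proof -
    have "test_nbhd test_functions" 
      unfolding test_nbhd_def
    proof (intro conjI ballI allI impI subset_refl)
      fix u v :: "real \<Rightarrow> complex" and a b :: complex
      assume "u \<in> test_functions" "v \<in> test_functions"
      then obtain r s where "u \<in> test_functions_within r" "v \<in> test_functions_within s"
        by (auto simp: test_functions_def)
      then have "u \<in> test_functions_within (max r s)" "v \<in> test_functions_within (max r s)"
        using test_functions_within_mono[OF _ max.cobounded1] test_functions_within_mono[OF _ max.cobounded2] by blast+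
      then show "(\<lambda>x. a * u x + b * v x) \<in> test_functions"
        unfolding test_functions_def
        by (intro UN_I[OF UNIV_I, of _ _ "max r s"] test_functions_within_add test_functions_within_cmult)
    next
      fix R
      show "\<exists>N. \<exists>\<epsilon>>0. \<forall>u\<in>test_functions_within R.
        (\<forall>k\<le>N. \<forall>x. norm (nth_vderiv k u x) < \<epsilon>) \<longrightarrow> u \<in> test_functions"
        unfolding test_functions_def by (intro exI[of _ 0] exI[of _ 1] conjI ballI impI UN_I[OF UNIV_I]) simp_all
    qed
    moreover have "(\<lambda>x. u x + w x) \<in> test_functions" if uw: "u \<in> test_functions" "w \<in> test_functions" for u w
    proof -
      obtain r s where "u \<in> test_functions_within r" "w \<in> test_functions_within s"
        using uw by (auto simp: test_functions_def)
      then have "u \<in> test_functions_within (max r s)" "w \<in> test_functions_within (max r s)"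
        using test_functions_within_mono[OF _ max.cobounded1] test_functions_within_mono[OF _ max.cobounded2] by blast+
      then show ?thesis unfolding test_functions_def
        by (intro UN_I[OF UNIV_I, of _ _ "max r s"] test_functions_within_add)
    qed
    ultimately show ?thesis unfolding openin_test_topology by blast
  qed
  have zero_test: "(\<lambda>x. 0 :: complex) \<in> test_functions_within R" by (simp add: test_functions_within_def)
  have "(\<lambda>x. 0) \<in> topspace test_topology"
    using openin_subset[OF test_open] zero_test by (auto simp: test_functions_def)
  then have "zfun (\<lambda>x. 0) \<in> topspace Zplus_topology"
    unfolding Zplus_topology_def Z_topology_def topspace_pullback_topology
    using zfun_Zplus[OF zero_test] fourier_Z_space[OF zero_test]
    by (simp add: zfun_exp inverse_fourier_fourier[OF zero_test])
  then have "(\<lambda>x. 0) \<in> O'" using inO[OF zero_test] h0 by (simp add: zero)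
  from bspec[OF conjunct2[OF O'(1)[unfolded openin_test_topology]] this]
  obtain W where W: "test_nbhd W" "\<forall>w\<in>W. (\<lambda>x. 0 + w x) \<in> O'"
    by blast
  have "\<exists>N. \<exists>\<epsilon>>0. \<forall>u\<in>test_functions_within R.
        (\<forall>k\<le>N. \<forall>x. norm (nth_vderiv k u x) < \<epsilon>) \<longrightarrow> u \<in> W"
    using W(1) unfolding test_nbhd_def by (elim conjE) (erule spec)
  then obtain N \<epsilon> where N: "\<epsilon> > 0" "\<forall>u\<in>test_functions_within R.
        (\<forall>k\<le>N. \<forall>x. norm (nth_vderiv k u x) < \<epsilon>) \<longrightarrow> u \<in> W"
    by (elim exE conjE) (rule that)
  have small: "norm (h (zfun u)) < 1"
    if "u \<in> test_functions_within R" "\<forall>k\<le>N. \<forall>x. norm (nth_vderiv k u x) < \<epsilon>" for u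
  proof -
    have "u \<in> W" using N(2) that by blast
    then have "u \<in> O'" using bspec[OF W(2), of u] by simp
    then show ?thesis using inO[OF that(1)] by simp
  qed
  show "\<exists>N. \<exists>C\<ge>0. \<forall>u\<in>test_functions_within R. \<forall>M\<ge>0. deriv_bound N R M u \<longrightarrow> norm (h (zfun u)) \<le> C * M"
  proof (intro exI[of _ N] exI[of _ "2 / \<epsilon>"] conjI ballI allI impI)
    fix u M assume u: "u \<in> test_functions_within R" and M: "M \<ge> 0" "deriv_bound N R M u"
    \<comment> \<open>The positive \<open>d\<close> allows division by \<open>M + d\<close> even
      when \<open>M = 0\<close>; it is removed by letting it tend to zero. The scaling factor
      \<open>c\<close> below brings every derivative of order at most \<open>N\<close> strictly
      under \<epsilon>.\<close>
    have *: "norm (h (zfun u)) \<le> 2 / \<epsilon> * (M + d)" if d: "d > 0" for d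
    proof -
      define c where "c = \<epsilon> / (2 * (M + d))"
      have c: "c > 0" using N(1) M d by (simp add: c_def)
      let ?v = "\<lambda>x. complex_of_real c * u x"
      have v: "?v \<in> test_functions_within R" by (rule test_functions_within_cmult[OF u])
      have "norm (nth_vderiv k ?v x) < \<epsilon>" if "k \<le> N" for k x
      proof -
        have "norm (nth_vderiv k ?v x) = c * norm (nth_vderiv k u x)"
          using c by (simp add: nth_vderiv_cmult test_functions_withinD(1)[OF u] norm_mult)
        also have "\<dots> \<le> c * M"
          using c deriv_bound_global[OF u M(2,1) that] by (intro mult_left_mono) auto
        also have "\<dots> < c * (2 * (M + d))" using c M d by (intro mult_strict_left_mono) auto
        also have "\<dots> = \<epsilon>" using M d by (simp add: c_def)
        finally show ?thesis .
      qed
      then have "norm (h (zfun ?v)) < 1" by (intro small[OF v]) auto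
      moreover have "h (zfun ?v) = complex_of_real c * h (zfun u)"
        using zfun_combine[OF u u, of c 0] lin[OF zfun_Zplus[OF u] zfun_Zplus[OF u], of c 0] by simp
      ultimately have "c * norm (h (zfun u)) < 1" using c by (simp add: norm_mult)
      then have "norm (h (zfun u)) < 1 / c" using c by (simp add: field_simps)
      also have "1 / c = 2 / \<epsilon> * (M + d)" using N(1) by (simp add: c_def)
      finally show ?thesis by simp
    qed
    have "norm (h (zfun u)) / (2 / \<epsilon>) \<le> M + d" if "d > 0" for d
      using *[OF that] N(1) by (simp add: field_simps)
    then have "norm (h (zfun u)) / (2 / \<epsilon>) \<le> M" by (rule field_le_epsilon)
    then show "norm (h (zfun u)) \<le> 2 / \<epsilon> * M" using N(1) by (simp add: field_simps)
  qed (use N in simp)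
qed

subsection \<open>Exponential substitution, Gamma and Beta integrals\<close>

lemma set_integrable_lborel_iff:
  fixes f :: "real \<Rightarrow> 'a::euclidean_space"
  assumes "f \<in> borel_measurable borel" "S \<in> sets borel"
  shows "set_integrable lborel S f \<longleftrightarrow> f absolutely_integrable_on S"
  unfolding set_integrable_def using assms
  by (subst integrable_completion) auto

lemma
  fixes f :: "real \<Rightarrow> complex"
  assumes f [measurable]: "f \<in> borel_measurable borel"
  shows set_integrable_exp_subst:
      "set_integrable lborel {0<..} f \<longleftrightarrow> integrable lborel (\<lambda>x. exp x *\<^sub>R f (exp x))" (is ?A)
    and integral_exp_subst: "set_integrable lborel {0<..} f \<Longrightarrow>
      (LINT t:{0<..}|lborel. f t) = (LINT x|lborel. exp x *\<^sub>R f (exp x))"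
proof -
  have img: "exp ` UNIV = {0 :: real<..}" by (auto simp: image_iff) (metis exp_ln)
  have der: "(exp has_field_derivative exp x) (at x within UNIV)" for x :: real
    by (auto intro!: derivative_eq_intros)
  have inj: "inj_on exp (UNIV :: real set)" by (simp add: inj_on_def)
  have A: "f absolutely_integrable_on {0<..} \<longleftrightarrow> (\<lambda>x. exp x *\<^sub>R f (exp x)) absolutely_integrable_on UNIV"
    using absolutely_integrable_change_of_variables_real[of UNIV exp exp f, OF _ der inj] by (simp add: img)
  have *: "integrable lborel (\<lambda>x. exp x *\<^sub>R f (exp x)) \<longleftrightarrow> set_integrable lborel UNIV (\<lambda>x. exp x *\<^sub>R f (exp x))"
    by (simp add: set_integrable_def)
  show ?A
    unfolding * using A by (simp add: set_integrable_lborel_iff)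
  assume int: "set_integrable lborel {0<..} f"
  then have abs: "f absolutely_integrable_on {0<..}" by (simp add: set_integrable_lborel_iff)
  \<comment> \<open>\<open>r\<close> stands for the real or the imaginary part; the value of the
    complex integral is assembled from the two.\<close>
  have val: "integral {0<..} (\<lambda>t. r (f t)) = integral UNIV (\<lambda>x. exp x * r (f (exp x)))"
    if "bounded_linear r" for r :: "complex \<Rightarrow> real"
  proof -
    have "(\<lambda>t. r (f t)) absolutely_integrable_on {0<..}"
      using absolutely_integrable_linear[OF abs that] by (simp add: o_def)
    then show ?thesis
      using has_absolute_integral_change_of_variables_1'[of UNIV exp exp "\<lambda>t. r (f t)"
          "integral {0<..} (\<lambda>t. r (f t))", OF _ der inj]
      by (simp add: img)
  qed
  have int2: "set_integrable lborel UNIV (\<lambda>x. exp x *\<^sub>R f (exp x))"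
    using \<open>?A\<close> int * by simp
  have "(LINT t:{0<..}|lborel. f t) = integral {0<..} f"
    by (rule set_borel_integral_eq_integral(2)[OF int])
  also have "\<dots> = integral UNIV (\<lambda>x. exp x *\<^sub>R f (exp x))"
  proof (rule complex_eqI)
    have 1: "f integrable_on {0<..}" by (rule set_borel_integral_eq_integral(1)[OF int])
    have 2: "(\<lambda>x. exp x *\<^sub>R f (exp x)) integrable_on UNIV" by (rule set_borel_integral_eq_integral(1)[OF int2])
    show "Re (integral {0<..} f) = Re (integral UNIV (\<lambda>x. exp x *\<^sub>R f (exp x)))"
      using val[OF bounded_linear_Re] integral_linear[OF 1 bounded_linear_Re] integral_linear[OF 2 bounded_linear_Re]
      by (simp add: o_def)
    show "Im (integral {0<..} f) = Im (integral UNIV (\<lambda>x. exp x *\<^sub>R f (exp x)))"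
      using val[OF bounded_linear_Im] integral_linear[OF 1 bounded_linear_Im] integral_linear[OF 2 bounded_linear_Im]
      by (simp add: o_def)
  qed
  also have "\<dots> = (LINT x:UNIV|lborel. exp x *\<^sub>R f (exp x))"
    by (rule set_borel_integral_eq_integral(2)[OF int2, symmetric])
  finally show "(LINT t:{0<..}|lborel. f t) = (LINT x|lborel. exp x *\<^sub>R f (exp x))"
    by (simp add: set_lebesgue_integral_def)
qed

text \<open>This is \<open>s powr (a - 1)\<close> on the half-line, extended by zero.\<close>

definition hom :: "complex \<Rightarrow> real \<Rightarrow> complex" where
  "hom a s = (if s > 0 then exp ((a - 1) * complex_of_real (ln s)) else 0)"

lemma hom_measurable [measurable]: "hom a \<in> borel_measurable borel"
  unfolding hom_def[abs_def] by measurable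

lemma hom_scale: "t > 0 \<Longrightarrow> hom a (t * s) = exp ((a - 1) * complex_of_real (ln t)) * hom a s"
  by (auto simp: hom_def ln_mult zero_less_mult_iff exp_add distrib_left)

lemma
  assumes "Re z > 0"
  shows integrable_Gamma: "integrable lborel (\<lambda>s. hom z s * complex_of_real (exp (- s)))"
    and integral_Gamma: "(LINT s|lborel. hom z s * complex_of_real (exp (- s))) = Gamma z"
proof -
  let ?f = "\<lambda>t. complex_of_real t powr (z - 1) / complex_of_real (exp t)"
  have eq: "(\<lambda>s. indicator {0<..} s *\<^sub>R ?f s) = (\<lambda>s. hom z s * complex_of_real (exp (- s)))"
    by (auto simp: hom_def indicator_def fun_eq_iff powr_def Ln_of_real exp_minus divide_inverse exp_of_real)
  have "?f absolutely_integrable_on {0<..}"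
    using absolutely_integrable_Gamma_integral[OF assms, of 1] by simp
  then have "integrable lebesgue (\<lambda>s. hom z s * complex_of_real (exp (- s)))"
    unfolding set_integrable_def eq .
  moreover have m: "(\<lambda>s. hom z s * complex_of_real (exp (- s))) \<in> borel_measurable borel" by measurable
  ultimately show int: "integrable lborel (\<lambda>s. hom z s * complex_of_real (exp (- s)))"
    by (subst (asm) integrable_completion) auto
  have "set_integrable lborel UNIV (\<lambda>s. hom z s * complex_of_real (exp (- s)))"
    using int by (simp add: set_integrable_def)
  from set_borel_integral_eq_integral(2)[OF this]
  have "(LINT s|lborel. hom z s * complex_of_real (exp (- s))) = integral UNIV (\<lambda>s. hom z s * complex_of_real (exp (- s)))"
    by (simp add: set_lebesgue_integral_def)
  also have "\<dots> = Gamma z"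
  proof (rule integral_unique)
    have "(?f has_integral Gamma z) {0..}" by (rule Gamma_integral_complex[OF assms])
    then have "(?f has_integral Gamma z) {0<..}"
      by (rule iffD1[OF has_integral_spike_set_eq, rotated 2])
         (auto intro: negligible_subset[OF negligible_sing[of 0]])
    then have "((\<lambda>s. if s \<in> {0<..} then ?f s else 0) has_integral Gamma z) UNIV"
      by (simp only: has_integral_restrict_UNIV)
    moreover have "(\<lambda>s. if s \<in> {0<..} then ?f s else 0) = (\<lambda>s. hom z s * complex_of_real (exp (- s)))"
      unfolding eq[symmetric] by (auto simp: indicator_def)
    ultimately show "((\<lambda>s. hom z s * complex_of_real (exp (- s))) has_integral Gamma z) UNIV" by simp
  qed
  finally show "(LINT s|lborel. hom z s * complex_of_real (exp (- s))) = Gamma z" .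
qed

text \<open>Substitute t * s for \<open>s\<close>: the two powers contribute degrees a - 1 and b -
  1, and the Jacobian contributes 1.\<close>

lemma hom_convolution_scale:
  assumes "t > 0"
  shows "(LINT s|lborel. hom a s * hom b (t - s)) =
     exp ((a + b - 1) * complex_of_real (ln t)) * (LINT s|lborel. hom a s * hom b (1 - s))"
proof -
  have "(LINT s|lborel. hom a s * hom b (t - s)) =
     \<bar>t\<bar> *\<^sub>R (LINT s|lborel. hom a (0 + t * s) * hom b (t - (0 + t * s)))"
    using assms by (intro lborel_integral_real_affine) auto
  also have "(\<lambda>s. hom a (0 + t * s) * hom b (t - (0 + t * s))) =
     (\<lambda>s. exp ((a - 1) * complex_of_real (ln t)) * exp ((b - 1) * complex_of_real (ln t)) * (hom a s * hom b (1 - s)))"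
  proof
    fix s
    have "t - (0 + t * s) = t * (1 - s)" by (simp add: algebra_simps)
    then show "hom a (0 + t * s) * hom b (t - (0 + t * s)) =
       exp ((a - 1) * complex_of_real (ln t)) * exp ((b - 1) * complex_of_real (ln t)) * (hom a s * hom b (1 - s))"
      by (simp only: hom_scale[OF assms] add_0) (simp only: mult_ac)
  qed
  also have "\<bar>t\<bar> *\<^sub>R (LINT s|lborel. \<dots> s) = 
     (complex_of_real t * exp ((a - 1) * complex_of_real (ln t)) * exp ((b - 1) * complex_of_real (ln t))) * (LINT s|lborel. hom a s * hom b (1 - s))"
    using assms by (simp only: integral_mult_right_zero) (simp add: scaleR_conv_of_real mult.assoc)
  also have "complex_of_real t = exp (complex_of_real (ln t))"
    using assms by (simp add: exp_of_real)
  also have "exp (complex_of_real (ln t)) * exp ((a - 1) * complex_of_real (ln t)) * exp ((b - 1) * complex_of_real (ln t)) = exp ((a + b - 1) * complex_of_real (ln t))"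
    by (simp add: exp_add[symmetric] algebra_simps)
  finally show ?thesis .
qed

text \<open>Euler's argument: integrate the convolution against exp (- x). Since exp (- x) factors
  as exp (- s) * exp (- (x - s)), one order of integration gives \<open>Gamma a * Gamma b\<close>;
  by homogeneity the other gives \<open>J * Gamma (a + b)\<close>, where \<open>J\<close> is the
  value at 1.\<close>

theorem Beta_convolution:
  assumes a: "Re a > 0" and b: "Re b > 0" and t: "t > 0"
  shows "(LINT s|lborel. hom a s * hom b (t - s)) =
     exp ((a + b - 1) * complex_of_real (ln t)) * (Gamma a * Gamma b * rGamma (a + b))"
proof -
  define J where "J = (LINT s|lborel. hom a s * hom b (1 - s))"
  define K where "K s x = hom a s * hom b (x - s) * complex_of_real (exp (- x))" for s x
  have K_split: "K s x = hom a s * complex_of_real (exp (- s)) * (hom b (x - s) * complex_of_real (exp (- (x - s))))" for s x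
    by (simp add: K_def exp_add[symmetric] flip: of_real_mult)
  have K_meas: "case_prod K \<in> borel_measurable (lborel \<Otimes>\<^sub>M lborel)"
    unfolding K_def by measurable
  have shift_int: "integrable lborel (\<lambda>x. g (x - s))" if "integrable lborel g" for g :: "real \<Rightarrow> complex" and s
    using lborel_integrable_real_affine[OF that, of 1 "- s"] by simp
  have shift: "(LINT x|lborel. g (x - s)) = (LINT x|lborel. g x)"
    for g :: "real \<Rightarrow> 'a::{banach,second_countable_topology}" and s
    using lborel_integral_real_affine[of 1 g "- s"] by simp
  have Kint: "integrable lborel (K s)" for s
    unfolding K_split by (intro integrable_mult_right shift_int[OF integrable_Gamma[OF b]])
  have "integrable (lborel \<Otimes>\<^sub>M lborel) (case_prod K)"
  proof (rule lborel_pair.Fubini_integrable[OF K_meas])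
    have "(LINT x|lborel. norm (K s x)) = norm (hom a s * complex_of_real (exp (- s))) * (LINT x|lborel. norm (hom b x * complex_of_real (exp (- x))))" for s
      unfolding K_split norm_mult[of "hom a s * complex_of_real (exp (- s))"]
      using shift[of "\<lambda>x. norm (hom b x * complex_of_real (exp (- x)))" s] by simp
    then show "integrable lborel (\<lambda>s. LINT x|lborel. norm (case_prod K (s, x)))"
      using integrable_norm[OF integrable_Gamma[OF a]] by simp
  qed (use Kint in simp)
  from lborel_pair.Fubini_integral[OF this]
  have "(LINT x|lborel. LINT s|lborel. K s x) = (LINT s|lborel. LINT x|lborel. K s x)" .
  also have "\<dots> = (LINT s|lborel. hom a s * complex_of_real (exp (- s)) * Gamma b)"
  proof (intro Bochner_Integration.integral_cong refl)
    fix s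
    show "(LINT x|lborel. K s x) = hom a s * complex_of_real (exp (- s)) * Gamma b"
      unfolding K_split integral_mult_right_zero
      using shift[of "\<lambda>x. hom b x * complex_of_real (exp (- x))" s] integral_Gamma[OF b] by simp
  qed
  also have "\<dots> = Gamma a * Gamma b"
    unfolding integral_mult_left_zero integral_Gamma[OF a] ..
  also have "(LINT x|lborel. LINT s|lborel. K s x) = (LINT x|lborel. J * (hom (a + b) x * complex_of_real (exp (- x))))"
  proof (intro Bochner_Integration.integral_cong refl)
    fix x :: real
    have "(LINT s|lborel. hom a s * hom b (x - s)) = hom (a + b) x * J"
    proof (cases "x > 0")
      case True
      then show ?thesis using hom_convolution_scale[OF True, of a b] by (simp add: J_def hom_def)
    next
      case False
      then have "(\<lambda>s. hom a s * hom b (x - s)) = (\<lambda>s. 0)" by (auto simp: hom_def)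
      then show ?thesis using False by (simp add: hom_def)
    qed
    then show "(LINT s|lborel. K s x) = J * (hom (a + b) x * complex_of_real (exp (- x)))"
      unfolding K_def integral_mult_left_zero by (simp add: mult_ac)
  qed
  also have "\<dots> = J * Gamma (a + b)"
    unfolding integral_mult_right_zero using integral_Gamma[of "a + b"] a b by simp
  finally have JG: "J * Gamma (a + b) = Gamma a * Gamma b" .
  have "Gamma (a + b) * rGamma (a + b) = 1"
  proof -
    have "a + b \<notin> \<int>\<^sub>\<le>\<^sub>0" using a b by (auto elim!: nonpos_Ints_cases simp: complex_eq_iff)
    then show ?thesis by (simp add: rGamma_inverse_Gamma Gamma_eq_zero_iff)
  qed
  then have "J = Gamma a * Gamma b * rGamma (a + b)"
    using JG by (metis mult.assoc mult.right_neutral)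
  then show ?thesis using hom_convolution_scale[OF t, of a b] by (simp add: J_def)
qed

text \<open>The density of the logarithm of a standard exponential variable, that is, a reflected
  Gumbel density. The substitution s = exp v turns Euler's integral for Gamma on the line Re = 1
  into its Fourier transform.\<close>

definition gumbel :: "real \<Rightarrow> real" where
  "gumbel v = exp (v - exp v)"

lemma integral_gumbel_osc:
  "(LINT v|lborel. complex_of_real (gumbel v) * osc (- v) x) = Gamma (1 - \<i> * complex_of_real x)"
proof -
  have eq: "exp v *\<^sub>R (hom (1 - \<i> * complex_of_real x) (exp v) * complex_of_real (exp (- exp v))) = complex_of_real (gumbel v) * osc (- v) x" for v x
    by (simp add: hom_def gumbel_def osc_def scaleR_conv_of_real exp_diff exp_minus divide_inverse mult_ac exp_of_real)
  have set_int: "set_integrable lborel {0<..} (\<lambda>s. hom (1 - \<i> * complex_of_real x) s * complex_of_real (exp (- s)))" for x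
    using integrable_Gamma[of "1 - \<i> * complex_of_real x"]
    unfolding set_integrable_def by (intro integrable_mult_indicator) auto
  have "(LINT s:{0<..}|lborel. hom (1 - \<i> * complex_of_real x) s * complex_of_real (exp (- s))) = (LINT s|lborel. hom (1 - \<i> * complex_of_real x) s * complex_of_real (exp (- s)))"
    unfolding set_lebesgue_integral_def
    by (intro Bochner_Integration.integral_cong) (auto simp: indicator_def hom_def)
  then show "(LINT v|lborel. complex_of_real (gumbel v) * osc (- v) x) = Gamma (1 - \<i> * complex_of_real x)"
    using integral_exp_subst[OF _ set_int[of x]] integral_Gamma[of "1 - \<i> * complex_of_real x"]
    unfolding eq by simp
qed

subsection \<open>Autocorrelations\<close>

lemma borel_measurable_cnj [measurable (raw)]:
  "f \<in> borel_measurable M \<Longrightarrow> (\<lambda>x. cnj (f x)) \<in> borel_measurable M"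
  by (rule measurable_compose[of f M borel cnj, OF _ borel_measurable_continuous_onI])
     (auto intro!: linear_continuous_on bounded_linear_cnj)

definition autocorr :: "(real \<Rightarrow> complex) \<Rightarrow> real \<Rightarrow> complex" where
  "autocorr g z = (LINT x|lborel. cnj (g x) * g (x + z))"

text \<open>The reflection and the factor 1 / (2 * pi) are chosen so that \<open>FT\<close> returns
  exactly \<open>autocorr g\<close>.\<close>

definition power_spectrum :: "(real \<Rightarrow> complex) \<Rightarrow> real \<Rightarrow> real" where
  "power_spectrum g y = (norm (FT g (- y)))\<^sup>2 / (2 * pi)"

lemma test_bounded:
  assumes u: "u \<in> test_functions_within R" shows "\<exists>B\<ge>0. \<forall>x. norm (u x) \<le> B"
proof -
  obtain B where "B \<ge> 0" "deriv_bound 0 R B u"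
    using ex_deriv_bound[OF test_functions_withinD(1)[OF u]] by blast
  then show ?thesis using deriv_bound_global[OF u, of 0 B 0] by auto
qed

lemma FT_FT_test:
  fixes u :: "real \<Rightarrow> complex"
  assumes u: "u \<in> test_functions_within R" shows "FT (FT u) x = 2 * pi * u (- x)"
proof -
  obtain B where "\<And>x. norm (u x) \<le> B" using test_bounded[OF u] by blast
  then show ?thesis
    by (intro FT_FT rapid_integrable[OF rapid_test[OF u]] test_continuous[OF u]
        rapid_integrable[OF rapid_Z_space[OF FT_Z_space[OF u]]])
qed

text \<open>The Wiener-Khinchin relation: expand the conjugated factor as an integral, exchange the
  order, and the inner integral becomes a double Fourier transform, which inversion
  evaluates.\<close>

lemma FT_norm_square:
  assumes g: "g \<in> test_functions_within R"
  shows "FT (\<lambda>y. complex_of_real ((norm (FT g y))\<^sup>2)) x = 2 * pi * autocorr g (- x)"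
proof -
  define K where "K y s = cnj (g s) * osc (- y) s * (FT g y * osc x y)" for y s
  have Fg: "FT g \<in> Z_space" by (rule FT_Z_space[OF g])
  have [measurable]: "g \<in> borel_measurable borel" "FT g \<in> borel_measurable borel"
    using rapid_measurable[OF rapid_test[OF g]] rapid_measurable[OF rapid_Z_space[OF Fg]] .
  have "FT (\<lambda>y. complex_of_real ((norm (FT g y))\<^sup>2)) x = (LINT y|lborel. LINT s|lborel. K y s)"
    unfolding FT_def[of "\<lambda>y. complex_of_real ((norm (FT g y))\<^sup>2)"]
  proof (intro Bochner_Integration.integral_cong refl)
    fix y
    have "complex_of_real ((norm (FT g y))\<^sup>2) = cnj (FT g y) * FT g y"
      unfolding complex_norm_square by (rule mult.commute)
    also have "cnj (FT g y) = (LINT s|lborel. cnj (g s) * osc (- y) s)"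
      unfolding FT_def by (simp add: Bochner_Integration.integral_cnj[symmetric] cnj_osc del: Bochner_Integration.integral_cnj)
    finally show "complex_of_real ((norm (FT g y))\<^sup>2) * osc x y = (LINT s|lborel. K y s)"
      unfolding K_def integral_mult_left_zero by (simp add: mult.assoc)
  qed
  also have "\<dots> = (LINT s|lborel. LINT y|lborel. K y s)"
  proof (rule Fubini_dominated[where a = "\<lambda>y. norm (FT g y)" and b = "\<lambda>s. norm (g s)"])
    show "case_prod K \<in> borel_measurable (lborel \<Otimes>\<^sub>M lborel)" unfolding K_def by measurable
  qed (auto simp: K_def norm_mult intro!: rapid_integrable_norm rapid_test[OF g] rapid_Z_space[OF Fg])
  also have "\<dots> = (LINT s|lborel. complex_of_real (2 * pi) * (cnj (g s) * g (s + - x)))"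
  proof (intro Bochner_Integration.integral_cong refl)
    fix s
    have "(LINT y|lborel. K y s) = (LINT y|lborel. cnj (g s) * (FT g y * osc (x - s) y))"
    proof (intro Bochner_Integration.integral_cong refl)
      fix y
      have "osc (x - s) y = osc x y * osc (- y) s"
        using osc_add[of x "- s" y] by (simp add: osc_def mult.commute)
      then show "K y s = cnj (g s) * (FT g y * osc (x - s) y)" by (simp add: K_def mult_ac)
    qed
    also have "\<dots> = cnj (g s) * FT (FT g) (x - s)"
      unfolding integral_mult_right_zero FT_def[of "FT g"] ..
    finally show "(LINT y|lborel. K y s) = complex_of_real (2 * pi) * (cnj (g s) * g (s + - x))"
      by (simp add: FT_FT_test[OF g])
  qed
  also have "\<dots> = 2 * pi * autocorr g (- x)"
    unfolding integral_mult_right_zero autocorr_def ..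
  finally show ?thesis .
qed

lemma autocorr_eq_FT:
  assumes g: "g \<in> test_functions_within R"
  shows "autocorr g = FT (\<lambda>y. complex_of_real (power_spectrum g y))"
proof
  fix x
  have "FT (\<lambda>y. complex_of_real (power_spectrum g y)) x
      = FT (\<lambda>y. complex_of_real (1 / (2 * pi)) * complex_of_real ((norm (FT g (- y)))\<^sup>2)) x"
    by (simp add: power_spectrum_def)
  also have "\<dots> = complex_of_real (1 / (2 * pi)) * (2 * pi * autocorr g x)"
    unfolding FT_cmult FT_reflect[of "\<lambda>y. complex_of_real ((norm (FT g y))\<^sup>2)"] FT_norm_square[OF g] by simp
  also have "\<dots> = autocorr g x" by simp
  finally show "autocorr g x = FT (\<lambda>y. complex_of_real (power_spectrum g y)) x" ..
qed

lemma power_spectrum_nonneg: "power_spectrum g y \<ge> 0"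
  by (simp add: power_spectrum_def)

lemma
  assumes g: "g \<in> test_functions_within R"
  shows rapid_power_spectrum: "rapid (\<lambda>y. complex_of_real (power_spectrum g y))"
    and isCont_power_spectrum: "isCont (power_spectrum g) y"
proof -
  have Z: "FT (\<lambda>x. g (- x)) \<in> Z_space" by (rule FT_Z_space[OF test_functions_within_reflect[OF g]])
  have eq: "power_spectrum g = (\<lambda>y. (norm (FT (\<lambda>x. g (- x)) y))\<^sup>2 / (2 * pi))"
    by (simp add: power_spectrum_def[abs_def] FT_reflect)
  have cont: "continuous_on UNIV (power_spectrum g)"
    unfolding eq by (intro continuous_intros Z_space_continuous[OF Z]) simp
  then show "isCont (power_spectrum g) y"
    by (simp add: continuous_on_eq_continuous_at)
  obtain C where C: "\<And>x. norm (FT (\<lambda>x. g (- x)) x) \<le> C"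
    using Z_space_decay[OF Z, of 0] by auto
  show "rapid (\<lambda>y. complex_of_real (power_spectrum g y))"
  proof (rule rapid_bound[OF rapid_Z_space[OF Z], of _ "C / (2 * pi)"])
    show "(\<lambda>y. complex_of_real (power_spectrum g y)) \<in> borel_measurable borel"
      using borel_measurable_continuous_onI[OF cont] by measurable
    fix y
    have "(norm (FT (\<lambda>x. g (- x)) y))\<^sup>2 \<le> C * norm (FT (\<lambda>x. g (- x)) y)"
      unfolding power2_eq_square by (intro mult_right_mono C) simp
    then show "norm (complex_of_real (power_spectrum g y)) \<le> C / (2 * pi) * norm (FT (\<lambda>x. g (- x)) y)"
      unfolding norm_of_real abs_of_nonneg[OF power_spectrum_nonneg] unfolding eq
      by (simp add: divide_right_mono)
  qed
qed

text \<open>For \<bar>z\<bar> > 2 * R the points \<open>x\<close> and \<open>x + z\<close> cannot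
  both lie in [-R, R]. Smoothness comes for free from the representation by
  \<open>FT\<close>.\<close>

lemma autocorr_test:
  assumes g: "g \<in> test_functions_within R"
  shows "autocorr g \<in> test_functions_within (2 * R)"
proof -
  have "autocorr g z = 0" if "\<bar>z\<bar> > 2 * R" for z
  proof -
    have *: "cnj (g x) * g (x + z) = 0" for x
    proof (cases "\<bar>x\<bar> > R")
      case False
      then have "\<bar>x + z\<bar> > R" using that by linarith
      then show ?thesis by (simp add: test_functions_withinD(2)[OF g])
    qed (simp add: test_functions_withinD(2)[OF g])
    show ?thesis unfolding autocorr_def * by simp
  qed
  moreover have "smooth (autocorr g)"
    unfolding autocorr_eq_FT[OF g] by (rule smooth_FT[OF rapid_power_spectrum[OF g]])
  ultimately show ?thesis by (simp add: test_functions_within_def)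
qed

subsection \<open>The Laplace convolution\<close>

definition dfun :: "(real \<Rightarrow> complex) \<Rightarrow> real \<Rightarrow> complex" where
  "dfun u s = (if s > 0 then complex_of_real (exp (- ln s / 2)) * fourier u (ln s) else 0)"

lemma dfun_D_space: "u \<in> test_functions_within R \<Longrightarrow> dfun u \<in> D_space"
proof -
  assume u: "u \<in> test_functions_within R"
  have "(\<lambda>x. complex_of_real (exp (x / 2)) * dfun u (exp x)) = fourier u"
    by (simp add: dfun_def fun_eq_iff exp_minus mult.assoc[symmetric] flip: of_real_mult)
  then show ?thesis by (simp add: D_space_def fourier_Z_space[OF u]) (simp add: dfun_def)
qed

lemma hom_half:
  "hom (1 / 2 + \<i> * complex_of_real x) s = (if s > 0 then complex_of_real (exp (- ln s / 2)) * osc (ln s) x else 0)"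
proof -
  have "exp ((1 / 2 + \<i> * complex_of_real x - 1) * complex_of_real (ln s)) =
      complex_of_real (exp (- ln s / 2)) * osc (ln s) x"
    unfolding exp_of_real[symmetric] osc_def exp_add[symmetric] by (simp add: algebra_simps)
  then show ?thesis by (simp only: hom_def)
qed

text \<open>A Mellin representation: \<open>dfun u\<close> is a superposition of the powers s powr
  (-1/2 - i x), whose convolutions the Beta integral evaluates.\<close>

lemma dfun_eq:
  "dfun u s = complex_of_real (1 / sqrt (2 * pi)) *
     (LINT x|lborel. u x * hom (1 / 2 - \<i> * complex_of_real x) s)"
proof (cases "s > 0")
  case True
  have "hom (1 / 2 - \<i> * complex_of_real x) s = complex_of_real (exp (- ln s / 2)) * osc (- ln s) x" for x
    using hom_half[of "- x" s] True by (simp add: osc_def)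
  then have "(LINT x|lborel. u x * hom (1 / 2 - \<i> * complex_of_real x) s) =
      (LINT x|lborel. complex_of_real (exp (- ln s / 2)) * (u x * osc (- ln s) x))"
    by (simp add: mult_ac)
  then show ?thesis using True
    unfolding integral_mult_right_zero by (simp add: dfun_def fourier_def FT_def)
qed (simp add: dfun_def hom_def)

lemma cnj_dfun_eq:
  "cnj (dfun u s) = complex_of_real (1 / sqrt (2 * pi)) *
     (LINT x|lborel. cnj (u x) * hom (1 / 2 + \<i> * complex_of_real x) s)"
proof -
  have "cnj (hom (1 / 2 - \<i> * complex_of_real x) s) = hom (1 / 2 + \<i> * complex_of_real x) s" for x
    by (simp add: hom_def exp_cnj)
  then show ?thesis unfolding dfun_eq by (simp add: Bochner_Integration.integral_cnj[symmetric] del: Bochner_Integration.integral_cnj)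
qed

text \<open>The common absolute value of all powers on the critical line, hence a majorant
  independent of the frequency.\<close>

definition rsqrt :: "real \<Rightarrow> real" where
  "rsqrt s = (if s > 0 then exp (- ln s / 2) else 0)"

lemma rsqrt_nonneg: "rsqrt s \<ge> 0"
  by (simp add: rsqrt_def)

lemma rsqrt_measurable [measurable]: "rsqrt \<in> borel_measurable borel"
  unfolding rsqrt_def[abs_def] by measurable

lemma norm_hom_half: "norm (hom (1 / 2 + \<i> * complex_of_real x) s) = rsqrt s"
  "norm (hom (1 / 2 - \<i> * complex_of_real x) s) = rsqrt s"
  using hom_half[of x s] hom_half[of "- x" s] by (simp_all add: rsqrt_def norm_mult)

lemma rsqrt_antimono: "0 < s \<Longrightarrow> s \<le> t \<Longrightarrow> rsqrt t \<le> rsqrt s"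
  by (simp add: rsqrt_def)

lemma integrable_rsqrt_exp: "integrable lborel (\<lambda>s. rsqrt s * exp (- s))"
  using integrable_norm[OF integrable_Gamma[of "1 / 2 + \<i> * complex_of_real 0"]]
  by (simp only: norm_mult norm_hom_half norm_of_real abs_exp_cancel) simp

text \<open>Split at t / 2. On each half one factor stays away from its singularity and is at most
  \<open>rsqrt (t / 2)\<close>; the other is compared with the integrable
  \<open>rsqrt s * exp (- s)\<close>, at the price exp t.\<close>

lemma integrable_rsqrt_convolution:
  assumes t: "t > 0" shows "integrable lborel (\<lambda>s. rsqrt s * rsqrt (t - s))"
proof -
  let ?\<gamma> = "\<lambda>s. rsqrt s * exp (- s)"
  define K where "K = rsqrt (t / 2) * exp t"
  have K: "K \<ge> 0" by (simp add: K_def rsqrt_nonneg)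
  have \<gamma>: "rsqrt s \<le> exp t * ?\<gamma> s" if "s \<le> t" for s
  proof -
    have "1 * rsqrt s \<le> exp (t - s) * rsqrt s" using that by (intro mult_right_mono rsqrt_nonneg) simp
    then show ?thesis by (simp add: exp_diff exp_minus divide_inverse mult_ac)
  qed
  have "integrable lborel (\<lambda>s. ?\<gamma> (t + (-1) * s))"
    by (rule lborel_integrable_real_affine[OF integrable_rsqrt_exp]) simp
  then have "integrable lborel (\<lambda>s. K * (?\<gamma> s + ?\<gamma> (t - s)))"
    by (intro integrable_mult_right Bochner_Integration.integrable_add integrable_rsqrt_exp) simp
  then show ?thesis
  proof (rule Bochner_Integration.integrable_bound)
    show "AE s in lborel. norm (rsqrt s * rsqrt (t - s)) \<le> norm (K * (?\<gamma> s + ?\<gamma> (t - s)))"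
    proof (rule AE_I2)
      fix s
      have nn: "?\<gamma> s \<ge> 0" "?\<gamma> (t - s) \<ge> 0" by (auto intro: mult_nonneg_nonneg rsqrt_nonneg)
      have "rsqrt s * rsqrt (t - s) \<le> K * (?\<gamma> s + ?\<gamma> (t - s))"
      proof (cases "0 < s \<and> s < t")
        case True
        show ?thesis
        proof (cases "s \<le> t / 2")
          case s: True
          have "rsqrt s * rsqrt (t - s) \<le> (exp t * ?\<gamma> s) * rsqrt (t / 2)"
            using True s t by (intro mult_mono \<gamma> rsqrt_antimono mult_nonneg_nonneg rsqrt_nonneg) auto
          also have "\<dots> = K * ?\<gamma> s" by (simp add: K_def mult_ac)
          also have "\<dots> \<le> K * (?\<gamma> s + ?\<gamma> (t - s))" using nn K by (intro mult_left_mono) auto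
          finally show ?thesis .
        next
          case s: False
          have "rsqrt s * rsqrt (t - s) \<le> rsqrt (t / 2) * (exp t * ?\<gamma> (t - s))"
            using True s t by (intro mult_mono \<gamma> rsqrt_antimono mult_nonneg_nonneg rsqrt_nonneg) auto
          also have "\<dots> = K * ?\<gamma> (t - s)" by (simp add: K_def mult_ac)
          also have "\<dots> \<le> K * (?\<gamma> s + ?\<gamma> (t - s))" using nn K by (intro mult_left_mono) auto
          finally show ?thesis .
        qed
      next
        case False
        then have "rsqrt s * rsqrt (t - s) = 0" by (auto simp: rsqrt_def)
        then show ?thesis using mult_nonneg_nonneg[OF K add_nonneg_nonneg[OF nn]] by (simp only:)
      qed
      then show "norm (rsqrt s * rsqrt (t - s)) \<le> norm (K * (?\<gamma> s + ?\<gamma> (t - s)))"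
        using rsqrt_nonneg K by (simp add: abs_mult)
    qed
  qed measurable
qed

text \<open>This is the factor left over by the Beta integral. It is the restriction of an entire
  function, so it may multiply test functions; the transform of \<open>gumbel\<close> is its
  reciprocal.\<close>

definition rg :: "real \<Rightarrow> complex" where
  "rg x = rGamma (1 - \<i> * complex_of_real x)"

lemma smooth_rg: "smooth rg"
  using smooth_entire[OF holomorphic_rGamma, of "- \<i>" 1] by (simp add: rg_def[abs_def])

lemma rg_Gamma: "rg x * Gamma (1 - \<i> * complex_of_real x) = 1"
proof -
  have "1 - \<i> * complex_of_real x \<notin> \<int>\<^sub>\<le>\<^sub>0" by (auto elim!: nonpos_Ints_cases simp: complex_eq_iff)
  then show ?thesis by (simp add: rg_def rGamma_inverse_Gamma Gamma_eq_zero_iff)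
qed

lemma rGamma_half_Gamma: "rGamma (1 / 2 - \<i> * complex_of_real x) * Gamma (1 / 2 - \<i> * complex_of_real x) = 1"
proof -
  have "1 / 2 - \<i> * complex_of_real x \<notin> \<int>\<^sub>\<le>\<^sub>0" by (auto elim!: nonpos_Ints_cases simp: complex_eq_iff)
  then show ?thesis by (simp add: rGamma_inverse_Gamma Gamma_eq_zero_iff)
qed

text \<open>The reciprocal Gamma factors put into \<open>u\<close> cancel Gamma (1/2 + i x) and
  Gamma (1/2 - i y) from the Beta integral. The rest depends only on z = y - x, and integrating over
  \<open>x\<close> with \<open>z\<close> fixed produces the autocorrelation.\<close>

theorem laplace_conv_dfun:
  assumes g: "g \<in> test_functions_within R" and t: "t > 0"
    and u_def: "u = (\<lambda>x. g x * rGamma (1 / 2 - \<i> * complex_of_real x))"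
  shows "((\<lambda>s. cnj (dfun u s)) \<star> dfun u) t =
     complex_of_real (1 / sqrt (2 * pi)) * fourier (\<lambda>z. autocorr g z * rg z) (ln t)"
proof -
  define c where "c = complex_of_real (1 / sqrt (2 * pi))"
  define F1 where "F1 r = (LINT y|lborel. u y * hom (1 / 2 - \<i> * complex_of_real y) r)" for r
  have u: "u \<in> test_functions_within R"
    unfolding u_def using test_functions_within_mult[OF g smooth_entire[OF holomorphic_rGamma, of "- \<i>" "1 / 2"]]
    by simp
  have [measurable]: "u \<in> borel_measurable borel" "g \<in> borel_measurable borel"
    using rapid_measurable[OF rapid_test[OF u]] rapid_measurable[OF rapid_test[OF g]] .
  have iu: "integrable lborel (\<lambda>x. norm (u x))" by (rule rapid_integrable_norm[OF rapid_test[OF u]])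
  have c0: "c \<noteq> 0" by (simp add: c_def)
  have dF: "dfun u r = c * F1 r" for r by (simp add: dfun_eq F1_def c_def)
  have [measurable]: "fourier u \<in> borel_measurable borel"
    by (rule rapid_measurable[OF rapid_Z_space[OF fourier_Z_space[OF u]]])
  have "F1 = (\<lambda>r. dfun u r / c)" using dF c0 by (simp add: fun_eq_iff)
  also have "\<dots> \<in> borel_measurable borel" unfolding dfun_def[abs_def] by measurable
  finally have [measurable]: "F1 \<in> borel_measurable borel" .
  define A where "A = (LINT x|lborel. norm (u x))"
  have F1_bound: "norm (F1 r) \<le> rsqrt r * A" for r
  proof -
    have "norm (F1 r) \<le> (LINT y|lborel. rsqrt r * norm (u y))"
      unfolding F1_def by (rule order_trans[OF integral_norm_bound]) (simp add: norm_mult norm_hom_half mult.commute)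
    then show ?thesis by (simp add: A_def)
  qed
  note iq = integrable_rsqrt_convolution[OF t]
  have hom_meas [measurable]: "(\<lambda>p. hom (f p) (s p)) \<in> borel_measurable M"
    if [measurable]: "f \<in> borel_measurable M" "s \<in> borel_measurable M" for f s and M :: "'b measure"
    unfolding hom_def by measurable
  define m where "m z = osc (- ln t) z * rg z" for z
  have rg_meas [measurable]: "rg \<in> borel_measurable borel"
    by (rule borel_measurable_continuous_onI[OF smooth_continuous[OF smooth_rg]])
  have inner: "(LINT s|lborel. hom (1 / 2 + \<i> * complex_of_real x) s * F1 (t - s)) =
     Gamma (1 / 2 + \<i> * complex_of_real x) * (LINT y|lborel. g y * m (y - x))" for x
  proof -
    define K where "K s y = hom (1 / 2 + \<i> * complex_of_real x) s * (u y * hom (1 / 2 - \<i> * complex_of_real y) (t - s))" for s y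
    have "(LINT s|lborel. hom (1 / 2 + \<i> * complex_of_real x) s * F1 (t - s)) = (LINT s|lborel. LINT y|lborel. K s y)"
      unfolding K_def F1_def integral_mult_right_zero ..
    also have "\<dots> = (LINT y|lborel. LINT s|lborel. K s y)"
    proof (rule Fubini_dominated[OF _ iq iu])
      show "case_prod K \<in> borel_measurable (lborel \<Otimes>\<^sub>M lborel)" unfolding K_def by measurable
      show "norm (K s y) \<le> rsqrt s * rsqrt (t - s) * norm (u y)" for s y
        by (simp add: K_def norm_mult norm_hom_half mult_ac)
    qed
    also have "\<dots> = (LINT y|lborel. Gamma (1 / 2 + \<i> * complex_of_real x) * (g y * m (y - x)))"
    proof (intro Bochner_Integration.integral_cong refl)
      fix y
      let ?a = "1 / 2 + \<i> * complex_of_real x" and ?b = "1 / 2 - \<i> * complex_of_real y"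
      have "(LINT s|lborel. K s y) = u y * (LINT s|lborel. hom ?a s * hom ?b (t - s))"
        unfolding K_def integral_mult_right_zero[symmetric] by (simp add: mult_ac)
      also have "(LINT s|lborel. hom ?a s * hom ?b (t - s)) =
          exp ((?a + ?b - 1) * complex_of_real (ln t)) * (Gamma ?a * Gamma ?b * rGamma (?a + ?b))"
        by (rule Beta_convolution) (use t in auto)
      also have "?a + ?b = 1 - \<i> * complex_of_real (y - x)" by (simp add: algebra_simps)
      also have "exp ((1 - \<i> * complex_of_real (y - x) - 1) * complex_of_real (ln t)) = osc (- ln t) (y - x)"
        by (simp add: osc_def algebra_simps)
      also have "u y * (osc (- ln t) (y - x) * (Gamma ?a * Gamma ?b * rGamma (1 - \<i> * complex_of_real (y - x))))
         = Gamma ?a * (g y * m (y - x)) * (rGamma ?b * Gamma ?b)"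
        by (simp add: u_def m_def rg_def mult_ac)
      finally show "(LINT s|lborel. K s y) = Gamma ?a * (g y * m (y - x))"
        by (simp add: rGamma_half_Gamma)
    qed
    finally show ?thesis by (simp only: integral_mult_right_zero)
  qed
  \<comment> \<open>\<open>dfun\<close> vanishes at nonpositive arguments, so the integral over
    {0<..<t} may be extended to the line.\<close>
  have "((\<lambda>s. cnj (dfun u s)) \<star> dfun u) t = (LINT s|lborel. cnj (dfun u s) * dfun u (t - s))"
    unfolding laplace_conv_def set_lebesgue_integral_def
    by (intro Bochner_Integration.integral_cong refl) (auto simp: indicator_def dfun_def)
  also have "\<dots> = (LINT s|lborel. c\<^sup>2 * (LINT x|lborel. cnj (u x) * hom (1 / 2 + \<i> * complex_of_real x) s * F1 (t - s)))"
  proof (intro Bochner_Integration.integral_cong refl)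
    fix s
    have "cnj (dfun u s) * dfun u (t - s) =
        (c * (LINT x|lborel. cnj (u x) * hom (1 / 2 + \<i> * complex_of_real x) s)) * (c * F1 (t - s))"
      by (simp only: cnj_dfun_eq c_def[symmetric] dF[of "t - s"])
    then show "cnj (dfun u s) * dfun u (t - s) =
        c\<^sup>2 * (LINT x|lborel. cnj (u x) * hom (1 / 2 + \<i> * complex_of_real x) s * F1 (t - s))"
      unfolding integral_mult_left_zero by (simp only: power2_eq_square mult_ac)
  qed
  also have "\<dots> = c\<^sup>2 * (LINT s|lborel. LINT x|lborel. cnj (u x) * hom (1 / 2 + \<i> * complex_of_real x) s * F1 (t - s))"
    by (rule integral_mult_right_zero)
  also have "(LINT s|lborel. LINT x|lborel. cnj (u x) * hom (1 / 2 + \<i> * complex_of_real x) s * F1 (t - s)) =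
     (LINT x|lborel. LINT s|lborel. cnj (u x) * hom (1 / 2 + \<i> * complex_of_real x) s * F1 (t - s))"
  proof (rule Fubini_dominated[OF _ integrable_mult_right[OF iq, of A] iu])
    show "norm (cnj (u x) * hom (1 / 2 + \<i> * complex_of_real x) s * F1 (t - s)) \<le>
      A * (rsqrt s * rsqrt (t - s)) * norm (u x)" for s x
      using mult_left_mono[OF F1_bound[of "t - s"], of "norm (u x) * rsqrt s"] rsqrt_nonneg[of s]
      by (simp add: norm_mult norm_hom_half mult_ac)
  qed measurable
  also have "\<dots> = (LINT x|lborel. LINT z|lborel. cnj (g x) * g (x + z) * m z)"
  proof (rule Bochner_Integration.integral_cong[OF refl])
    fix x
    let ?a = "1 / 2 + \<i> * complex_of_real x"
    have "(LINT s|lborel. cnj (u x) * hom ?a s * F1 (t - s)) = cnj (u x) * (LINT s|lborel. hom ?a s * F1 (t - s))"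
      unfolding integral_mult_right_zero[symmetric] by (simp add: mult.assoc)
    also have "\<dots> = cnj (u x) * Gamma ?a * (LINT y|lborel. g y * m (y - x))"
      unfolding inner by (simp add: mult.assoc)
    \<comment> \<open>Gamma commutes with conjugation, and 1/2 + i x is the conjugate of 1/2 - i
      x.\<close>
    also have "cnj (u x) * Gamma ?a = cnj (g x) * cnj (rGamma (1 / 2 - \<i> * complex_of_real x) * Gamma (1 / 2 - \<i> * complex_of_real x))"
      by (simp add: u_def cnj_rGamma cnj_Gamma mult_ac)
    also have "\<dots> = cnj (g x)" by (simp add: rGamma_half_Gamma del: complex_cnj_mult)
    also have "(LINT y|lborel. g y * m (y - x)) = (LINT z|lborel. g (x + z) * m z)"
      using lborel_integral_real_affine[of 1 "\<lambda>y. g y * m (y - x)" x] by simp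
    finally show "(LINT s|lborel. cnj (u x) * hom ?a s * F1 (t - s)) = (LINT z|lborel. cnj (g x) * g (x + z) * m z)"
      unfolding integral_mult_right_zero[symmetric] by (simp add: mult.assoc)
  qed
  also have "\<dots> = (LINT z|lborel. LINT x|lborel. cnj (g x) * g (x + z) * m z)"
  proof -
    obtain B where B: "B \<ge> 0" "\<And>x. norm (g x) \<le> B" using test_bounded[OF g] by blast
    obtain M where M: "M \<ge> 0" "deriv_bound 0 (2 * R) M rg" using ex_deriv_bound[OF smooth_rg] by blast
    \<comment> \<open>A local bound on \<open>rg\<close> suffices, because \<open>g x\<close> and
      \<open>g (x + z)\<close> are both nonzero only if \<bar>z\<bar> \<le> 2 * R.\<close>
    have Mb: "norm (rg z) \<le> M" if "\<bar>z\<bar> \<le> 2 * R" for z using M(2) that by (simp add: deriv_bound_def)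
    show ?thesis
    proof (rule Fubini_dominated[where a = "\<lambda>x. norm (g x)" and b = "\<lambda>z. indicator {-2*R..2*R} z * (B * M)"])
      show "integrable lborel (\<lambda>z. indicator {-2*R..2*R} z * (B * M))"
        by (intro integrable_mult_left integrable_real_indicator) (auto simp: emeasure_lborel_Icc_eq)
      show "norm (cnj (g x) * g (x + z) * m z) \<le> norm (g x) * (indicator {-2*R..2*R} z * (B * M))" for x z
      proof (cases "g x = 0 \<or> g (x + z) = 0")
        case False
        then have "\<bar>x\<bar> \<le> R" "\<bar>x + z\<bar> \<le> R"
          using test_functions_withinD(2)[OF g] by (meson not_le)+
        then have z: "\<bar>z\<bar> \<le> 2 * R" by linarith
        have "norm (g (x + z)) * norm (rg z) \<le> B * M"
          by (intro mult_mono B Mb z) auto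
        then show ?thesis using z mult_left_mono[of _ "B * M" "norm (g x)"]
          by (auto simp: m_def norm_mult mult.assoc indicator_def abs_le_iff)
      qed (use B M in \<open>auto simp: indicator_def\<close>)
    qed (auto simp: m_def intro!: rapid_integrable_norm rapid_test[OF g])
  qed
  also have "\<dots> = FT (\<lambda>z. autocorr g z * rg z) (- ln t)"
    unfolding integral_mult_left_zero FT_def autocorr_def m_def by (simp add: mult_ac)
  finally show ?thesis by (simp add: fourier_def c_def power2_eq_square mult.assoc)
qed

corollary laplace_conv_dfun_eq_zfun:
  assumes g: "g \<in> test_functions_within R"
    and u_def: "u = (\<lambda>x. g x * rGamma (1 / 2 - \<i> * complex_of_real x))"
  shows "(\<lambda>s. cnj (dfun u s)) \<star> dfun u =
     zfun (\<lambda>z. complex_of_real (1 / sqrt (2 * pi)) * (autocorr g z * rg z))"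
proof
  fix t
  show "((\<lambda>s. cnj (dfun u s)) \<star> dfun u) t = zfun (\<lambda>z. complex_of_real (1 / sqrt (2 * pi)) * (autocorr g z * rg z)) t"
  proof (cases "t > 0")
    case True
    then show ?thesis unfolding laplace_conv_dfun[OF g True u_def]
      using True by (simp only: zfun_def if_True fourier_def FT_cmult)
  next
    case False
    then show ?thesis by (simp add: laplace_conv_def set_lebesgue_integral_def zfun_def)
  qed
qed

subsection \<open>A bump function\<close>

text \<open>Raise x / n \<le> exp (x / n) to the n-th power.\<close>

lemma power_le_exp:
  fixes x :: real
  assumes "x \<ge> 0" shows "x ^ n \<le> real n ^ n * exp x"
proof (cases "n = 0")
  case False
  have "x / real n \<le> exp (x / real n)" using exp_ge_add_one_self[of "x / real n"] by linarith
  then have "(x / real n) ^ n \<le> exp (x / real n) ^ n" using assms by (intro power_mono) auto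
  also have "\<dots> = exp x" using False by (intro exp_divide_power_eq) simp
  finally show ?thesis using False by (simp add: power_divide field_simps)
qed (use assms in simp)

text \<open>The parameter \<open>m\<close> makes the derivative of each function a linear combination of
  functions of the same family.\<close>

definition flat :: "nat \<Rightarrow> real \<Rightarrow> real" where
  "flat m x = (if x > 0 then inverse x ^ m * exp (- inverse x) else 0)"

text \<open>The exponential absorbs two powers of \<open>inverse x\<close> beyond the
  \<open>m\<close> present, so the function is quadratically small at 0 and
  \<open>has_vector_derivative_quadratic\<close> yields derivative zero there.\<close>

lemma flat_le: "\<bar>flat m x\<bar> \<le> real (m + 2) ^ (m + 2) * x\<^sup>2"
proof (cases "x > 0")
  case True
  have "inverse x ^ (m + 2) * exp (- inverse x) \<le> real (m + 2) ^ (m + 2) * exp (inverse x) * exp (- inverse x)"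
    using True by (intro mult_right_mono power_le_exp) auto
  also have "\<dots> = real (m + 2) ^ (m + 2)" by (simp add: mult.assoc flip: exp_add)
  finally have "inverse x ^ (m + 2) * exp (- inverse x) * x\<^sup>2 \<le> real (m + 2) ^ (m + 2) * x\<^sup>2"
    by (rule mult_right_mono) simp
  moreover have "flat m x = inverse x ^ (m + 2) * exp (- inverse x) * x\<^sup>2"
    using True by (simp add: flat_def power_add field_simps power2_eq_square)
  moreover have "flat m x \<ge> 0" by (simp add: flat_def)
  ultimately show ?thesis by (simp only: abs_of_nonneg)
qed (simp add: flat_def)

lemma flat_has_derivative:
  "(flat m has_real_derivative (- real m * flat (Suc m) x + flat (m + 2) x)) (at x)"
proof -
  consider "x > 0" | "x < 0" | "x = 0" by linarith
  then show ?thesis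
  proof cases
    case 1
    have "((\<lambda>x. inverse x ^ m * exp (- inverse x)) has_real_derivative
        (- real m * flat (Suc m) x + flat (m + 2) x)) (at x)"
      using 1 by (auto intro!: derivative_eq_intros simp: flat_def power2_eq_square)
         (cases m; simp add: field_simps)
    then show ?thesis
      by (rule has_field_derivative_transform_within_open[of _ _ _ "{0<..}"]) (use 1 in \<open>auto simp: flat_def\<close>)
  next
    case 2
    have "((\<lambda>x. 0) has_real_derivative (- real m * flat (Suc m) x + flat (m + 2) x)) (at x)"
      using 2 by (simp add: flat_def)
    then show ?thesis
      by (rule has_field_derivative_transform_within_open[of _ _ _ "{..<0}"]) (use 2 in \<open>auto simp: flat_def\<close>)
  next
    case 3
    have "(flat m has_vector_derivative 0) (at 0)"
      by (rule has_vector_derivative_quadratic[where C = "real (m + 2) ^ (m + 2)"])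
         (use flat_le[of m] in \<open>simp add: flat_def[of _ 0]\<close>)
    then show ?thesis using 3 by (simp add: flat_def[of _ 0] has_real_derivative_iff_has_vector_derivative)
  qed
qed

lemma smooth_flat: "smooth (\<lambda>x. complex_of_real (flat m x))"
proof -
  have der: "((\<lambda>x. complex_of_real (flat m x)) has_vector_derivative
     complex_of_real (- real m) * complex_of_real (flat (Suc m) x) + complex_of_real (flat (m + 2) x)) (at x)" for m x
  proof -
    have "((\<lambda>x. complex_of_real (flat m x)) has_vector_derivative
        complex_of_real (- real m * flat (Suc m) x + flat (m + 2) x)) (at x)"
      by (intro has_vector_derivative_of_real) (simp only: flat_has_derivative has_real_derivative_iff_has_vector_derivative[symmetric])
    then show ?thesis by simp
  qed
  have "smooth_upto n (\<lambda>x. complex_of_real (flat m x))" for n m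
  proof (induction n arbitrary: m)
    case 0
    show ?case using der by (auto simp: smooth_upto_0 intro: differentiableI_vector)
  next
    case (Suc n)
    have "(\<lambda>x. vector_derivative (\<lambda>x. complex_of_real (flat m x)) (at x)) =
      (\<lambda>x. complex_of_real (- real m) * complex_of_real (flat (Suc m) x) + complex_of_real (flat (m + 2) x))"
      using der by (intro ext vector_derivative_at)
    moreover have "smooth_upto n (\<lambda>x. complex_of_real (- real m) * complex_of_real (flat (Suc m) x) + complex_of_real (flat (m + 2) x))"
      using smooth_const[unfolded smooth_iff_upto] by (intro smooth_upto_add smooth_upto_mult Suc.IH) blast
    ultimately show ?case using der unfolding smooth_upto_Suc by (auto intro: differentiableI_vector)
  qed
  then show ?thesis by (simp add: smooth_iff_upto)
qed

text \<open>The half-width 1/2 makes the autocorrelation live on [-1, 1] and keeps the phase y * x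
  below pi / 2 for \<bar>y\<bar> \<le> 1.\<close>

definition bump :: "real \<Rightarrow> real" where
  "bump x = flat 0 (1 / 2 + x) * flat 0 (1 / 2 - x)"

lemma bump_test: "(\<lambda>x. complex_of_real (bump x)) \<in> test_functions_within (1 / 2)"
proof -
  have "smooth (\<lambda>x. complex_of_real (flat 0 (1 * x + 1 / 2)) * complex_of_real (flat 0 (- 1 * x + 1 / 2)))"
    by (intro smooth_mult smooth_affine[OF smooth_flat])
  moreover have "(\<lambda>x. complex_of_real (flat 0 (1 * x + 1 / 2)) * complex_of_real (flat 0 (- 1 * x + 1 / 2))) = (\<lambda>x. complex_of_real (bump x))"
    by (simp add: bump_def add.commute)
  ultimately show ?thesis by (auto simp: test_functions_within_def bump_def flat_def abs_if split: if_splits)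
qed

lemma bump_nonneg: "bump x \<ge> 0"
  by (simp add: bump_def flat_def)

text \<open>Both arguments of \<open>flat 0\<close> are at least 1/4, and each factor is then at
  least exp (- 4).\<close>

lemma bump_lower: "\<bar>x\<bar> \<le> 1 / 4 \<Longrightarrow> bump x \<ge> exp (- 8)"
proof -
  assume x: "\<bar>x\<bar> \<le> 1 / 4"
  have "exp (- 4) \<le> flat 0 s" if "s \<ge> 1 / 4" for s
    using that le_imp_inverse_le[of "1 / 4" s] by (simp add: flat_def)
  then have "exp (- 4) * exp (- 4) \<le> bump x"
    unfolding bump_def using x by (intro mult_mono) (auto simp: abs_le_iff flat_def)
  then show ?thesis by (simp flip: exp_add)
qed

lemma integral_bump_pos:
  fixes f :: "real \<Rightarrow> real"
  assumes f: "integrable lborel f" and c: "c > 0" and nn: "\<And>x. f x \<ge> 0"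
    and low: "\<And>x. \<bar>x\<bar> \<le> 1 / 4 \<Longrightarrow> f x \<ge> (c :: real)"
  shows "(LINT x|lborel. f x) > 0"
proof -
  have "c / 2 = (LINT x|lborel. indicator {- 1 / 4..1 / 4 :: real} x * c)" by simp
  also have "\<dots> \<le> (LINT x|lborel. f x)"
  proof (rule integral_mono[OF _ f])
    show "integrable lborel (\<lambda>x. indicator {- 1 / 4..1 / 4 :: real} x * c)"
      by (intro integrable_mult_left integrable_real_indicator emeasure_bounded_finite) auto
    show "indicator {- 1 / 4..1 / 4} x * c \<le> f x" for x
      using low[of x] nn[of x] by (auto simp: indicator_def abs_le_iff)
  qed
  finally show ?thesis using c by simp
qed

lemma bump_sq_integrable: "integrable lborel (\<lambda>x. bump x * bump x)"
proof -
  have "integrable lborel (\<lambda>x. complex_of_real (bump x) * complex_of_real (bump x))"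
    by (rule integrable_test[OF bump_test test_continuous[OF bump_test]])
  then show ?thesis
    by (simp only: of_real_mult[symmetric] complex_of_real_integrable_eq)
qed

definition cutoff :: "real \<Rightarrow> complex" where
  "cutoff = autocorr (\<lambda>x. complex_of_real (bump x))"

definition cutoff0 :: real where
  "cutoff0 = (LINT x|lborel. bump x * bump x)"

lemma cutoff0_pos: "cutoff0 > 0"
  unfolding cutoff0_def
proof (rule integral_bump_pos[OF bump_sq_integrable])
  show "exp (- 8) * exp (- 8) \<le> bump x * bump x" if "\<bar>x\<bar> \<le> 1 / 4" for x
    using bump_lower[OF that] by (intro mult_mono bump_nonneg) auto
qed (auto simp: bump_nonneg)

lemma cutoff_0: "cutoff 0 = cutoff0"
  unfolding cutoff_def autocorr_def cutoff0_def
  by (simp del: of_real_mult add: of_real_mult[symmetric] integral_complex_of_real)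

lemma cutoff_test: "cutoff \<in> test_functions_within 1"
  using autocorr_test[OF bump_test] by (simp add: cutoff_def)

text \<open>On the support of \<open>bump\<close> the cosine is at least cos (1/2) > 0, so the real
  part of the transform cannot vanish.\<close>

lemma power_spectrum_bump_pos:
  assumes y: "\<bar>y\<bar> \<le> 1"
  shows "power_spectrum (\<lambda>x. complex_of_real (bump x)) y > 0"
proof -
  have int: "integrable lborel (\<lambda>x. complex_of_real (bump x) * osc (- y) x)"
    by (rule integrable_FT[OF rapid_test[OF bump_test]])
  have "Re (FT (\<lambda>x. complex_of_real (bump x)) (- y)) = (LINT x|lborel. Re (complex_of_real (bump x) * osc (- y) x))"
    unfolding FT_def by (rule integral_Re[OF int, symmetric])
  also have "\<dots> = (LINT x|lborel. bump x * cos (y * x))"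
    by (simp add: osc_def Re_exp)
  also have "\<dots> > 0"
  proof (rule integral_bump_pos[where c = "exp (- 8) * cos (1 / 2)"])
    have "integrable lborel (\<lambda>x. Re (complex_of_real (bump x) * osc (- y) x))" by (rule integrable_Re[OF int])
    then show "integrable lborel (\<lambda>x. bump x * cos (y * x))" by (simp add: osc_def Re_exp)
    have c: "cos (1 / 2 :: real) > 0" by (rule cos_gt_zero_pi) (use pi_gt3 in auto)
    then show "exp (- 8) * cos (1 / 2) > (0 :: real)" by simp
    have cos: "cos (y * x) \<ge> cos (1 / 2)" if "\<bar>x\<bar> \<le> 1 / 2" for x
    proof -
      have "\<bar>y * x\<bar> \<le> 1 * (1 / 2)" unfolding abs_mult using y that by (intro mult_mono) auto
      then have "cos \<bar>y * x\<bar> \<ge> cos (1 / 2)" using pi_gt3 by (intro cos_monotone_0_pi_le) auto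
      then show ?thesis by simp
    qed
    show "bump x * cos (y * x) \<ge> 0" for x
    proof (cases "\<bar>x\<bar> \<le> 1 / 2")
      case True
      then show ?thesis using cos[OF True] c by (intro mult_nonneg_nonneg bump_nonneg) linarith
    next
      case False
      then show ?thesis using test_functions_withinD(2)[OF bump_test, of x] by simp
    qed
    show "exp (- 8) * cos (1 / 2) \<le> bump x * cos (y * x)" if "\<bar>x\<bar> \<le> 1 / 4" for x
      using bump_lower[OF that] cos[of x] c that by (intro mult_mono bump_nonneg) auto
  qed
  finally have "FT (\<lambda>x. complex_of_real (bump x)) (- y) \<noteq> 0" by auto
  then show ?thesis by (simp add: power_spectrum_def)
qed

lemma power_spectrum_bump_lower:
  "\<exists>c>0. \<forall>y. \<bar>y\<bar> \<le> 1 \<longrightarrow> power_spectrum (\<lambda>x. complex_of_real (bump x)) y \<ge> c"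
proof -
  let ?P = "power_spectrum (\<lambda>x. complex_of_real (bump x))"
  have "\<exists>x\<in>{-1..1::real}. \<forall>y\<in>{-1..1}. ?P x \<le> ?P y"
    by (rule continuous_attains_inf)
       (auto intro!: continuous_at_imp_continuous_on isCont_power_spectrum[OF bump_test])
  then obtain x where x: "\<bar>x\<bar> \<le> 1" "\<And>y. \<bar>y\<bar> \<le> 1 \<Longrightarrow> ?P x \<le> ?P y"
    by (auto simp: abs_le_iff)
  then show ?thesis using power_spectrum_bump_pos[OF x(1)] by blast
qed

subsection \<open>Dilated cutoffs\<close>

text \<open>Normalized to the value 1 at the origin; \<open>Suc n\<close> keeps the dilation
  meaningful for \<open>n = 0\<close>.\<close>

definition cutoffs :: "nat \<Rightarrow> real \<Rightarrow> complex" where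
  "cutoffs n z = cutoff (z / real (Suc n)) / complex_of_real cutoff0"

lemma nth_vderiv_scale:
  assumes "smooth f"
  shows "nth_vderiv k (\<lambda>x. f (a * x)) = (\<lambda>x. complex_of_real a ^ k * nth_vderiv k f (a * x))"
  using assms
proof (induction k arbitrary: f)
  case (Suc k)
  let ?D = "\<lambda>x. vector_derivative f (at x)"
  have sm: "smooth (\<lambda>x. ?D (a * x))" using smooth_affine[OF smooth_vderiv[OF Suc.prems], of a 0] by simp
  have "((f \<circ> (\<lambda>x. a * x)) has_vector_derivative a *\<^sub>R ?D (a * x)) (at x)" for x
    by (rule vector_diff_chain_at)
       (auto intro!: derivative_eq_intros smooth_has_vderiv Suc.prems simp: has_real_derivative_iff_has_vector_derivative[symmetric])
  then have "nth_vderiv (Suc k) (\<lambda>x. f (a * x)) = nth_vderiv k (\<lambda>x. complex_of_real a * ?D (a * x))"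
    by (intro nth_vderiv_SucI) (simp add: o_def scaleR_conv_of_real)
  also have "\<dots> = (\<lambda>x. complex_of_real a ^ Suc k * nth_vderiv (Suc k) f (a * x))"
    unfolding nth_vderiv_cmult[OF sm] Suc.IH[OF smooth_vderiv[OF Suc.prems]]
    by (simp add: nth_vderiv_Suc mult_ac)
  finally show ?case .
qed simp

lemma cutoffs_eq: "cutoffs n = (\<lambda>z. inverse (complex_of_real cutoff0) * cutoff (inverse (real (Suc n)) * z))"
  by (simp add: cutoffs_def[abs_def] divide_inverse mult.commute)

lemma smooth_cutoffs: "smooth (cutoffs n)"
  unfolding cutoffs_eq
  using smooth_cmult[OF smooth_affine[OF test_functions_withinD(1)[OF cutoff_test], of "inverse (real (Suc n))" 0]]
  by simp

lemma cutoffs_test: "cutoffs n \<in> test_functions_within (real (Suc n))"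
  using smooth_cutoffs[of n] test_functions_withinD(2)[OF cutoff_test]
  by (auto simp: test_functions_within_def cutoffs_def pos_less_divide_eq)

lemma nth_vderiv_cutoffs:
  "nth_vderiv k (cutoffs n) z = inverse (complex_of_real cutoff0) *
     (complex_of_real (inverse (real (Suc n))) ^ k * nth_vderiv k cutoff (inverse (real (Suc n)) * z))"
proof -
  have sm: "smooth cutoff" by (rule test_functions_withinD(1)[OF cutoff_test])
  have "smooth (\<lambda>z. cutoff (inverse (real (Suc n)) * z))"
    using smooth_affine[OF sm, of "inverse (real (Suc n))" 0] by simp
  then show ?thesis unfolding cutoffs_eq by (simp only: nth_vderiv_cmult nth_vderiv_scale[OF sm])
qed

lemma cutoff_deriv_bound: "\<exists>M\<ge>0. \<forall>k\<le>N. \<forall>x. norm (nth_vderiv k cutoff x) \<le> M"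
proof -
  obtain M where M: "M \<ge> 0" "deriv_bound N 1 M cutoff"
    using ex_deriv_bound[OF test_functions_withinD(1)[OF cutoff_test]] by blast
  then show ?thesis using deriv_bound_global[OF cutoff_test] by blast
qed

lemma cutoffs_uniform_bound: "\<exists>M\<ge>0. \<forall>n. deriv_bound N R M (cutoffs n)"
proof -
  obtain M where M: "M \<ge> 0" "\<And>k x. k \<le> N \<Longrightarrow> norm (nth_vderiv k cutoff x) \<le> M"
    using cutoff_deriv_bound by blast
  have "norm (nth_vderiv k (cutoffs n) x) \<le> inverse cutoff0 * M" if "k \<le> N" for k n x
  proof -
    have "inverse (real (Suc n)) ^ k * norm (nth_vderiv k cutoff (inverse (real (Suc n)) * x)) \<le> 1 * M"
      using M that by (intro mult_mono power_le_one) (auto simp: inverse_le_1_iff)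
    then show ?thesis using cutoff0_pos unfolding nth_vderiv_cutoffs
      by (simp add: norm_mult norm_power norm_inverse mult_left_mono del: of_nat_Suc)
  qed
  then show ?thesis using M(1) cutoff0_pos
    by (intro exI[of _ "inverse cutoff0 * M"]) (auto simp: deriv_bound_def)
qed

text \<open>For order zero the Lipschitz bound of \<open>cutoff\<close> at 0 gives a factor 1 / (n +
  1) on bounded sets; every derivative of positive order carries at least one such factor by the
  chain rule.\<close>

lemma cutoffs_tendsto_1:
  assumes R: "R \<ge> 0"
  shows "\<exists>M\<ge>0. \<forall>n. deriv_bound N R (M / real (Suc n)) (\<lambda>x. cutoffs n x - 1)"
proof -
  obtain M where M: "M \<ge> 0" "\<And>k x. k \<le> Suc N \<Longrightarrow> norm (nth_vderiv k cutoff x) \<le> M"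
    using cutoff_deriv_bound by blast
  have sm: "smooth cutoff" by (rule test_functions_withinD(1)[OF cutoff_test])
  have lip: "norm (cutoff x - cutoff 0) \<le> M * \<bar>x\<bar>" for x
  proof -
    have "norm (cutoff x - cutoff 0) \<le> M * norm (x - 0)"
    proof (rule differentiable_bound[where S = UNIV])
      show "(cutoff has_derivative (\<lambda>h. h *\<^sub>R vector_derivative cutoff (at x))) (at x within UNIV)" for x
        using smooth_has_vderiv[OF sm] by (simp add: has_vector_derivative_def)
      show "onorm (\<lambda>h. h *\<^sub>R vector_derivative cutoff (at x)) \<le> M" for x
        using M(2)[of 1 x] by (intro onorm_bound M(1)) (auto simp: nth_vderiv_Suc mult.commute[of M] intro: mult_left_mono)
    qed auto
    then show ?thesis by simp
  qed
  \<comment> \<open>The factor 1 + R exceeds both \<bar>x\<bar>, as needed for order zero, and 1, as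
    needed for the other orders.\<close>
  have bound: "norm (nth_vderiv k (\<lambda>x. cutoffs n x - 1) x) \<le> inverse cutoff0 * (M * (1 + R)) / real (Suc n)"
    if k: "k \<le> N" and x: "\<bar>x\<bar> \<le> R" for k n x
  proof (cases k)
    case 0
    have "cutoffs n x - 1 = inverse (complex_of_real cutoff0) * (cutoff (inverse (real (Suc n)) * x) - cutoff 0)"
      unfolding cutoffs_eq cutoff_0 using cutoff0_pos by (simp add: field_simps)
    then have "norm (cutoffs n x - 1) = inverse cutoff0 * norm (cutoff (inverse (real (Suc n)) * x) - cutoff 0)"
      using cutoff0_pos by (simp add: norm_mult norm_inverse)
    also have "\<dots> \<le> inverse cutoff0 * (M * \<bar>inverse (real (Suc n)) * x\<bar>)"
      using cutoff0_pos by (intro mult_left_mono lip) auto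
    also have "\<dots> \<le> inverse cutoff0 * (M * (inverse (real (Suc n)) * (1 + R)))"
      unfolding abs_mult using cutoff0_pos M(1) x by (intro mult_left_mono mult_mono) auto
    finally show ?thesis using 0 by (simp add: divide_inverse mult_ac)
  next
    case (Suc j)
    have "nth_vderiv k (\<lambda>x. cutoffs n x - 1) x = nth_vderiv k (cutoffs n) x"
      unfolding nth_vderiv_diff[OF smooth_cutoffs smooth_const] Suc
      using nth_vderiv_vanish[of UNIV "\<lambda>x. 0" x j] by (simp add: nth_vderiv_Suc)
    also have "norm \<dots> = inverse cutoff0 * (inverse (real (Suc n)) * inverse (real (Suc n)) ^ j * norm (nth_vderiv k cutoff (inverse (real (Suc n)) * x)))"
      unfolding nth_vderiv_cutoffs using cutoff0_pos Suc by (simp add: norm_mult norm_power norm_inverse del: of_nat_Suc)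
    also have "\<dots> \<le> inverse cutoff0 * (inverse (real (Suc n)) * 1 * M)"
      using cutoff0_pos M k by (intro mult_left_mono mult_mono power_le_one mult_nonneg_nonneg) (auto simp: inverse_le_1_iff)
    also have "\<dots> \<le> inverse cutoff0 * (inverse (real (Suc n)) * 1 * (M * (1 + R)))"
      using cutoff0_pos M(1) R by (intro mult_left_mono) (auto simp: mult_le_cancel_left1)
    finally show ?thesis by (simp add: divide_inverse mult_ac)
  qed
  show ?thesis
    using M(1) R cutoff0_pos bound
    by (intro exI[of _ "inverse cutoff0 * (M * (1 + R))"]) (auto simp: deriv_bound_def)
qed

text \<open>Modulating a function by a frequency multiplies its autocorrelation by the same
  frequency, and dilation commutes with forming it up to a constant. Hence positivity may be applied
  to a truncated pure exponential.\<close>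

lemma cutoffs_osc_autocorr:
  "\<exists>g. g \<in> test_functions_within (real (Suc n)) \<and> autocorr g = (\<lambda>z. cutoffs n z * osc y z)"
proof -
  define s where "s = real (Suc n)"
  have s: "s > 0" by (simp add: s_def)
  \<comment> \<open>Dilation multiplies the integral by \<open>s\<close>, and \<open>cutoff0\<close>
    is the value of \<open>cutoff\<close> at 0; the square of \<alpha> cancels both.\<close>
  define \<alpha> where "\<alpha> = 1 / sqrt (s * cutoff0)"
  define g where "g x = complex_of_real \<alpha> * complex_of_real (bump (inverse s * x)) * osc y x" for x
  have "smooth g" unfolding g_def
    using smooth_affine[OF test_functions_withinD(1)[OF bump_test], of "inverse s" 0]
    by (intro smooth_mult smooth_const smooth_osc) simp
  moreover have "g x = 0" if "\<bar>x\<bar> > s" for x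
  proof -
    have "\<bar>inverse s * x\<bar> > 1" using that s by (simp add: abs_mult field_simps)
    then show ?thesis using test_functions_withinD(2)[OF bump_test, of "inverse s * x"] by (simp add: g_def)
  qed
  ultimately have "g \<in> test_functions_within s" by (simp add: test_functions_within_def)
  moreover have "autocorr g z = cutoffs n z * osc y z" for z
  proof -
    have a2: "\<alpha> * \<alpha> = 1 / (s * cutoff0)" using s cutoff0_pos by (simp add: \<alpha>_def)
    let ?b = "\<lambda>x. complex_of_real (bump x)"
    have inv: "inverse s * (s * x) = x" for x using s by (simp add: mult.assoc[symmetric])
    have "autocorr g z = (LINT x|lborel. complex_of_real (\<alpha> * \<alpha>) * osc y z * (cnj (?b (inverse s * x)) * ?b (inverse s * x + z / s)))"
      unfolding autocorr_def
    proof (rule Bochner_Integration.integral_cong[OF refl])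
      fix x
      have "cnj (osc y x) * osc y (x + z) = osc y z"
        unfolding osc_add_right mult.assoc[symmetric] cnj_osc by (simp add: osc_def flip: exp_add)
      then have "cnj (g x) * g (x + z) = complex_of_real (\<alpha> * \<alpha>) * osc y z * (cnj (?b (inverse s * x)) * ?b (inverse s * (x + z)))"
        by (simp add: g_def mult_ac)
      also have "inverse s * (x + z) = inverse s * x + z / s" by (simp add: distrib_left divide_inverse mult.commute)
      finally show "cnj (g x) * g (x + z) = complex_of_real (\<alpha> * \<alpha>) * osc y z * (cnj (?b (inverse s * x)) * ?b (inverse s * x + z / s))" .
    qed
    also have "\<dots> = complex_of_real (\<alpha> * \<alpha>) * osc y z * (LINT x|lborel. cnj (?b (inverse s * x)) * ?b (inverse s * x + z / s))"
      by (rule integral_mult_right_zero)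
    also have "(LINT x|lborel. cnj (?b (inverse s * x)) * ?b (inverse s * x + z / s)) = s *\<^sub>R cutoff (z / s)"
      using lborel_integral_real_affine[of s "\<lambda>x. cnj (?b (inverse s * x)) * ?b (inverse s * x + z / s)" 0] s
      by (simp add: cutoff_def autocorr_def inv)
    also have "complex_of_real (\<alpha> * \<alpha>) * osc y z * (s *\<^sub>R cutoff (z / s)) = cutoffs n z * osc y z"
      unfolding a2 cutoffs_def s_def[symmetric] using s by (simp add: scaleR_conv_of_real)
    finally show ?thesis .
  qed
  ultimately show ?thesis unfolding s_def by blast
qed

subsection \<open>Decay of the Gumbel kernel\<close>

lemma gumbel_pos: "gumbel v > 0"
  by (simp add: gumbel_def)

lemma gumbel_le_exp: "gumbel v \<le> exp (- \<bar>v\<bar>)"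
proof (cases "v \<ge> 0")
  case True
  \<comment> \<open>What is required is v - exp v \<le> - v.\<close>
  have "2 * v \<le> 1 + v + v\<^sup>2 / 2" using zero_le_power2[of "v - 1"] by (simp add: power2_diff)
  also have "\<dots> \<le> exp v" by (rule exp_lower_Taylor_quadratic[OF True])
  finally show ?thesis using True by (simp add: gumbel_def)
qed (simp add: gumbel_def)

lemma gumbel_decay: "\<exists>C>0. \<forall>v. gumbel v \<le> C / (1 + \<bar>v\<bar>) ^ N"
proof -
  define C where "C = (real N ^ N + 1) * exp 1"
  have "gumbel v \<le> C / (1 + \<bar>v\<bar>) ^ N" for v
  proof -
    have "gumbel v * (1 + \<bar>v\<bar>) ^ N \<le> exp (- \<bar>v\<bar>) * (real N ^ N * exp (1 + \<bar>v\<bar>))"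
      by (intro mult_mono gumbel_le_exp power_le_exp) auto
    also have "\<dots> = real N ^ N * exp 1" by (simp flip: exp_add)
    also have "\<dots> \<le> C" by (simp add: C_def)
    finally show ?thesis by (simp add: pos_le_divide_eq add_pos_nonneg)
  qed
  moreover have "C > 0" by (simp add: C_def add_nonneg_pos)
  ultimately show ?thesis by blast
qed

lemma rapid_shift:
  assumes b: "rapid b" shows "rapid (\<lambda>y. b (y - x))"
  unfolding rapid_def
proof (intro conjI allI)
  have [measurable]: "b \<in> borel_measurable borel" by (rule rapid_measurable[OF b])
  show "(\<lambda>y. b (y - x)) \<in> borel_measurable borel" by measurable
  fix k
  have "integrable lborel (\<lambda>v. \<bar>x + v\<bar> ^ k * norm (b v))"
  proof (rule Bochner_Integration.integrable_bound)
    show "integrable lborel (\<lambda>v. (1 + \<bar>x\<bar>) ^ k * ((1 + \<bar>v\<bar>) ^ k * norm (b v)))"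
      by (intro integrable_mult_right rapid_integrable_weight b)
    show "AE v in lborel. norm (\<bar>x + v\<bar> ^ k * norm (b v)) \<le> norm ((1 + \<bar>x\<bar>) ^ k * ((1 + \<bar>v\<bar>) ^ k * norm (b v)))"
    proof (rule AE_I2)
      fix v
      have "(1 + \<bar>x\<bar>) * (1 + \<bar>v\<bar>) = 1 + \<bar>x\<bar> + \<bar>v\<bar> + \<bar>x * v\<bar>" by (simp add: algebra_simps abs_mult)
      then have "\<bar>x + v\<bar> \<le> (1 + \<bar>x\<bar>) * (1 + \<bar>v\<bar>)"
        using abs_triangle_ineq[of x v] abs_ge_zero[of "x * v"] by linarith
      then have "\<bar>x + v\<bar> ^ k \<le> (1 + \<bar>x\<bar>) ^ k * (1 + \<bar>v\<bar>) ^ k"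
        unfolding power_mult_distrib[symmetric] by (intro power_mono) auto
      then have "\<bar>x + v\<bar> ^ k * norm (b v) \<le> (1 + \<bar>x\<bar>) ^ k * (1 + \<bar>v\<bar>) ^ k * norm (b v)"
        by (rule mult_right_mono) simp
      then show "norm (\<bar>x + v\<bar> ^ k * norm (b v)) \<le> norm ((1 + \<bar>x\<bar>) ^ k * ((1 + \<bar>v\<bar>) ^ k * norm (b v)))"
        by (simp add: mult.assoc)
    qed
  qed measurable
  from lborel_integrable_real_affine[OF this, of 1 "- x"]
  show "integrable lborel (\<lambda>y. \<bar>y\<bar> ^ k * norm (b (y - x)))" by simp
qed

lemma FT_shift: "FT (\<lambda>y. b (y - x)) z = osc x z * FT b z"
proof -
  have "FT (\<lambda>y. b (y - x)) z = (LINT v|lborel. b v * osc z (x + v))"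
    unfolding FT_def using lborel_integral_real_affine[of 1 "\<lambda>y. b (y - x) * osc z y" x] by simp
  also have "\<dots> = (LINT v|lborel. osc x z * (b v * osc z v))"
    by (simp add: osc_add_right osc_commute[of z x] mult_ac)
  finally show ?thesis by (simp add: FT_def)
qed

lemma rapid_gumbel: "rapid (\<lambda>y. complex_of_real (gumbel (x - y)))"
proof -
  have "rapid (\<lambda>y. complex_of_real (gumbel (- y)))"
  proof (rule rapid_decay)
    show "(\<lambda>y. complex_of_real (gumbel (- y))) \<in> borel_measurable borel"
      unfolding gumbel_def by measurable
    fix n
    obtain C where C: "C > 0" "\<And>v. gumbel v \<le> C / (1 + \<bar>v\<bar>) ^ n" using gumbel_decay by blast
    show "\<exists>C\<ge>0. \<forall>y. norm (complex_of_real (gumbel (- y))) \<le> C / (1 + \<bar>y\<bar>) ^ n"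
      using C(1) C(2)[of "- _"] gumbel_pos by (intro exI[of _ C]) (simp add: less_imp_le)
  qed
  from rapid_shift[OF this, of x] show ?thesis by simp
qed

lemma FT_gumbel: "FT (\<lambda>y. complex_of_real (gumbel (x - y))) z = osc x z * Gamma (1 - \<i> * complex_of_real z)"
proof -
  have "FT (\<lambda>y. complex_of_real (gumbel (x - y))) z = (LINT v|lborel. complex_of_real (gumbel v) * osc z (x - v))"
    unfolding FT_def
    using lborel_integral_real_affine[of "-1" "\<lambda>y. complex_of_real (gumbel (x - y)) * osc z y" x] by simp
  also have "\<dots> = (LINT v|lborel. osc x z * (complex_of_real (gumbel v) * osc (- v) z))"
  proof (rule Bochner_Integration.integral_cong[OF refl])
    fix v
    have "osc z (x - v) = osc x z * osc (- v) z"
      using osc_add_right[of z x "- v"] by (simp add: osc_commute)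
    then show "complex_of_real (gumbel v) * osc z (x - v) = osc x z * (complex_of_real (gumbel v) * osc (- v) z)"
      by (simp add: mult_ac)
  qed
  finally show ?thesis by (simp add: integral_gumbel_osc)
qed

subsection \<open>Positive distributions and their approximating densities\<close>

text \<open>Autocorrelations are the functions on which positive definiteness is tested, so this
  states it for the product of \<open>L\<close> with the multiplier \<open>rg\<close>.\<close>

locale positive_distribution = antilinear_distribution L for L +
  assumes positive: "\<And>g R. g \<in> test_functions_within R \<Longrightarrow> L (\<lambda>z. autocorr g z * rg z) \<in> \<real>\<^sub>\<ge>\<^sub>0"
begin

text \<open>By positivity these smooth functions are densities of positive measures whose Fourier
  transforms approximate \<open>L\<close> composed with multiplication by \<open>rg\<close>.\<close>

definition dens :: "nat \<Rightarrow> real \<Rightarrow> real" where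
  "dens n y = Re (L (\<lambda>z. cutoffs n z * rg z * osc y z))"

lemma cutoffs_rg_test: "(\<lambda>z. cutoffs n z * rg z) \<in> test_functions_within (real (Suc n))"
  by (rule test_functions_within_mult[OF cutoffs_test smooth_rg])

lemma L_cutoffs_rg_osc: "L (\<lambda>z. cutoffs n z * rg z * osc y z) = complex_of_real (dens n y)"
  and dens_nonneg: "dens n y \<ge> 0"
proof -
  obtain g where g: "g \<in> test_functions_within (real (Suc n))" "autocorr g = (\<lambda>z. cutoffs n z * osc y z)"
    using cutoffs_osc_autocorr[of n y] by blast
  have "L (\<lambda>z. autocorr g z * rg z) \<in> \<real>\<^sub>\<ge>\<^sub>0" by (rule positive[OF g(1)])
  moreover have "(\<lambda>z. autocorr g z * rg z) = (\<lambda>z. cutoffs n z * rg z * osc y z)"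
    by (simp add: g(2) mult_ac)
  ultimately have "L (\<lambda>z. cutoffs n z * rg z * osc y z) \<in> \<real>\<^sub>\<ge>\<^sub>0" by simp
  then show "L (\<lambda>z. cutoffs n z * rg z * osc y z) = complex_of_real (dens n y)" "dens n y \<ge> 0"
    unfolding dens_def by (auto simp: complex_nonneg_Reals_iff complex_eq_iff)
qed

lemma dens_isCont: "isCont (dens n) y"
  using continuous_L_osc[OF cutoffs_rg_test[of n], of y] unfolding dens_def[abs_def]
  by (rule isCont_Re)

lemma dens_measurable [measurable]: "dens n \<in> borel_measurable borel"
  by (intro borel_measurable_continuous_onI continuous_at_imp_continuous_on ballI dens_isCont)

lemma L_FT_dens:
  fixes a :: "real \<Rightarrow> real"
  assumes "rapid (\<lambda>y. complex_of_real (a y))" "\<And>y. isCont a y"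
  shows "integrable lborel (\<lambda>y. a y * dens n y)"
    and "L (\<lambda>z. cutoffs n z * rg z * FT (\<lambda>y. complex_of_real (a y)) z) = complex_of_real (LINT y|lborel. a y * dens n y)"
proof -
  have c: "isCont (\<lambda>y. complex_of_real (a y)) y" for y using assms(2) by (intro continuous_intros)
  note L = L_FT[OF cutoffs_rg_test[of n] assms(1) c]
  have eq: "(\<lambda>y. cnj (complex_of_real (a y)) * L (\<lambda>x. cutoffs n x * rg x * osc y x)) = (\<lambda>y. complex_of_real (a y * dens n y))"
    by (simp add: L_cutoffs_rg_osc)
  show "integrable lborel (\<lambda>y. a y * dens n y)"
    using L(1) unfolding eq complex_of_real_integrable_eq .
  show "L (\<lambda>z. cutoffs n z * rg z * FT (\<lambda>y. complex_of_real (a y)) z) = complex_of_real (LINT y|lborel. a y * dens n y)"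
    using L(2) unfolding eq integral_complex_of_real .
qed

abbreviation spectrum :: "real \<Rightarrow> real" where
  "spectrum \<equiv> power_spectrum (\<lambda>x. complex_of_real (bump x))"

text \<open>The transform of the translated spectrum is \<open>cutoff z * osc x z\<close>, so the
  average of the density near \<open>x\<close> is the value of \<open>L\<close> at
  \<open>cutoff * rg\<close> times \<open>cutoffs n * osc x\<close>. The fixed support of
  \<open>cutoff\<close> gives one order \<open>N\<close> for all \<open>n\<close>, and the
  derivatives of \<open>osc x\<close> account for the power of \<open>x\<close>.\<close>

lemma integrable_spectrum_dens: "integrable lborel (\<lambda>y. spectrum (y - x) * dens n y)"
  and spectrum_dens_bound: "\<exists>N. \<exists>C\<ge>0. \<forall>n x. (LINT y|lborel. spectrum (y - x) * dens n y) \<le> C * (1 + \<bar>x\<bar>) ^ N"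
proof -
  have r: "rapid (\<lambda>y. complex_of_real (spectrum (y - x)))" for x
    by (rule rapid_shift[OF rapid_power_spectrum[OF bump_test]])
  have c: "isCont (\<lambda>y. spectrum (y - x)) y" for x y
    using isCont_o2[OF _ isCont_power_spectrum[OF bump_test], of y "\<lambda>y. y - x"] by simp
  show "integrable lborel (\<lambda>y. spectrum (y - x) * dens n y)"
    by (rule L_FT_dens(1)[OF r c])
  have eq: "complex_of_real (LINT y|lborel. spectrum (y - x) * dens n y) =
      L (\<lambda>z. (cutoff z * rg z) * (cutoffs n z * osc x z))" for n x
    unfolding L_FT_dens(2)[OF r c, symmetric] FT_shift[of "\<lambda>y. complex_of_real (spectrum y)"]
      autocorr_eq_FT[OF bump_test, symmetric] cutoff_def[symmetric]
    by (simp add: mult_ac)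
  obtain C N where C: "C \<ge> 0" "\<And>g M. smooth g \<Longrightarrow> M \<ge> 0 \<Longrightarrow> deriv_bound N 1 M g \<Longrightarrow>
    norm (L (\<lambda>z. cutoff z * rg z * g z)) \<le> C * M"
    using bounded_mult[OF test_functions_within_mult[OF cutoff_test smooth_rg]] by auto
  obtain M where M: "M \<ge> 0" "\<And>n. deriv_bound N 1 M (cutoffs n)"
    using cutoffs_uniform_bound[of N 1] by blast
  have "(LINT y|lborel. spectrum (y - x) * dens n y) \<le> (C * (2 ^ N * M)) * (1 + \<bar>x\<bar>) ^ N" for n x
  proof -
    have "deriv_bound N 1 ((1 + \<bar>x\<bar>) ^ N) (osc x)" using deriv_bound_osc[of N 1 1 x] by simp
    then have "deriv_bound N 1 (2 ^ N * M * (1 + \<bar>x\<bar>) ^ N) (\<lambda>z. cutoffs n z * osc x z)"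
      using M by (intro deriv_bound_mult smooth_cutoffs smooth_osc) auto
    then have "norm (L (\<lambda>z. cutoff z * rg z * (cutoffs n z * osc x z))) \<le> C * (2 ^ N * M * (1 + \<bar>x\<bar>) ^ N)"
      using M(1) by (intro C(2) smooth_mult smooth_cutoffs smooth_osc) auto
    then have "norm (complex_of_real (LINT y|lborel. spectrum (y - x) * dens n y)) \<le> C * (2 ^ N * M * (1 + \<bar>x\<bar>) ^ N)"
      unfolding eq .
    then show ?thesis by (simp add: mult_ac)
  qed
  then show "\<exists>N. \<exists>C\<ge>0. \<forall>n x. (LINT y|lborel. spectrum (y - x) * dens n y) \<le> C * (1 + \<bar>x\<bar>) ^ N"
    using C(1) M(1) by (intro exI[of _ N] exI[of _ "C * (2 ^ N * M)"]) auto
qed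

text \<open>A slowly varying weight is dominated by its own average against the spectrum: the
  spectrum is bounded below on [-1, 1], and there the weight changes by at most the factor
  \<open>2 ^ K\<close>. Integrals in \<open>ennreal\<close> prepare for an exchange without
  integrability conditions.\<close>

lemma weight_le_spectrum_average:
  "\<exists>C\<ge>0. \<forall>v. ennreal (1 / (1 + \<bar>v\<bar>) ^ K) \<le> ennreal C * (\<integral>\<^sup>+s. ennreal (1 / (1 + \<bar>s\<bar>) ^ K * spectrum (v - s)) \<partial>lborel)"
proof -
  obtain c where c: "c > 0" "\<And>y. \<bar>y\<bar> \<le> 1 \<Longrightarrow> spectrum y \<ge> c"
    using power_spectrum_bump_lower by blast
  have "ennreal (1 / (1 + \<bar>v\<bar>) ^ K) \<le> ennreal (2 ^ K / c) * (\<integral>\<^sup>+s. ennreal (1 / (1 + \<bar>s\<bar>) ^ K * spectrum (v - s)) \<partial>lborel)" for v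
  proof -
    \<comment> \<open>A lower bound for the integrand on the whole interval {v - 1..v + 1}, which
      has length 2.\<close>
    define q where "q = 1 / (2 * (1 + \<bar>v\<bar>)) ^ K * c"
    have q: "q \<ge> 0" using c by (simp add: q_def)
    have "ennreal q * 2 = (\<integral>\<^sup>+s. ennreal q * indicator {v - 1..v + 1} s \<partial>lborel)"
      by (simp add: nn_integral_cmult)
    also have "\<dots> \<le> (\<integral>\<^sup>+s. ennreal (1 / (1 + \<bar>s\<bar>) ^ K * spectrum (v - s)) \<partial>lborel)"
    proof (intro nn_integral_mono)
      fix s :: real
      show "ennreal q * indicator {v - 1..v + 1} s \<le> ennreal (1 / (1 + \<bar>s\<bar>) ^ K * spectrum (v - s))"
      proof (cases "s \<in> {v - 1..v + 1}")
        case True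
        then have s: "\<bar>v - s\<bar> \<le> 1" by auto
        then have "1 + \<bar>s\<bar> \<le> 2 * (1 + \<bar>v\<bar>)"
          using abs_triangle_ineq4[of v "v - s"] by simp
        then have "1 / (2 * (1 + \<bar>v\<bar>)) ^ K \<le> 1 / (1 + \<bar>s\<bar>) ^ K"
          by (intro divide_left_mono power_mono mult_pos_pos zero_less_power) auto
        then have "q \<le> 1 / (1 + \<bar>s\<bar>) ^ K * spectrum (v - s)"
          unfolding q_def using c(1) c(2)[OF s] by (intro mult_mono) auto
        then show ?thesis using True by (simp add: ennreal_leI)
      qed simp
    qed
    finally have *: "ennreal q * 2 \<le> (\<integral>\<^sup>+s. ennreal (1 / (1 + \<bar>s\<bar>) ^ K * spectrum (v - s)) \<partial>lborel)" .
    have "1 / (1 + \<bar>v\<bar>) ^ K = 2 ^ K / c * q"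
      using c(1) unfolding q_def power_mult_distrib by simp
    also have "\<dots> \<le> 2 ^ K / c * (q * 2)" using q c(1) by (intro mult_left_mono) auto
    finally have "ennreal (1 / (1 + \<bar>v\<bar>) ^ K) \<le> ennreal (2 ^ K / c * (q * 2))" by (rule ennreal_leI)
    also have "\<dots> = ennreal (2 ^ K / c) * ennreal (q * 2)"
      using q c(1) by (intro ennreal_mult) auto
    also have "ennreal (q * 2) = ennreal q * 2"
      using q ennreal_mult[of q 2] by simp
    also have "ennreal (2 ^ K / c) * (ennreal q * 2) \<le> ennreal (2 ^ K / c) * (\<integral>\<^sup>+s. ennreal (1 / (1 + \<bar>s\<bar>) ^ K * spectrum (v - s)) \<partial>lborel)"
      by (intro mult_left_mono *) simp
    finally show ?thesis .
  qed
  then show ?thesis using c(1) by (intro exI[of _ "2 ^ K / c"]) auto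
qed

lemma spectrum_measurable [measurable]: "spectrum \<in> borel_measurable borel"
  by (intro borel_measurable_continuous_onI continuous_at_imp_continuous_on ballI isCont_power_spectrum[OF bump_test])

text \<open>Replace the weight by its spectral average and exchange the integrals; the inner one is
  then a local average of the density around x + s. Of the exponent N + 2, \<open>N\<close> powers
  compensate the growth in \<open>s\<close> and two make the integral converge.\<close>

lemma dens_weight_bound:
  "\<exists>N. \<exists>C\<ge>0. \<forall>n x. integrable lborel (\<lambda>y. dens n y / (1 + \<bar>x - y\<bar>) ^ (N + 2)) \<and>
     (LINT y|lborel. dens n y / (1 + \<bar>x - y\<bar>) ^ (N + 2)) \<le> C * (1 + \<bar>x\<bar>) ^ N"
proof -
  obtain N C where C: "C \<ge> 0" "\<And>n x. (LINT y|lborel. spectrum (y - x) * dens n y) \<le> C * (1 + \<bar>x\<bar>) ^ N"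
    using spectrum_dens_bound by blast
  define K where "K = N + 2"
  define w where "w s = 1 / (1 + \<bar>s\<bar>) ^ K" for s :: real
  have w_meas [measurable]: "w \<in> borel_measurable borel" unfolding w_def by measurable
  have w0: "w s \<ge> 0" for s by (simp add: w_def)
  obtain C1 where C1: "C1 \<ge> 0" "\<And>v. ennreal (w v) \<le> ennreal C1 * (\<integral>\<^sup>+s. ennreal (w s * spectrum (v - s)) \<partial>lborel)"
    using weight_le_spectrum_average[of K] unfolding w_def by blast
  define I where "I = (LINT s::real|lborel. 1 / (1 + s\<^sup>2))"
  have I0: "I \<ge> 0" by (simp add: I_def)
  have nnI: "(\<integral>\<^sup>+s. ennreal (1 / (1 + s\<^sup>2)) \<partial>lborel) = ennreal I"
    unfolding I_def by (rule nn_integral_eq_integral[OF integrable_inverse_1_plus_square_lborel]) auto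
  have nn: "(\<integral>\<^sup>+y. ennreal (dens n y * w (x - y)) \<partial>lborel) \<le> ennreal (C1 * (C * I) * (1 + \<bar>x\<bar>) ^ N)" for n x
  proof -
    have sp: "(\<integral>\<^sup>+y. ennreal (spectrum (y - x') * dens n y) \<partial>lborel) \<le> ennreal (C * (1 + \<bar>x'\<bar>) ^ N)" for x'
    proof -
      have "(\<integral>\<^sup>+y. ennreal (spectrum (y - x') * dens n y) \<partial>lborel) = ennreal (LINT y|lborel. spectrum (y - x') * dens n y)"
        by (rule nn_integral_eq_integral[OF integrable_spectrum_dens])
           (auto intro!: mult_nonneg_nonneg power_spectrum_nonneg dens_nonneg)
      then show ?thesis using C(2) by (simp add: ennreal_leI)
    qed
    have "(\<integral>\<^sup>+y. ennreal (dens n y * w (x - y)) \<partial>lborel) \<le>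
       (\<integral>\<^sup>+y. ennreal C1 * (\<integral>\<^sup>+s. ennreal (w s) * ennreal (spectrum (y - (x + s)) * dens n y) \<partial>lborel) \<partial>lborel)"
    proof (intro nn_integral_mono)
      fix y
      have "ennreal (dens n y * w (x - y)) = ennreal (dens n y) * ennreal (w (y - x))"
      proof -
        have "w (x - y) = w (y - x)" by (simp add: w_def abs_minus_commute)
        then show ?thesis by (simp add: ennreal_mult w0 dens_nonneg)
      qed
      also have "\<dots> \<le> ennreal (dens n y) * (ennreal C1 * (\<integral>\<^sup>+s. ennreal (w s * spectrum (y - x - s)) \<partial>lborel))"
        by (intro mult_left_mono C1) simp
      also have "\<dots> = ennreal C1 * (\<integral>\<^sup>+s. ennreal (dens n y) * ennreal (w s * spectrum (y - x - s)) \<partial>lborel)"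
        by (subst nn_integral_cmult) (auto simp: mult_ac)
      also have "(\<lambda>s. ennreal (dens n y) * ennreal (w s * spectrum (y - x - s))) =
          (\<lambda>s. ennreal (w s) * ennreal (spectrum (y - (x + s)) * dens n y))"
        using w0 dens_nonneg power_spectrum_nonneg by (simp add: ennreal_mult mult_ac diff_diff_eq)
      finally show "ennreal (dens n y * w (x - y)) \<le> ennreal C1 * (\<integral>\<^sup>+s. ennreal (w s) * ennreal (spectrum (y - (x + s)) * dens n y) \<partial>lborel)" .
    qed
    also have "\<dots> = ennreal C1 * (\<integral>\<^sup>+y. (\<integral>\<^sup>+s. ennreal (w s) * ennreal (spectrum (y - (x + s)) * dens n y) \<partial>lborel) \<partial>lborel)"
      by (rule nn_integral_cmult) measurable
    also have "(\<integral>\<^sup>+y. (\<integral>\<^sup>+s. ennreal (w s) * ennreal (spectrum (y - (x + s)) * dens n y) \<partial>lborel) \<partial>lborel) =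
       (\<integral>\<^sup>+s. (\<integral>\<^sup>+y. ennreal (w s) * ennreal (spectrum (y - (x + s)) * dens n y) \<partial>lborel) \<partial>lborel)"
      by (rule lborel_pair.Fubini') measurable
    also have "\<dots> = (\<integral>\<^sup>+s. ennreal (w s) * (\<integral>\<^sup>+y. ennreal (spectrum (y - (x + s)) * dens n y) \<partial>lborel) \<partial>lborel)"
      by (intro nn_integral_cong nn_integral_cmult) measurable
    also have "\<dots> \<le> (\<integral>\<^sup>+s. ennreal (C * (1 + \<bar>x\<bar>) ^ N) * ennreal (1 / (1 + s\<^sup>2)) \<partial>lborel)"
    proof (intro nn_integral_mono)
      fix s :: real
      have "(1 + \<bar>x\<bar>) * (1 + \<bar>s\<bar>) = 1 + \<bar>x\<bar> + \<bar>s\<bar> + \<bar>x * s\<bar>" by (simp add: algebra_simps abs_mult)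
      then have "1 + \<bar>x + s\<bar> \<le> (1 + \<bar>x\<bar>) * (1 + \<bar>s\<bar>)"
        using abs_triangle_ineq[of x s] abs_ge_zero[of "x * s"] by linarith
      then have "(1 + \<bar>x + s\<bar>) ^ N \<le> (1 + \<bar>x\<bar>) ^ N * (1 + \<bar>s\<bar>) ^ N"
        unfolding power_mult_distrib[symmetric] by (intro power_mono) auto
      then have "w s * (C * (1 + \<bar>x + s\<bar>) ^ N) \<le> w s * (C * ((1 + \<bar>x\<bar>) ^ N * (1 + \<bar>s\<bar>) ^ N))"
        by (intro mult_left_mono w0 C)
      also have "\<dots> = C * (1 + \<bar>x\<bar>) ^ N * (1 / (1 + \<bar>s\<bar>)\<^sup>2)"
        by (simp add: w_def K_def power_add power2_eq_square add_pos_nonneg[THEN less_imp_neq, THEN not_sym])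
      also have "\<dots> \<le> C * (1 + \<bar>x\<bar>) ^ N * (1 / (1 + s\<^sup>2))"
      proof (intro mult_left_mono divide_left_mono mult_pos_pos)
        show "1 + s\<^sup>2 \<le> (1 + \<bar>s\<bar>)\<^sup>2" by (simp add: power2_sum)
      qed (use C in \<open>auto simp: add_pos_nonneg\<close>)
      finally have le: "w s * (C * (1 + \<bar>x + s\<bar>) ^ N) \<le> C * (1 + \<bar>x\<bar>) ^ N * (1 / (1 + s\<^sup>2))" .
      have "ennreal (w s) * (\<integral>\<^sup>+y. ennreal (spectrum (y - (x + s)) * dens n y) \<partial>lborel) \<le> ennreal (w s) * ennreal (C * (1 + \<bar>x + s\<bar>) ^ N)"
        by (intro mult_left_mono sp) simp
      also have "\<dots> = ennreal (w s * (C * (1 + \<bar>x + s\<bar>) ^ N))"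
        using C(1) by (simp add: ennreal_mult w0)
      also have "\<dots> \<le> ennreal (C * (1 + \<bar>x\<bar>) ^ N * (1 / (1 + s\<^sup>2)))" by (rule ennreal_leI[OF le])
      also have "\<dots> = ennreal (C * (1 + \<bar>x\<bar>) ^ N) * ennreal (1 / (1 + s\<^sup>2))"
        using C(1) by (intro ennreal_mult) auto
      finally show "ennreal (w s) * (\<integral>\<^sup>+y. ennreal (spectrum (y - (x + s)) * dens n y) \<partial>lborel) \<le>
          ennreal (C * (1 + \<bar>x\<bar>) ^ N) * ennreal (1 / (1 + s\<^sup>2))" .
    qed
    also have "\<dots> = ennreal (C * (1 + \<bar>x\<bar>) ^ N) * ennreal I"
      unfolding nnI[symmetric] by (rule nn_integral_cmult) measurable
    finally have "(\<integral>\<^sup>+y. ennreal (dens n y * w (x - y)) \<partial>lborel) \<le> ennreal C1 * (ennreal (C * (1 + \<bar>x\<bar>) ^ N) * ennreal I)"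
      by (simp add: mult_left_mono)
    also have "\<dots> = ennreal (C1 * (C * I) * (1 + \<bar>x\<bar>) ^ N)"
      using C(1) C1(1) I0 by (simp add: ennreal_mult[symmetric] mult_ac)
    finally show ?thesis .
  qed
  have "integrable lborel (\<lambda>y. dens n y * w (x - y)) \<and>
     (LINT y|lborel. dens n y * w (x - y)) \<le> C1 * (C * I) * (1 + \<bar>x\<bar>) ^ N" for n x
  proof
    have nonneg: "dens n y * w (x - y) \<ge> 0" for y by (intro mult_nonneg_nonneg dens_nonneg w0)
    show int: "integrable lborel (\<lambda>y. dens n y * w (x - y))"
      using nn[of n x] nonneg by (intro integrableI_nonneg) (auto simp: top.not_eq_extremum intro: le_less_trans)
    have "ennreal (LINT y|lborel. dens n y * w (x - y)) = (\<integral>\<^sup>+y. ennreal (dens n y * w (x - y)) \<partial>lborel)"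
      by (rule nn_integral_eq_integral[OF int, symmetric]) (use nonneg in auto)
    then have "ennreal (LINT y|lborel. dens n y * w (x - y)) \<le> ennreal (C1 * (C * I) * (1 + \<bar>x\<bar>) ^ N)"
      using nn[of n x] by simp
    then show "(LINT y|lborel. dens n y * w (x - y)) \<le> C1 * (C * I) * (1 + \<bar>x\<bar>) ^ N"
      using C(1) C1(1) I0 by (subst (asm) ennreal_le_iff) auto
  qed
  then show ?thesis using C(1) C1(1) I0
    by (intro exI[of _ N] exI[of _ "C1 * (C * I)"]) (auto simp: w_def K_def divide_inverse)
qed

lemma isCont_gumbel: "isCont (\<lambda>y. gumbel (x - y)) y"
  unfolding gumbel_def by (intro continuous_intros)

lemma gumbel_measurable [measurable]: "gumbel \<in> borel_measurable borel"
  unfolding gumbel_def[abs_def] by measurable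

definition mollified :: "nat \<Rightarrow> real \<Rightarrow> real" where
  "mollified n x = (LINT y|lborel. gumbel (x - y) * dens n y)"

lemma integrable_gumbel_dens: "integrable lborel (\<lambda>y. gumbel (x - y) * dens n y)"
  by (rule L_FT_dens(1)[OF rapid_gumbel isCont_gumbel])

text \<open>The transform of the Gumbel kernel is a Gamma factor that cancels \<open>rg\<close>.
  Smearing the density thus recovers \<open>L\<close> itself, up to the cutoff, at the frequency
  \<open>x\<close>.\<close>

lemma mollified_eq: "complex_of_real (mollified n x) = L (\<lambda>z. cutoffs n z * osc x z)"
proof -
  have "complex_of_real (mollified n x) = L (\<lambda>z. cutoffs n z * rg z * FT (\<lambda>y. complex_of_real (gumbel (x - y))) z)"
    unfolding mollified_def by (rule L_FT_dens(2)[OF rapid_gumbel isCont_gumbel, symmetric])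
  also have "(\<lambda>z. cutoffs n z * rg z * FT (\<lambda>y. complex_of_real (gumbel (x - y))) z) =
     (\<lambda>z. cutoffs n z * osc x z * (rg z * Gamma (1 - \<i> * complex_of_real z)))"
    unfolding FT_gumbel by (simp add: mult_ac)
  finally show ?thesis by (simp add: rg_Gamma)
qed

text \<open>The kernel is taken with decay N + 3, one power more than
  \<open>dens_weight_bound\<close> requires. Outside {-n..n} one has 1 + \<bar>x - y\<bar> \<ge> 1 +
  n - \<bar>x\<bar>, so the spare power makes the truncation error tend to zero.\<close>

lemma mollified_bound:
  "\<exists>N. \<exists>C>0. (\<forall>n x. mollified n x \<le> C * (1 + \<bar>x\<bar>) ^ N) \<and>
     (\<forall>n x. \<bar>x\<bar> \<le> real n \<longrightarrow> \<bar>mollified n x - (LINT y|lborel. indicator {- real n..real n} y * (gumbel (x - y) * dens n y))\<bar>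
         \<le> C * (1 + \<bar>x\<bar>) ^ N / (1 + real n - \<bar>x\<bar>))"
proof -
  obtain N C where C: "C \<ge> 0" "\<And>n x. integrable lborel (\<lambda>y. dens n y / (1 + \<bar>x - y\<bar>) ^ (N + 2))"
    "\<And>n x. (LINT y|lborel. dens n y / (1 + \<bar>x - y\<bar>) ^ (N + 2)) \<le> C * (1 + \<bar>x\<bar>) ^ N"
    using dens_weight_bound by blast
  obtain D where D: "D > 0" "\<And>v. gumbel v \<le> D / (1 + \<bar>v\<bar>) ^ (N + 3)" using gumbel_decay by blast
  have gw: "gumbel v \<le> D / (1 + \<bar>v\<bar>) ^ (N + 2) / (1 + \<bar>v\<bar>)" for v
    using D(2)[of v] by (simp add: numeral_3_eq_3 numeral_2_eq_2 mult_ac)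
  have gw': "gumbel (x - y) * dens n y \<le> (D / r) * (dens n y / (1 + \<bar>x - y\<bar>) ^ (N + 2))"
    if "1 \<le> r" "r \<le> 1 + \<bar>x - y\<bar>" for r x y n
  proof -
    have "gumbel (x - y) \<le> D / (1 + \<bar>x - y\<bar>) ^ (N + 2) / r"
      using that D(1) by (intro order_trans[OF gw] divide_left_mono mult_pos_pos) (auto simp: add_pos_nonneg)
    from mult_right_mono[OF this dens_nonneg[of n y]]
    show ?thesis by (simp add: divide_inverse mult_ac)
  qed
  have nn: "gumbel (x - y) * dens n y \<ge> 0" for x y n
    by (intro mult_nonneg_nonneg dens_nonneg less_imp_le gumbel_pos)
  have 1: "mollified n x \<le> D * C * (1 + \<bar>x\<bar>) ^ N" for n x
  proof -
    have "mollified n x \<le> (LINT y|lborel. D / 1 * (dens n y / (1 + \<bar>x - y\<bar>) ^ (N + 2)))"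
      unfolding mollified_def
      by (rule integral_mono[OF integrable_gumbel_dens integrable_mult_right[OF C(2)] gw']) auto
    also have "\<dots> = D * (LINT y|lborel. dens n y / (1 + \<bar>x - y\<bar>) ^ (N + 2))"
      unfolding integral_mult_right_zero by simp
    also have "\<dots> \<le> D * (C * (1 + \<bar>x\<bar>) ^ N)" using D(1) by (intro mult_left_mono C) auto
    finally show ?thesis by (simp add: mult.assoc)
  qed
  have 2: "\<bar>mollified n x - (LINT y|lborel. indicator {- real n..real n} y * (gumbel (x - y) * dens n y))\<bar>
      \<le> D * C * (1 + \<bar>x\<bar>) ^ N / (1 + real n - \<bar>x\<bar>)" if x: "\<bar>x\<bar> \<le> real n" for n x
  proof -
    let ?g = "\<lambda>y. gumbel (x - y) * dens n y"
    let ?r = "1 + real n - \<bar>x\<bar>"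
    have i1: "integrable lborel (\<lambda>y. indicator {- real n..real n} y * ?g y)"
      using integrable_mult_indicator[OF _ integrable_gumbel_dens[of x n], of "{- real n..real n}"] by simp
    have eq: "mollified n x - (LINT y|lborel. indicator {- real n..real n} y * ?g y)
        = (LINT y|lborel. ?g y - indicator {- real n..real n} y * ?g y)"
      unfolding mollified_def using i1 integrable_gumbel_dens by simp
    have "norm (LINT y|lborel. ?g y - indicator {- real n..real n} y * ?g y) \<le> (LINT y|lborel. D / ?r * (dens n y / (1 + \<bar>x - y\<bar>) ^ (N + 2)))"
    proof (rule Bochner_Integration.integral_norm_bound_integral)
      show "integrable lborel (\<lambda>y. ?g y - indicator {- real n..real n} y * ?g y)"
        using i1 integrable_gumbel_dens by simp
      show "integrable lborel (\<lambda>y. D / ?r * (dens n y / (1 + \<bar>x - y\<bar>) ^ (N + 2)))"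
        by (intro integrable_mult_right C)
      fix y
      show "norm (?g y - indicator {- real n..real n} y * ?g y) \<le> D / ?r * (dens n y / (1 + \<bar>x - y\<bar>) ^ (N + 2))"
      proof (cases "y \<in> {- real n..real n}")
        case True
        then show ?thesis using D(1) dens_nonneg x by simp
      next
        case False
        then have "?r \<le> 1 + \<bar>x - y\<bar>" by auto
        then show ?thesis using gw'[of ?r x y n] x False nn[of x y n] by simp
      qed
    qed
    also have "\<dots> = D / ?r * (LINT y|lborel. dens n y / (1 + \<bar>x - y\<bar>) ^ (N + 2))"
      by (simp only: integral_mult_right_zero)
    also have "\<dots> \<le> D / ?r * (C * (1 + \<bar>x\<bar>) ^ N)" using D(1) x by (intro mult_left_mono C) auto
    also have "\<dots> = D * C * (1 + \<bar>x\<bar>) ^ N / ?r" by simp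
    finally show ?thesis unfolding eq real_norm_def .
  qed
  define Q where "Q = D * C + 1"
  have Q: "Q > 0" "D * C \<le> Q" using add_nonneg_pos[OF mult_nonneg_nonneg[of D C], of 1] D(1) C(1) by (simp_all add: Q_def)
  have "mollified n x \<le> Q * (1 + \<bar>x\<bar>) ^ N" for n x
    using Q by (intro order_trans[OF 1] mult_right_mono) auto
  moreover have "\<bar>mollified n x - (LINT y|lborel. indicator {- real n..real n} y * (gumbel (x - y) * dens n y))\<bar>
      \<le> Q * (1 + \<bar>x\<bar>) ^ N / (1 + real n - \<bar>x\<bar>)" if x: "\<bar>x\<bar> \<le> real n" for n x
    using Q x by (intro order_trans[OF 2[OF x]] divide_right_mono mult_right_mono) auto
  ultimately show ?thesis using Q(1) by blast
qed

lemma mollified_nonneg: "mollified n x \<ge> 0"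
  unfolding mollified_def
  by (intro integral_nonneg_AE AE_I2 mult_nonneg_nonneg dens_nonneg less_imp_le gumbel_pos)

end

subsection \<open>Holomorphic approximants\<close>

context positive_distribution
begin

text \<open>The index \<open>j\<close> counts derivatives in \<open>z\<close>, each of which brings
  down a factor - exp (- y). Integrating over a compact interval makes every approximant
  entire.\<close>

definition approx :: "nat \<Rightarrow> nat \<Rightarrow> complex \<Rightarrow> complex" where
  "approx j n z = complex_of_real (1 / sqrt (2 * pi)) * integral (cbox (- real n) (real n))
     (\<lambda>y. (- complex_of_real (exp (- y))) ^ j * (exp (- z * complex_of_real (exp (- y))) *
        complex_of_real (exp (- y) * dens n y)))"

lemma continuous_dens: "continuous_on A (dens n)"
  by (intro continuous_at_imp_continuous_on ballI dens_isCont)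

lemma approx_has_field_derivative: "(approx j n has_field_derivative approx (Suc j) n z) (at z)"
proof -
  let ?f = "\<lambda>j z y. (- complex_of_real (exp (- y))) ^ j * (exp (- z * complex_of_real (exp (- y))) *
        complex_of_real (exp (- y) * dens n y))"
  have "((\<lambda>z. integral (cbox (- real n) (real n)) (?f j z)) has_field_derivative
     integral (cbox (- real n) (real n)) (?f (Suc j) z)) (at z within UNIV)"
  proof (rule leibniz_rule_field_derivative)
    show "((\<lambda>z. ?f j z y) has_field_derivative ?f (Suc j) z y) (at z within UNIV)" for z y
      by (auto intro!: derivative_eq_intros)
    show "?f j z integrable_on cbox (- real n) (real n)" for z
      by (intro integrable_continuous continuous_intros continuous_dens)
    have "continuous_on (UNIV \<times> cbox (- real n) (real n)) (\<lambda>p. ?f (Suc j) (fst p) (snd p))"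
      by (intro continuous_intros continuous_on_compose2[OF continuous_dens[of UNIV]]) auto
    then show "continuous_on (UNIV \<times> cbox (- real n) (real n)) (\<lambda>(z, y). ?f (Suc j) z y)"
      by (simp add: case_prod_unfold)
  qed auto
  then show ?thesis unfolding approx_def[abs_def] by (rule DERIV_cmult)
qed

lemma approx_holomorphic: "approx j n holomorphic_on A"
  using approx_has_field_derivative[of j n] by (auto simp: holomorphic_on_def field_differentiable_def intro: has_field_derivative_at_within)

lemma higher_deriv_approx: "(deriv ^^ j) (approx 0 n) = approx j n"
proof (induction j)
  case (Suc j)
  have "(deriv ^^ Suc j) (approx 0 n) = deriv (approx j n)" by (simp add: Suc.IH)
  also have "\<dots> = approx (Suc j) n" by (intro ext DERIV_imp_deriv approx_has_field_derivative)
  finally show ?case .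
qed simp

definition real_approx :: "nat \<Rightarrow> nat \<Rightarrow> real \<Rightarrow> real" where
  "real_approx j n t = 1 / sqrt (2 * pi) * integral (cbox (- real n) (real n))
     (\<lambda>y. exp (- y) ^ j * (exp (- t * exp (- y)) * (exp (- y) * dens n y)))"

lemma real_approx_nonneg: "real_approx j n t \<ge> 0"
  unfolding real_approx_def
  by (intro mult_nonneg_nonneg integral_nonneg integrable_continuous continuous_intros continuous_dens)
     (auto intro!: mult_nonneg_nonneg dens_nonneg)

lemma approx_of_real: "approx j n (complex_of_real t) = complex_of_real ((- 1) ^ j * real_approx j n t)"
proof -
  let ?g = "\<lambda>y. exp (- y) ^ j * (exp (- t * exp (- y)) * (exp (- y) * dens n y))"
  have int: "?g integrable_on cbox (- real n) (real n)"
    by (intro integrable_continuous continuous_intros continuous_dens)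
  have int2: "(\<lambda>y. (- 1) ^ j * ?g y) integrable_on cbox (- real n) (real n)"
    by (rule integrable_on_mult_right[OF int])
  have "(\<lambda>y. (- complex_of_real (exp (- y))) ^ j * (exp (- complex_of_real t * complex_of_real (exp (- y))) *
        complex_of_real (exp (- y) * dens n y))) = (\<lambda>y. complex_of_real ((- 1) ^ j * ?g y))"
    by (simp add: exp_of_real[symmetric] power_minus[of "exp (- complex_of_real _)"] fun_eq_iff)
  moreover have "integral (cbox (- real n) (real n)) (\<lambda>y. complex_of_real ((- 1) ^ j * ?g y)) =
      complex_of_real (integral (cbox (- real n) (real n)) (\<lambda>y. (- 1) ^ j * ?g y))"
    using integral_linear[OF int2 bounded_linear_of_real[where 'a = complex]] by (simp only: o_def)
  ultimately show ?thesis
    unfolding approx_def real_approx_def integral_mult_right by (simp only: of_real_mult mult_ac)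
qed

text \<open>As the density is nonnegative, the modulus of the Laplace integral at \<open>z\<close>
  is at most its value at \<open>Re z\<close>, which decreases in \<open>Re z\<close>.\<close>

lemma norm_approx_le:
  assumes "a \<le> Re z" shows "norm (approx 0 n z) \<le> real_approx 0 n a"
proof -
  have "norm (integral (cbox (- real n) (real n)) (\<lambda>y. exp (- z * complex_of_real (exp (- y))) *
        complex_of_real (exp (- y) * dens n y))) \<le>
     integral (cbox (- real n) (real n)) (\<lambda>y. exp (- a * exp (- y)) * (exp (- y) * dens n y))"
  proof (rule integral_norm_bound_integral)
    fix y
    have "exp (- Re z * exp (- y)) * (exp (- y) * dens n y) \<le> exp (- a * exp (- y)) * (exp (- y) * dens n y)"
      using assms dens_nonneg by (intro mult_right_mono mult_nonneg_nonneg) auto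
    moreover have "norm (exp (- z * complex_of_real (exp (- y))) * complex_of_real (exp (- y) * dens n y)) =
        exp (- Re z * exp (- y)) * (exp (- y) * dens n y)"
      using dens_nonneg[of n y] by (simp add: norm_mult)
    ultimately show "norm (exp (- z * complex_of_real (exp (- y))) * complex_of_real (exp (- y) * dens n y)) \<le>
        exp (- a * exp (- y)) * (exp (- y) * dens n y)" by simp
  qed (intro integrable_continuous continuous_intros continuous_dens)+
  then show ?thesis unfolding approx_def real_approx_def
    by (simp add: norm_mult norm_divide divide_right_mono)
qed

text \<open>With t = exp (ln t) the Laplace kernel exp (- y) * exp (- t * exp (- y)) is the Gumbel
  kernel at ln t - y divided by \<open>t\<close>.\<close>

lemma real_approx_eq:
  assumes t: "t > 0"
  shows "real_approx 0 n t = 1 / sqrt (2 * pi) / t *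
     (LINT y|lborel. indicator {- real n..real n} y * (gumbel (ln t - y) * dens n y))"
proof -
  have g: "exp (- t * exp (- y)) * (exp (- y) * dens n y) = 1 / t * (gumbel (ln t - y) * dens n y)" for y
    using t by (simp add: gumbel_def exp_diff exp_minus divide_inverse mult_ac)
  have "set_integrable lborel {- real n..real n} (\<lambda>y. 1 / t * (gumbel (ln t - y) * dens n y))"
    unfolding set_integrable_def
    by (intro borel_integrable_compact continuous_intros continuous_dens)
       (auto simp: gumbel_def intro!: continuous_intros)
  from set_borel_integral_eq_integral(2)[OF this, symmetric]
  have "integral {- real n..real n} (\<lambda>y. 1 / t * (gumbel (ln t - y) * dens n y)) =
     (LINT y|lborel. indicator {- real n..real n} y *\<^sub>R (1 / t * (gumbel (ln t - y) * dens n y)))"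
    unfolding set_lebesgue_integral_def .
  also have "(\<lambda>y. indicator {- real n..real n} y *\<^sub>R (1 / t * (gumbel (ln t - y) * dens n y))) =
     (\<lambda>y. 1 / t * (indicator {- real n..real n} y * (gumbel (ln t - y) * dens n y)))"
    by (simp add: fun_eq_iff)
  also have "(LINT y|lborel. 1 / t * (indicator {- real n..real n} y * (gumbel (ln t - y) * dens n y))) =
     1 / t * (LINT y|lborel. indicator {- real n..real n} y * (gumbel (ln t - y) * dens n y))"
    by (simp only: integral_mult_right_zero)
  finally show ?thesis unfolding real_approx_def power_0 mult_1 g cbox_interval by simp
qed

lemma real_approx_le:
  assumes t: "t > 0" shows "real_approx 0 n t \<le> mollified n (ln t) / t"
proof -
  have s: "1 / sqrt (2 * pi) \<le> 1" using pi_gt3 by simp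
  have nn: "gumbel (ln t - y) * dens n y \<ge> 0" for y
    by (intro mult_nonneg_nonneg dens_nonneg less_imp_le gumbel_pos)
  have i1: "integrable lborel (\<lambda>y. indicator {- real n..real n} y * (gumbel (ln t - y) * dens n y))"
    using integrable_mult_indicator[OF _ integrable_gumbel_dens[of "ln t" n], of "{- real n..real n}"] by simp
  have "(LINT y|lborel. indicator {- real n..real n} y * (gumbel (ln t - y) * dens n y)) \<le> mollified n (ln t)"
    unfolding mollified_def
    by (rule integral_mono[OF i1 integrable_gumbel_dens]) (use nn in \<open>auto simp: indicator_def\<close>)
  then have "real_approx 0 n t \<le> 1 / sqrt (2 * pi) / t * mollified n (ln t)"
    unfolding real_approx_eq[OF t] using t by (intro mult_left_mono) auto
  also have "\<dots> = 1 / sqrt (2 * pi) * (mollified n (ln t) / t)" by simp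
  also have "\<dots> \<le> 1 * (mollified n (ln t) / t)"
    using t mollified_nonneg by (intro mult_right_mono s) auto
  finally show ?thesis by simp
qed

text \<open>The two quantities differ only by the part of the integral outside {-n..n}, which for
  fixed \<open>t\<close> is of order 1 / n.\<close>

lemma real_approx_tendsto_diff:
  assumes t: "t > 0"
  shows "(\<lambda>n. real_approx 0 n t - 1 / sqrt (2 * pi) / t * mollified n (ln t)) \<longlonglongrightarrow> 0"
proof -
  obtain N C where C: "\<And>n x. \<bar>x\<bar> \<le> real n \<Longrightarrow> \<bar>mollified n x - (LINT y|lborel. indicator {- real n..real n} y * (gumbel (x - y) * dens n y))\<bar>
         \<le> C * (1 + \<bar>x\<bar>) ^ N / (1 + real n - \<bar>x\<bar>)" using mollified_bound by blast
  define c where "c = 1 / sqrt (2 * pi) / t"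
  have c: "c > 0" using t by (simp add: c_def)
  define K where "K = c * (C * (1 + \<bar>ln t\<bar>) ^ N)"
  have "(\<lambda>n. K / (1 + real n - \<bar>ln t\<bar>)) \<longlonglongrightarrow> 0" by real_asymp
  then show ?thesis
  proof (rule Lim_null_comparison[rotated])
    show "\<forall>\<^sub>F n in sequentially. norm (real_approx 0 n t - 1 / sqrt (2 * pi) / t * mollified n (ln t)) \<le> K / (1 + real n - \<bar>ln t\<bar>)"
      using eventually_ge_at_top[of "nat \<lceil>\<bar>ln t\<bar>\<rceil>"]
    proof eventually_elim
      case (elim n)
      then have n: "\<bar>ln t\<bar> \<le> real n" by linarith
      let ?I = "LINT y|lborel. indicator {- real n..real n} y * (gumbel (ln t - y) * dens n y)"
      have "real_approx 0 n t - 1 / sqrt (2 * pi) / t * mollified n (ln t) = - (c * (mollified n (ln t) - ?I))"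
        unfolding real_approx_eq[OF t] c_def by (simp only: right_diff_distrib)
      then have "norm (real_approx 0 n t - 1 / sqrt (2 * pi) / t * mollified n (ln t)) = c * \<bar>mollified n (ln t) - ?I\<bar>"
        using c by (simp add: abs_mult)
      also have "\<dots> \<le> c * (C * (1 + \<bar>ln t\<bar>) ^ N / (1 + real n - \<bar>ln t\<bar>))"
        using c by (intro mult_left_mono C n) auto
      finally show ?case by (simp add: K_def)
    qed
  qed
qed

subsection \<open>The limit function\<close>

text \<open>Fourier inversion writes \<open>u\<close> as \<open>FT\<close> of its normalized
  transform; \<open>L_FT\<close> then reduces \<open>L\<close> to its values on truncated
  exponentials, which are the mollified densities.\<close>

lemma fourier_L_cutoffs:
  assumes u: "u \<in> test_functions_within R"
  shows "L (\<lambda>z. cutoffs n z * u z) =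
     (LINT x|lborel. cnj (fourier u x) * complex_of_real (1 / sqrt (2 * pi) * mollified n x))"
proof -
  let ?c = "complex_of_real (1 / sqrt (2 * pi))"
  let ?a = "\<lambda>x. ?c * fourier u x"
  have Z: "fourier u \<in> Z_space" by (rule fourier_Z_space[OF u])
  have r: "rapid ?a"
    by (rule rapid_bound[OF rapid_Z_space[OF Z], of _ "norm ?c"])
       (use rapid_measurable[OF rapid_Z_space[OF Z]] in \<open>auto simp: norm_mult norm_divide\<close>)
  have c: "isCont ?a x" for x
    using Z_space_continuous[OF Z, of UNIV] by (intro continuous_intros) (simp add: continuous_on_eq_continuous_at)
  have "FT ?a = u"
  proof
    fix x
    have "FT ?a x = inverse_fourier (fourier u) x" unfolding inverse_fourier_eq_FT by (rule FT_cmult)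
    then show "FT ?a x = u x" by (simp only: inverse_fourier_fourier[OF u])
  qed
  then have "L (\<lambda>z. cutoffs n z * u z) = (LINT x|lborel. cnj (?a x) * complex_of_real (mollified n x))"
    using L_FT(2)[OF cutoffs_test[of n] r c] by (simp only: mollified_eq)
  then show ?thesis
    by (simp only: complex_cnj_mult complex_cnj_complex_of_real of_real_mult mult_ac)
qed

lemma L_cutoffs_tendsto:
  assumes u: "u \<in> test_functions_within R"
  shows "(\<lambda>n. L (\<lambda>z. cutoffs n z * u z)) \<longlonglongrightarrow> L u"
proof -
  obtain C N where C: "C \<ge> 0" "\<And>g M. smooth g \<Longrightarrow> M \<ge> 0 \<Longrightarrow> deriv_bound N R M g \<Longrightarrow>
    norm (L (\<lambda>z. u z * g z)) \<le> C * M" using bounded_mult[OF u] by auto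
  obtain M where M: "M \<ge> 0" "\<And>n. deriv_bound N \<bar>R\<bar> (M / real (Suc n)) (\<lambda>x. cutoffs n x - 1)"
    using cutoffs_tendsto_1[of "\<bar>R\<bar>" N] by auto
  have lim: "(\<lambda>n. C * (M / real (Suc n))) \<longlonglongrightarrow> 0" by real_asymp
  have "norm (L (\<lambda>z. cutoffs n z * u z) - L u) \<le> C * (M / real (Suc n))" for n
  proof -
    have "deriv_bound N R (M / real (Suc n)) (\<lambda>x. cutoffs n x - 1)"
      by (rule deriv_bound_mono[OF M(2)]) auto
    then have "norm (L (\<lambda>z. u z * (cutoffs n z - 1))) \<le> C * (M / real (Suc n))"
      using M(1) by (intro C(2) smooth_diff smooth_cutoffs smooth_const) auto
    then show ?thesis
      unfolding L_diff[OF u smooth_cutoffs smooth_const] by (simp add: mult.commute)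
  qed
  then have "(\<lambda>n. L (\<lambda>z. cutoffs n z * u z) - L u) \<longlonglongrightarrow> 0"
    by (intro Lim_null_comparison[OF _ lim]) simp
  then show ?thesis by (simp add: LIM_zero_iff)
qed

text \<open>A subsequence from Montel's theorem is enough, since L of the truncated \<open>u\<close>
  converges to \<open>L u\<close> along the full sequence. The bound keeps \<open>a\<close> free: a
  = Re z gives the growth estimate, and a fixed \<open>a\<close> gives boundedness on
  half-planes.\<close>

theorem representation:
  "\<exists>H N. \<exists>C>0. H holomorphic_on {z. Re z > 0} \<and>
     (\<forall>z a. 0 < a \<longrightarrow> a \<le> Re z \<longrightarrow> norm (H z) \<le> C * (1 + \<bar>ln a\<bar>) ^ N / a) \<and>
     (\<forall>j t. t > 0 \<longrightarrow> (- 1) ^ j * (deriv ^^ j) H (complex_of_real t) \<in> \<real>\<^sub>\<ge>\<^sub>0) \<and>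
     (\<forall>R u. u \<in> test_functions_within R \<longrightarrow>
        integrable lborel (\<lambda>x. exp x *\<^sub>R (H (complex_of_real (exp x)) * cnj (fourier u x))) \<and>
        L u = (LINT x|lborel. exp x *\<^sub>R (H (complex_of_real (exp x)) * cnj (fourier u x))))"
proof -
  let ?S = "{z. Re z > 0}"
  have S: "open ?S" by (rule open_halfspace_Re_gt)
  obtain N C where C: "C > 0" "\<And>n x. mollified n x \<le> C * (1 + \<bar>x\<bar>) ^ N"
    using mollified_bound by blast
  have bound: "norm (approx 0 n z) \<le> C * (1 + \<bar>ln a\<bar>) ^ N / a" if "0 < a" "a \<le> Re z" for n z a
  proof -
    have "norm (approx 0 n z) \<le> mollified n (ln a) / a"
      by (rule order_trans[OF norm_approx_le[OF that(2)] real_approx_le[OF that(1)]])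
    also have "\<dots> \<le> C * (1 + \<bar>ln a\<bar>) ^ N / a"
      using that by (intro divide_right_mono C) auto
    finally show ?thesis .
  qed
  have loc_bdd: "\<exists>B. \<forall>h\<in>range (approx 0). \<forall>z\<in>K. norm (h z) \<le> B" if K: "compact K" "K \<subseteq> ?S" for K
  proof (cases "K = {}")
    case False
    have "\<exists>x\<in>K. \<forall>y\<in>K. Re x \<le> Re y"
      by (rule continuous_attains_inf[OF K(1) False]) (intro continuous_intros)
    then obtain z0 where z0: "z0 \<in> K" "\<And>z. z \<in> K \<Longrightarrow> Re z0 \<le> Re z" by blast
    then have "Re z0 > 0" using K(2) by auto
    then show ?thesis using bound[of "Re z0"] z0(2) by blast
  qed simp
  obtain H r where H: "H holomorphic_on ?S" and r: "strict_mono (r :: nat \<Rightarrow> nat)"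
    and lim: "\<And>z. z \<in> ?S \<Longrightarrow> (\<lambda>n. approx 0 (r n) z) \<longlonglongrightarrow> H z"
    and ulim: "\<And>K. compact K \<Longrightarrow> K \<subseteq> ?S \<Longrightarrow> uniform_limit K (approx 0 \<circ> r) H sequentially"
    by (rule Montel[OF S, of "range (approx 0)" "approx 0"])
       (use approx_holomorphic loc_bdd in auto)
  have Hbound: "norm (H z) \<le> C * (1 + \<bar>ln a\<bar>) ^ N / a" if "0 < a" "a \<le> Re z" for z a
  proof (rule LIMSEQ_le_const2[OF tendsto_norm[OF lim]])
    show "z \<in> ?S" using that by simp
    show "\<exists>M. \<forall>n\<ge>M. norm (approx 0 (r n) z) \<le> C * (1 + \<bar>ln a\<bar>) ^ N / a" using bound[OF that] by blast
  qed
  have Hderiv: "(- 1) ^ j * (deriv ^^ j) H (complex_of_real t) \<in> \<real>\<^sub>\<ge>\<^sub>0" if t: "t > 0" for j t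
  proof -
    have sub: "cball (complex_of_real t) (t / 2) \<subseteq> ?S"
    proof
      fix z assume "z \<in> cball (complex_of_real t) (t / 2)"
      then have "\<bar>Re (complex_of_real t - z)\<bar> \<le> t / 2"
        using abs_Re_le_cmod[of "complex_of_real t - z"] by (simp add: dist_norm)
      then have "\<bar>t - Re z\<bar> \<le> t / 2" by simp
      then have "t - Re z \<le> t / 2" by (rule abs_le_D1)
      then show "z \<in> ?S" using t by simp
    qed
    \<comment> \<open>Uniform convergence on a disc inside the half-plane passes to all derivatives
      at its centre, so their signs survive in the limit.\<close>
    have "uniform_limit (ball (complex_of_real t) (t / 2)) (\<lambda>n. approx 0 (r n)) H sequentially"
      using uniform_limit_on_subset[OF ulim[OF compact_cball sub] ball_subset_cball] by (simp add: o_def)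
    then have "(\<lambda>n. (deriv ^^ j) (approx 0 (r n)) (complex_of_real t)) \<longlonglongrightarrow> (deriv ^^ j) H (complex_of_real t)"
      by (rule higher_deriv_complex_uniform_limit) (use t approx_holomorphic in auto)
    then have lim': "(\<lambda>n. (- 1) ^ j * complex_of_real ((- 1) ^ j * real_approx j (r n) t)) \<longlonglongrightarrow> (- 1) ^ j * (deriv ^^ j) H (complex_of_real t)"
      unfolding higher_deriv_approx approx_of_real by (intro tendsto_intros)
    have "(- 1) ^ j * complex_of_real ((- 1) ^ j * real_approx j (r n) t) \<in> \<real>\<^sub>\<ge>\<^sub>0" for n
      using real_approx_nonneg[of j "r n" t]
      by (simp add: mult.assoc[symmetric] power_mult_distrib[symmetric])
    from closed_sequentially[OF closed_nonneg_Reals_complex this lim'] show ?thesis .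
  qed
  have Lrep: "integrable lborel (\<lambda>x. exp x *\<^sub>R (H (complex_of_real (exp x)) * cnj (fourier u x))) \<and>
        L u = (LINT x|lborel. exp x *\<^sub>R (H (complex_of_real (exp x)) * cnj (fourier u x)))"
    if u: "u \<in> test_functions_within R" for u R
  proof -
    let ?c = "1 / sqrt (2 * pi)"
    have Z: "rapid (fourier u)" by (rule rapid_Z_space[OF fourier_Z_space[OF u]])
    have [measurable]: "fourier u \<in> borel_measurable borel" by (rule rapid_measurable[OF Z])
    have cont: "continuous_on UNIV (\<lambda>x. H (complex_of_real (exp x)))"
      by (intro continuous_on_compose2[OF holomorphic_on_imp_continuous_on[OF H]] continuous_intros) auto
    have [measurable]: "(\<lambda>x. H (complex_of_real (exp x))) \<in> borel_measurable borel"
      by (rule borel_measurable_continuous_onI[OF cont])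
    have [measurable]: "mollified n \<in> borel_measurable borel" for n
    proof -
      have "continuous_on UNIV (\<lambda>x. Re (L (\<lambda>z. cutoffs n z * osc x z)))"
        by (intro continuous_at_imp_continuous_on ballI isCont_Re continuous_L_osc[OF cutoffs_test])
      then show ?thesis
        unfolding mollified_eq[symmetric] by (simp add: borel_measurable_continuous_onI)
    qed
    have w: "integrable lborel (\<lambda>x. C * ((1 + \<bar>x\<bar>) ^ N * norm (fourier u x)))"
      by (rule integrable_mult_right[OF rapid_integrable_weight[OF Z]])
    \<comment> \<open>At t = exp x the approximants tend to \<open>H\<close>, and they differ from
      the scaled mollified densities by a null sequence; the factor exp x cancels the division by
      \<open>t\<close>.\<close>
    have pw: "(\<lambda>n. cnj (fourier u x) * complex_of_real (?c * mollified (r n) x))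
        \<longlonglongrightarrow> exp x *\<^sub>R (H (complex_of_real (exp x)) * cnj (fourier u x))" for x
    proof -
      have "(\<lambda>n. complex_of_real (real_approx 0 (r n) (exp x) - ?c / exp x * mollified (r n) x)) \<longlonglongrightarrow> complex_of_real 0"
        using LIMSEQ_subseq_LIMSEQ[OF real_approx_tendsto_diff[of "exp x"] r]
        by (intro tendsto_of_real) (simp add: o_def)
      moreover have "(\<lambda>n. complex_of_real (real_approx 0 (r n) (exp x))) \<longlonglongrightarrow> H (complex_of_real (exp x))"
        using lim[of "complex_of_real (exp x)"] by (simp add: approx_of_real)
      ultimately have "(\<lambda>n. complex_of_real (real_approx 0 (r n) (exp x)) -
          complex_of_real (real_approx 0 (r n) (exp x) - ?c / exp x * mollified (r n) x)) \<longlonglongrightarrow> H (complex_of_real (exp x)) - complex_of_real 0"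
        by (intro tendsto_diff)
      then have "(\<lambda>n. complex_of_real (?c / exp x * mollified (r n) x)) \<longlonglongrightarrow> H (complex_of_real (exp x))"
        by simp
      then have "(\<lambda>n. complex_of_real (exp x) * cnj (fourier u x) * complex_of_real (?c / exp x * mollified (r n) x))
          \<longlonglongrightarrow> complex_of_real (exp x) * cnj (fourier u x) * H (complex_of_real (exp x))"
        by (intro tendsto_mult tendsto_const)
      moreover have "complex_of_real (exp x) * cnj (fourier u x) * complex_of_real (?c / exp x * mollified (r n) x) =
          cnj (fourier u x) * complex_of_real (?c * mollified (r n) x)" for n
      proof -
        have "complex_of_real (exp x) * complex_of_real (?c / exp x * mollified (r n) x) = complex_of_real (?c * mollified (r n) x)"
          unfolding of_real_mult[symmetric] by (simp del: of_real_mult)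
        then show ?thesis by (metis mult.assoc mult.commute)
      qed
      ultimately show ?thesis by (simp only: scaleR_conv_of_real mult_ac)
    qed
    \<comment> \<open>The polynomial bound on the mollified densities is uniform in
      \<open>n\<close>, and the transform of \<open>u\<close> is rapid, so one majorant serves both
      the limit and the integrability of the limit function.\<close>
    have dom: "norm (cnj (fourier u x) * complex_of_real (?c * mollified n x)) \<le> C * ((1 + \<bar>x\<bar>) ^ N * norm (fourier u x))" for n x
    proof -
      have "?c * mollified n x \<le> 1 * (C * (1 + \<bar>x\<bar>) ^ N)"
        using pi_gt3 by (intro mult_mono C(2) mollified_nonneg) auto
      then have "norm (fourier u x) * (?c * mollified n x) \<le> norm (fourier u x) * (C * (1 + \<bar>x\<bar>) ^ N)"
        by (intro mult_left_mono) auto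
      moreover have "norm (cnj (fourier u x) * complex_of_real (?c * mollified n x)) = norm (fourier u x) * (?c * mollified n x)"
        using mollified_nonneg[of n x] by (simp add: norm_mult norm_divide)
      ultimately show ?thesis by (simp only: mult_ac)
    qed
    have int: "integrable lborel (\<lambda>x. exp x *\<^sub>R (H (complex_of_real (exp x)) * cnj (fourier u x)))"
      by (rule integrable_dominated_convergence[OF _ _ w, where s = "\<lambda>n x. cnj (fourier u x) * complex_of_real (?c * mollified (r n) x)"])
         (use pw dom in auto)
    have "(\<lambda>n. LINT x|lborel. cnj (fourier u x) * complex_of_real (?c * mollified (r n) x)) \<longlonglongrightarrow>
       (LINT x|lborel. exp x *\<^sub>R (H (complex_of_real (exp x)) * cnj (fourier u x)))"
      by (rule integral_dominated_convergence[OF _ _ w]) (use pw dom in auto)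
    moreover have "(\<lambda>n. LINT x|lborel. cnj (fourier u x) * complex_of_real (?c * mollified (r n) x)) \<longlonglongrightarrow> L u"
      using LIMSEQ_subseq_LIMSEQ[OF L_cutoffs_tendsto[OF u] r] unfolding fourier_L_cutoffs[OF u] o_def .
    ultimately show ?thesis using int LIMSEQ_unique by blast
  qed
  show ?thesis
    using H Hbound Hderiv Lrep C(1) by blast
qed

end

section \<open>Derivatives along the positive axis and assembly of the result\<close>

lemma nth_vderiv_Re_holomorphic:
  assumes H: "H holomorphic_on {z. Re z > 0}" and t: "t > 0"
  shows "(nth_vderiv j (\<lambda>t. Re (H (complex_of_real t))) has_vector_derivative
     Re ((deriv ^^ Suc j) H (complex_of_real t))) (at t)"
    and "nth_vderiv j (\<lambda>t. Re (H (complex_of_real t))) t = Re ((deriv ^^ j) H (complex_of_real t))"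
proof -
  let ?k = "\<lambda>t. Re (H (complex_of_real t))"
  have S: "open {z. Re z > 0}" by (rule open_halfspace_Re_gt)
  have der: "((\<lambda>t. Re ((deriv ^^ j) H (complex_of_real t))) has_vector_derivative
     Re ((deriv ^^ Suc j) H (complex_of_real t))) (at t)" if "t > 0" for j t
  proof -
    have "(deriv ^^ j) H holomorphic_on {z. Re z > 0}" by (rule holomorphic_higher_deriv[OF H S])
    then have "((deriv ^^ j) H has_field_derivative (deriv ^^ Suc j) H (complex_of_real t)) (at (complex_of_real t))"
      using holomorphic_derivI[OF _ S, of "(deriv ^^ j) H" "complex_of_real t"] that by simp
    then have "((\<lambda>t. (deriv ^^ j) H (complex_of_real t)) has_vector_derivative (deriv ^^ Suc j) H (complex_of_real t)) (at t)"
      by (rule has_vector_derivative_real_field)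
    then show ?thesis by (rule bounded_linear.has_vector_derivative[OF bounded_linear_Re])
  qed
  have eq: "\<forall>t>0. nth_vderiv j ?k t = Re ((deriv ^^ j) H (complex_of_real t))" for j
  proof (induction j)
    case (Suc j)
    show ?case
    proof (intro allI impI)
      fix t :: real assume t: "t > 0"
      have "(nth_vderiv j ?k has_vector_derivative Re ((deriv ^^ Suc j) H (complex_of_real t))) (at t)"
        by (rule has_vector_derivative_transform_within_open[OF der[OF t], of "{0<..}"]) (use t Suc in auto)
      then show "nth_vderiv (Suc j) ?k t = Re ((deriv ^^ Suc j) H (complex_of_real t))"
        unfolding nth_vderiv_Suc' by (rule vector_derivative_at)
    qed
  qed simp
  show "nth_vderiv j ?k t = Re ((deriv ^^ j) H (complex_of_real t))" using eq t by blast
  show "(nth_vderiv j ?k has_vector_derivative Re ((deriv ^^ Suc j) H (complex_of_real t))) (at t)"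
    by (rule has_vector_derivative_transform_within_open[OF der[OF t], of "{0<..}"]) (use t eq in auto)
qed

text \<open>Multiplication by the entire function \<open>rGamma\<close> preserves smoothness and
  support, so every \<open>g\<close> yields an admissible \<open>f\<close>, namely
  \<open>dfun u\<close>. The positive constant from the normalization of the transform is divided
  out at the end.\<close>

lemma positive_distribution_zfun:
  assumes "h \<in> Zplus_dual"
    and pos: "\<And>f. f \<in> D_space \<Longrightarrow> h ((\<lambda>s. cnj (f s)) \<star> f) \<in> \<real>\<^sub>\<ge>\<^sub>0"
  shows "positive_distribution (\<lambda>u. h (zfun u))"
proof -
  interpret antilinear_distribution "\<lambda>u. h (zfun u)"
    by (rule antilinear_distribution_zfun[OF assms(1)])
  show ?thesis
  proof
    fix g R assume g: "g \<in> test_functions_within R"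
    define u where "u = (\<lambda>x. g x * rGamma (1 / 2 - \<i> * complex_of_real x))"
    have u: "u \<in> test_functions_within R"
      unfolding u_def using test_functions_within_mult[OF g smooth_entire[OF holomorphic_rGamma, of "- \<i>" "1 / 2"]]
      by simp
    let ?c = "complex_of_real (1 / sqrt (2 * pi))"
    have w: "(\<lambda>z. autocorr g z * rg z) \<in> test_functions_within (2 * R)"
      by (intro test_functions_within_mult autocorr_test g smooth_rg)
    have "?c * h (zfun (\<lambda>z. autocorr g z * rg z)) = h (zfun (\<lambda>z. ?c * (autocorr g z * rg z)))"
      using L_cmult[OF w, of ?c] by simp
    also have "\<dots> = h ((\<lambda>s. cnj (dfun u s)) \<star> dfun u)"
      unfolding laplace_conv_dfun_eq_zfun[OF g u_def] ..
    also have "\<dots> \<in> \<real>\<^sub>\<ge>\<^sub>0" by (rule pos[OF dfun_D_space[OF u]])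
    finally have *: "?c * h (zfun (\<lambda>z. autocorr g z * rg z)) \<in> \<real>\<^sub>\<ge>\<^sub>0" .
    have "complex_of_real (sqrt (2 * pi)) \<in> \<real>\<^sub>\<ge>\<^sub>0" unfolding nonneg_Reals_of_real_iff by simp
    from nonneg_Reals_mult_I[OF this *]
    have "complex_of_real (sqrt (2 * pi)) * (?c * h (zfun (\<lambda>z. autocorr g z * rg z))) \<in> \<real>\<^sub>\<ge>\<^sub>0" .
    moreover have "complex_of_real (sqrt (2 * pi)) * (?c * w) = w" for w by simp
    ultimately show "h (zfun (\<lambda>z. autocorr g z * rg z)) \<in> \<real>\<^sub>\<ge>\<^sub>0" by (simp only:)
  qed
qed

theorem corollary4p8:
  fixes h :: "(real \<Rightarrow> complex) \<Rightarrow> complex"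
  assumes "h \<in> Zplus_dual"
    and "real_distribution h"
    and "\<And>f. f \<in> D_space \<Longrightarrow> h ((\<lambda>s. cnj (f s)) \<star> f) \<in> \<real>\<^sub>\<ge>\<^sub>0"
  shows "\<exists>k :: real \<Rightarrow> real.
      identified_with h (\<lambda>t. complex_of_real (k t)) \<and>
      C_infinity_on {0<..} k \<and>
      (\<forall>n. \<forall>t>0. (- 1) ^ n * nth_vderiv n k t \<ge> 0) \<and>
      (\<exists>H. H holomorphic_on {z. Re z > 0} \<and>
           (\<forall>t>0. H (complex_of_real t) = complex_of_real (k t)) \<and>
           (\<forall>t1 t2. 0 < t1 \<longrightarrow> t1 < t2 \<longrightarrow> bounded (H ` {z. t1 < Re z \<and> Re z < t2}))) \<and>
      (\<exists>\<kappa>::real. \<exists>C>0. \<forall>t>0. k t \<le> C * t powr (- 1) * (1 + \<bar>ln t\<bar>) powr \<kappa>)"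
proof -
  interpret positive_distribution "\<lambda>u. h (zfun u)"
    by (rule positive_distribution_zfun[OF assms(1,3)])
  obtain H N C where C: "C > 0" and H: "H holomorphic_on {z. Re z > 0}"
    and bound: "\<And>z a. 0 < a \<Longrightarrow> a \<le> Re z \<Longrightarrow> norm (H z) \<le> C * (1 + \<bar>ln a\<bar>) ^ N / a"
    and deriv: "\<And>j t. t > 0 \<Longrightarrow> (- 1) ^ j * (deriv ^^ j) H (complex_of_real t) \<in> \<real>\<^sub>\<ge>\<^sub>0"
    and rep: "\<And>R u. u \<in> test_functions_within R \<Longrightarrow>
        integrable lborel (\<lambda>x. exp x *\<^sub>R (H (complex_of_real (exp x)) * cnj (fourier u x))) \<and>
        h (zfun u) = (LINT x|lborel. exp x *\<^sub>R (H (complex_of_real (exp x)) * cnj (fourier u x)))"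
    using representation by blast
  define k where "k t = Re (H (complex_of_real t))" for t
  \<comment> \<open>The sign condition of order zero includes reality, so passing to the real part
    loses nothing on the positive axis.\<close>
  have Hk: "H (complex_of_real t) = complex_of_real (k t)" if "t > 0" for t
    using deriv[OF that, of 0] by (auto simp: k_def complex_nonneg_Reals_iff complex_eq_iff)
  note kd = nth_vderiv_Re_holomorphic[OF H, folded k_def[abs_def]]
  have "identified_with h (\<lambda>t. complex_of_real (k t))"
    unfolding identified_with_def
  proof
    fix F assume "F \<in> Zplus"
    then obtain u R where u: "u \<in> test_functions_within R" and F: "F = zfun u" by (rule Zplus_zfun)
    \<comment> \<open>The indicator is built in because nothing is known about \<open>k\<close> at
      nonpositive arguments, while the substitution t = exp x asks for measurability on the whole
      line.\<close>
    let ?f = "\<lambda>t. indicator {0<..} t *\<^sub>R (complex_of_real (k t) * cnj (F t))"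
    have Fexp: "exp x *\<^sub>R ?f (exp x) = exp x *\<^sub>R (H (complex_of_real (exp x)) * cnj (fourier u x))" for x
      by (simp add: F zfun_def Hk)
    have "continuous_on {0<..} (\<lambda>t. complex_of_real (k t) * cnj (F t))"
    proof -
      have "continuous_on {0<..} (\<lambda>t. H (complex_of_real t) * cnj (fourier u (ln t)))"
        by (intro continuous_intros continuous_on_compose2[OF holomorphic_on_imp_continuous_on[OF H]]
            continuous_on_compose2[OF Z_space_continuous[OF fourier_Z_space[OF u], of UNIV]]) auto
      then show ?thesis by (rule continuous_on_eq) (simp add: F zfun_def Hk)
    qed
    then have meas: "?f \<in> borel_measurable borel"
      by (rule borel_measurable_continuous_on_indicator[rotated]) simp
    have ff: "set_integrable lborel {0<..} ?f \<longleftrightarrow> set_integrable lborel {0<..} (\<lambda>t. complex_of_real (k t) * cnj (F t))"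
    proof -
      have "(\<lambda>t. indicator {0<..} t *\<^sub>R ?f t) = ?f" by (auto simp: indicator_def)
      then show ?thesis unfolding set_integrable_def by (simp only:)
    qed
    have fi: "set_integrable lborel {0<..} ?f"
      unfolding set_integrable_exp_subst[OF meas] Fexp using rep[OF u] by blast
    have "h F = (LINT t:{0<..}|lborel. ?f t)"
      unfolding integral_exp_subst[OF meas fi] Fexp using rep[OF u] F by blast
    also have "\<dots> = (LINT t:{0<..}|lborel. complex_of_real (k t) * cnj (F t))"
      unfolding set_lebesgue_integral_def by (intro Bochner_Integration.integral_cong) (auto simp: indicator_def)
    finally show "set_integrable lborel {0<..} (\<lambda>t. complex_of_real (k t) * cnj (F t)) \<and>
         h F = (LINT t:{0<..}|lborel. complex_of_real (k t) * cnj (F t))"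
      using fi ff by blast
  qed
  moreover have "C_infinity_on {0<..} k"
    unfolding C_infinity_on_def using kd(1) by (auto intro: differentiableI_vector)
  moreover have "(- 1) ^ n * nth_vderiv n k t \<ge> 0" if "t > 0" for n t
  proof -
    have "Re ((- 1) ^ n * (deriv ^^ n) H (complex_of_real t)) \<ge> 0"
      using deriv[OF that, of n] by (simp add: complex_nonneg_Reals_iff)
    moreover have "Re ((- 1) ^ n * z) = (- 1) ^ n * Re z" for z
      by (cases "even n") auto
    ultimately show ?thesis by (simp add: kd(2)[OF that])
  qed
  moreover have "bounded (H ` {z. t1 < Re z \<and> Re z < t2})" if "0 < t1" for t1 t2
    unfolding bounded_iff using bound[OF that] by (intro exI[of _ "C * (1 + \<bar>ln t1\<bar>) ^ N / t1"]) auto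
  moreover have "k t \<le> C * t powr (- 1) * (1 + \<bar>ln t\<bar>) powr real N" if "t > 0" for t
  proof -
    have "k t \<le> norm (H (complex_of_real t))" unfolding k_def by (rule complex_Re_le_cmod)
    also have "\<dots> \<le> C * (1 + \<bar>ln t\<bar>) ^ N / t" using bound[of t "complex_of_real t"] that by simp
    also have "\<dots> = C * t powr (- 1) * (1 + \<bar>ln t\<bar>) powr real N"
      using that by (simp add: powr_realpow powr_minus divide_inverse add_pos_nonneg)
    finally show ?thesis .
  qed
  ultimately show ?thesis using H Hk C by blast
qed

end
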